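(* Let $\xi=(a,b)\in\mathbb{R}^d\times\mathbb{R}$ be random of law $\mathcal{P}$, let $f(x)=\mathbb{E}\big[\frac12(b-\langle x,a\rangle)^2\big]$ for $x\in\mathbb{R}^d$, minimized at $x_*\in\mathbb{R}^d$, and assume that $b=\langle x_*,a\rangle$ almost surely. Let $H=\mathbb{E}[aa^\top]$ be the Hessian of $f$, and let $R^2$ and $\tilde\kappa$ be the smallest positive reals such that $$\mathbb{E}\big[\|a\|^2aa^\top\big]\preccurlyeq R^2H,\qquad \mathbb{E}\big[\|a\|^2_{H^{-1}}aa^\top\big]\preccurlyeq\tilde\kappa H.$$ Let $\nabla f(x,\xi)=-(b-\langle x,a\rangle)a$ for $\xi=(a,b)$, and let $(x_t,z_t)_{t\ge0}$ be the càdlàg process with initial values $x_0,z_0\in\mathbb{R}^d$ satisfying $$\mathrm{d}x_t=\eta_t(z_t-x_t)\,\mathrm{d}t-\gamma_t\int\nabla f(x_t,\xi)\,\mathrm{d}N(t,\xi),\qquad \mathrm{d}z_t=\eta'_t(x_t-z_t)\,\mathrm{d}t-\gamma'_t\int\nabla f(x_t,\xi)\,\mathrm{d}N(t,\xi),$$ where $N$ is a Poisson point measure on $\mathbb{R}_{\ge0}\times(\mathbb{R}^d\times\mathbb{R})$ with intensity $\mathrm{d}t\otimes\mathcal{P}$. Then: 1. For $\eta_t=\frac2t$, $\eta'_t=0$, $\gamma_t=\frac1{R^2}$, $\gamma'_t=\frac{t}{2R^2\tilde\kappa}$, $$\frac12\mathbb{E}\|x_t-x_*\|^2\le\frac{R^2\tilde\kappa\,\|z_0-x_*\|^2_{H^{-1}}}{t^2}.$$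 2. Assume further that $f$ is $\mu$-strongly convex, i.e. all eigenvalues of $H$ are greater than or equal to $\mu$, where $\mu>0$, and let $\kappa=R^2/\mu$. For $\eta_t=\eta'_t=\frac1{\sqrt{\kappa\tilde\kappa}}$, $\gamma_t=\frac1{R^2}$, $\gamma'_t=\frac1{R^2}\sqrt{\frac{\kappa}{\tilde\kappa}}$, $$\frac12\mathbb{E}\|x_t-x_*\|^2\le\Big(\frac12\|x_0-x_*\|^2+\frac\mu2\|z_0-x_*\|^2_{H^{-1}}\Big)\exp\Big(-\frac{t}{\sqrt{\kappa\tilde\kappa}}\Big).$$
   Context: For a symmetric nonnegative matrix $A$, $\|x\|_A^2=x^\top Ax$; $\preccurlyeq$ is the Loewner order on symmetric matrices. The Poisson point measure is $\mathrm{d}N(t,\xi)=\sum_{k\ge1}\delta_{(T_k,\xi_k)}(\mathrm{d}t,\mathrm{d}\xi)$ where $T_1,T_2-T_1,T_3-T_2,\dots$ are i.i.d. exponential of rate $1$ and $\xi_1,\xi_2,\dots$ are i.i.d. of law $\mathcal{P}$, independent of the $T_k$. The stochastic equation means: the processes are càdlàg (right continuous with left limits); at each $T_k$, $x_{T_k}=x_{T_k-}-\gamma_{T_k}\nabla f(x_{T_k-},\xi_k)$ and $z_{T_k}=z_{T_k-}-\gamma'_{T_k}\nabla f(x_{T_k-},\xi_k)$, with $x_{t-},z_{t-}$ left limits; between these times, $\mathrm{d}x_t=\eta_t(z_t-x_t)\,\mathrm{d}t$, $\mathrm{d}z_t=\eta'_t(x_t-z_t)\,\mathrm{d}t$. 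*)

theory Defs
  imports "HOL-Probability.Probability"
begin

definition outer :: "real^'d \<Rightarrow> real^'d^'d" where
  "outer a = (\<chi> i j. a $ i * a $ j)"

definition qnorm2 :: "real^'d^'d \<Rightarrow> real^'d \<Rightarrow> real" where
  "qnorm2 A x = x \<bullet> (A *v x)"

definition loewner_le :: "real^'d^'d \<Rightarrow> real^'d^'d \<Rightarrow> bool" where
  "loewner_le A B \<longleftrightarrow>
     transpose A = A \<and> transpose B = B \<and> (\<forall>x. 0 \<le> x \<bullet> ((B - A) *v x))"

definition eigenvalue :: "real^'d^'d \<Rightarrow> real \<Rightarrow> bool" where
  "eigenvalue A c \<longleftrightarrow> (\<exists>v. v \<noteq> 0 \<and> A *v v = c *\<^sub>R v)"

definition smallest_positive :: "(real \<Rightarrow> bool) \<Rightarrow> real \<Rightarrow> bool" where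
  "smallest_positive Q r \<longleftrightarrow> 0 < r \<and> Q r \<and> (\<forall>s>0. Q s \<longrightarrow> r \<le> s)"

text \<open>A sample is a pair (a, b); the measure P is its law.\<close>

definition risk :: "((real^'d) \<times> real) measure \<Rightarrow> real^'d \<Rightarrow> real" where
  "risk P x = (\<integral>\<xi>. 1/2 * (snd \<xi> - x \<bullet> fst \<xi>)\<^sup>2 \<partial>P)"

definition sgrad :: "real^'d \<Rightarrow> (real^'d) \<times> real \<Rightarrow> real^'d" where
  "sgrad x \<xi> = - (snd \<xi> - x \<bullet> fst \<xi>) *\<^sub>R fst \<xi>"

definition hessian :: "((real^'d) \<times> real) measure \<Rightarrow> real^'d^'d" where
  "hessian P = (\<integral>\<xi>. outer (fst \<xi>) \<partial>P)"

text \<open>The points of the Poisson measure are numbered from 0 here: the pair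
  (T k, \<xi> k) is the (k+1)-st point in order of time.\<close>

definition gap :: "(nat \<Rightarrow> 'w \<Rightarrow> real) \<Rightarrow> nat \<Rightarrow> 'w \<Rightarrow> real" where
  "gap T k \<omega> = (case k of 0 \<Rightarrow> T 0 \<omega> | Suc j \<Rightarrow> T (Suc j) \<omega> - T j \<omega>)"

definition marked_poisson ::
    "'w measure \<Rightarrow> 'b measure \<Rightarrow> (nat \<Rightarrow> 'w \<Rightarrow> real) \<Rightarrow> (nat \<Rightarrow> 'w \<Rightarrow> 'b) \<Rightarrow> bool" where
  "marked_poisson M P T \<xi> \<longleftrightarrow>
     prob_space.indep_vars M (\<lambda>_. borel) (gap T) UNIV \<and>
     (\<forall>k. distributed M lborel (gap T k) (exponential_density 1)) \<and>
     prob_space.indep_vars M (\<lambda>_. P) \<xi> UNIV \<and>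
     (\<forall>k. distr M P (\<xi> k) = P) \<and>
     prob_space.indep_set M
       (sets (vimage_algebra (space M) (\<lambda>\<omega> k. T k \<omega>) (PiM UNIV (\<lambda>_. borel))))
       (sets (vimage_algebra (space M) (\<lambda>\<omega> k. \<xi> k \<omega>) (PiM UNIV (\<lambda>_. P))))"

definition left_lim :: "(real \<Rightarrow> 'a::t2_space) \<Rightarrow> real \<Rightarrow> 'a" where
  "left_lim f t = Lim (at_left t) f"

definition cadlag :: "(real \<Rightarrow> 'a::t2_space) \<Rightarrow> bool" where
  "cadlag f \<longleftrightarrow> (\<forall>t\<ge>0. (f \<longlongrightarrow> f t) (at_right t)) \<and> (\<forall>t>0. \<exists>l. (f \<longlongrightarrow> l) (at_left t))"

text \<open>One trajectory, driven by the points (T k, \<xi> k). The differential equations are imposed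
  at positive times only, since coefficients such as 2/t are singular at 0.\<close>

definition continuized_path ::
    "(real \<Rightarrow> real) \<Rightarrow> (real \<Rightarrow> real) \<Rightarrow> (real \<Rightarrow> real) \<Rightarrow> (real \<Rightarrow> real) \<Rightarrow>
     (nat \<Rightarrow> real) \<Rightarrow> (nat \<Rightarrow> (real^'d) \<times> real) \<Rightarrow>
     (real \<Rightarrow> real^'d) \<Rightarrow> (real \<Rightarrow> real^'d) \<Rightarrow> bool" where
  "continuized_path \<eta> \<eta>' \<gamma> \<gamma>' T \<xi> x z \<longleftrightarrow>
     cadlag x \<and> cadlag z \<and>
     (\<forall>k. x (T k) = left_lim x (T k) - \<gamma> (T k) *\<^sub>R sgrad (left_lim x (T k)) (\<xi> k) \<and>
          z (T k) = left_lim z (T k) - \<gamma>' (T k) *\<^sub>R sgrad (left_lim x (T k)) (\<xi> k)) \<and>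
     (\<forall>t>0. t \<notin> range T \<longrightarrow>
        (x has_vector_derivative \<eta> t *\<^sub>R (z t - x t)) (at t) \<and>
        (z has_vector_derivative \<eta>' t *\<^sub>R (x t - z t)) (at t))"

definition continuized_process ::
    "'w measure \<Rightarrow> (nat \<Rightarrow> 'w \<Rightarrow> real) \<Rightarrow> (nat \<Rightarrow> 'w \<Rightarrow> (real^'d) \<times> real) \<Rightarrow>
     (real \<Rightarrow> real) \<Rightarrow> (real \<Rightarrow> real) \<Rightarrow> (real \<Rightarrow> real) \<Rightarrow> (real \<Rightarrow> real) \<Rightarrow>
     real^'d \<Rightarrow> real^'d \<Rightarrow>
     (real \<Rightarrow> 'w \<Rightarrow> real^'d) \<Rightarrow> (real \<Rightarrow> 'w \<Rightarrow> real^'d) \<Rightarrow> bool" where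
  "continuized_process M T \<xi> \<eta> \<eta>' \<gamma> \<gamma>' x0 z0 x z \<longleftrightarrow>
     (\<forall>t\<ge>0. x t \<in> borel_measurable M \<and> z t \<in> borel_measurable M) \<and>
     (AE \<omega> in M. x 0 \<omega> = x0 \<and> z 0 \<omega> = z0 \<and>
        continuized_path \<eta> \<eta>' \<gamma> \<gamma>' (\<lambda>k. T k \<omega>) (\<lambda>k. \<xi> k \<omega>) (\<lambda>t. x t \<omega>) (\<lambda>t. z t \<omega>))"

end

theory Submission
  imports Defs
begin

text \<open>
  Between jumps the process follows a linear flow, and the marks at the jumps are independent
  of the past. Decomposing at the first jump shows that a nonnegative function \<open>U\<close> of time and state that satisfies
  the integrated inequality for the generator (a supersolution) bounds the expectation of its terminal
  value by its initial value; no martingale theory is needed. After centring at the optimum, \<open>U\<close> is taken to be a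
  time-dependent combination of \<open>\<parallel>x\<parallel>\<^sup>2\<close>, \<open>\<parallel>z\<parallel>\<^sup>2\<close> and \<open>\<parallel>z - x\<parallel>\<^sup>2\<close>, the last two in the norm of the inverse
  Hessian. The two constants \<open>R2\<close> and \<open>\<kappa>'\<close> control the second-order terms of a jump.

  For strongly convex \<open>f\<close> the weights are \<open>1/2\<close>, \<open>\<mu>/2\<close> and \<open>0\<close>, multiplied by an exponential.
  In the other case the constant weight on \<open>\<parallel>z\<parallel>\<^sup>2\<close> loses a factor \<open>2\<close>. The singular drift
  \<open>2 / t\<close> makes the weight of \<open>\<parallel>x\<parallel>\<^sup>2\<close> vanish at \<open>0\<close>; the factor is recovered by
  weights that depend on the final time \<open>T\<close>: the term in \<open>z - x\<close> is built up, saturated, and dropped shortly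
  before \<open>T\<close>, while the weight of \<open>\<parallel>z\<parallel>\<^sup>2\<close> may decrease to a nonnegative value at \<open>T\<close>.
\<close>

section \<open>First-jump decomposition\<close>

text \<open>The norm of the inverse Hessian is chosen because \<open>Hi\<close> cancels
  \<open>H\<close> on average: the first-order effect of a jump on \<open>q z\<close> is a plain
  inner product of \<open>z\<close> and \<open>x\<close>, of the same kind as the drift of the
  squared norm of \<open>x\<close>.

  The factor 2 is found as follows. Let \<theta> be time in the unit \<kappa>', and let
  \<open>S\<close>, \<open>b\<close>, \<open>k\<close> be the rescaled weights. The constant choice
  \<open>S = b = 1\<close>, \<open>k = 0\<close> removes every cross term, but the squared norm of
  \<open>x\<close> only asks for \<theta> S' + 2 S \<le> 4 b, so half of the room is wasted:
  \<open>S\<close> could approach 2 b, and the stated rate needs \<open>S = 2\<close> at the end. An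
  excess of \<open>S\<close> over \<open>b\<close> creates a cross term of \<open>z - x\<close> and
  \<open>x\<close>, which the decay of the \<open>k\<close> term can absorb. A jump moves
  \<open>z - x\<close> in proportion to \<theta> / 2 - 1, so before \<theta> = 2 it moves against
  \<open>z\<close>, and building up \<open>k\<close> there costs some \<open>b\<close>; after 2 the
  sign is favourable and \<open>S\<close> grows at constant \<open>b\<close>. At the final time only
  \<open>S\<close> counts, so what is left of \<open>b\<close> pays for the last increase of
  \<open>S\<close>.\<close>

abbreviation exp_law :: "real measure" where
  "exp_law \<equiv> density lborel (\<lambda>x. ennreal (exponential_density 1 x))"

lemma prob_space_exp_law: "prob_space exp_law"
  using prob_space_exponential_density[of 1] by simp

lemma nn_integral_sequence_space:
  assumes "prob_space Q"
    and f: "f \<in> borel_measurable (PiM (UNIV :: nat set) (\<lambda>_. Q))"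
  shows "(\<integral>\<^sup>+g. f g \<partial>PiM UNIV (\<lambda>_. Q)) =
         (\<integral>\<^sup>+u. \<integral>\<^sup>+g. f (case_nat u g) \<partial>PiM UNIV (\<lambda>_. Q) \<partial>Q)"
proof -
  interpret Q: prob_space Q by fact
  interpret S: product_prob_space "\<lambda>_::nat. Q" UNIV ..
  interpret S: sequence_space Q ..
  have "(\<integral>\<^sup>+g. f g \<partial>PiM UNIV (\<lambda>_. Q))
      = (\<integral>\<^sup>+g. f g \<partial>distr (Q \<Otimes>\<^sub>M PiM UNIV (\<lambda>_. Q)) (PiM UNIV (\<lambda>_. Q)) (\<lambda>(s, \<omega>). case_nat s \<omega>))"
    by (subst S.PiM_iter) simp
  also have "\<dots> = (\<integral>\<^sup>+p. f (case p of (s, \<omega>) \<Rightarrow> case_nat s \<omega>) \<partial>(Q \<Otimes>\<^sub>M PiM UNIV (\<lambda>_. Q)))"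
    by (rule nn_integral_distr) (use f in \<open>measurable\<close>)
  also have "\<dots> = (\<integral>\<^sup>+u. \<integral>\<^sup>+g. f (case_nat u g) \<partial>PiM UNIV (\<lambda>_. Q) \<partial>Q)"
    by (subst S.P.nn_integral_fst[symmetric]) (use f in \<open>measurable\<close>)
  finally show ?thesis .
qed

text \<open>Terminal value along the trajectory with gaps \<open>g\<close> and marks \<open>a\<close>, truncated: it is \<open>0\<close>
  when \<open>n\<close> or more jumps occur up to time \<open>t\<close>, so it increases to the true value with \<open>n\<close>.\<close>

primrec jump_value ::
    "(real \<Rightarrow> real \<Rightarrow> 's \<Rightarrow> 's) \<Rightarrow> (real \<Rightarrow> 'm \<Rightarrow> 's \<Rightarrow> 's) \<Rightarrow> real \<Rightarrow> ('s \<Rightarrow> ennreal) \<Rightarrow>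
     nat \<Rightarrow> real \<Rightarrow> 's \<Rightarrow> (nat \<Rightarrow> real) \<Rightarrow> (nat \<Rightarrow> 'm) \<Rightarrow> ennreal" where
  "jump_value F J t \<phi> 0 s w g a = 0"
| "jump_value F J t \<phi> (Suc n) s w g a =
     (if t < s + g 0 then \<phi> (F s t w)
      else jump_value F J t \<phi> n (s + g 0) (J (s + g 0) (a 0) (F s (s + g 0) w))
             (\<lambda>k. g (Suc k)) (\<lambda>k. a (Suc k)))"

text \<open>\<open>F s t w\<close> is the state at time \<open>t\<close> of the deterministic flow
  that leaves \<open>w\<close> at time \<open>s\<close>; \<open>J u a w\<close> is the state after a
  jump at time \<open>u\<close> with mark \<open>a\<close>.\<close>

locale jump_flow = prob_space P for P :: "'m measure" +
  fixes N :: "'s measure"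
    and F :: "real \<Rightarrow> real \<Rightarrow> 's \<Rightarrow> 's"
    and J :: "real \<Rightarrow> 'm \<Rightarrow> 's \<Rightarrow> 's"
  assumes space_N: "space N = UNIV"
    and F_measurable: "(\<lambda>(s, t, w). F s t w) \<in> borel \<Otimes>\<^sub>M borel \<Otimes>\<^sub>M N \<rightarrow>\<^sub>M N"
    and J_measurable: "(\<lambda>(u, a, w). J u a w) \<in> borel \<Otimes>\<^sub>M P \<Otimes>\<^sub>M N \<rightarrow>\<^sub>M N"
begin

lemma F_meas [measurable (raw)]:
  assumes "f \<in> X \<rightarrow>\<^sub>M borel" "g \<in> X \<rightarrow>\<^sub>M borel" "h \<in> X \<rightarrow>\<^sub>M N"
  shows "(\<lambda>x. F (f x) (g x) (h x)) \<in> X \<rightarrow>\<^sub>M N"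
  using measurable_compose[OF measurable_Pair[OF assms(1) measurable_Pair[OF assms(2,3)]] F_measurable]
  by simp

lemma J_meas [measurable (raw)]:
  assumes "f \<in> X \<rightarrow>\<^sub>M borel" "g \<in> X \<rightarrow>\<^sub>M P" "h \<in> X \<rightarrow>\<^sub>M N"
  shows "(\<lambda>x. J (f x) (g x) (h x)) \<in> X \<rightarrow>\<^sub>M N"
  using measurable_compose[OF measurable_Pair[OF assms(1) measurable_Pair[OF assms(2,3)]] J_measurable]
  by simp

abbreviation "gaps \<equiv> PiM (UNIV :: nat set) (\<lambda>_. exp_law)"
abbreviation "marks \<equiv> PiM (UNIV :: nat set) (\<lambda>_. P)"

lemma jump_value_meas [measurable (raw)]:
  assumes "\<phi> \<in> borel_measurable N" "s \<in> X \<rightarrow>\<^sub>M borel" "w \<in> X \<rightarrow>\<^sub>M N" "g \<in> X \<rightarrow>\<^sub>M gaps" "a \<in> X \<rightarrow>\<^sub>M marks"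
  shows "(\<lambda>x. jump_value F J t \<phi> n (s x) (w x) (g x) (a x)) \<in> borel_measurable X"
  using assms(2-)
proof (induction n arbitrary: s w g a)
  case (Suc n)
  note [measurable] = assms(1) Suc.prems
  have g0: "(\<lambda>x. g x k) \<in> borel_measurable X" for k
  proof -
    have "(\<lambda>x. g x k) \<in> X \<rightarrow>\<^sub>M exp_law" by measurable
    then show ?thesis by simp
  qed
  note [measurable] = g0
  have gS: "(\<lambda>x k. g x (Suc k)) \<in> X \<rightarrow>\<^sub>M gaps"
  proof (rule measurable_PiM_single')
    show "(\<lambda>x. g x (Suc i)) \<in> X \<rightarrow>\<^sub>M exp_law" for i by measurable
  qed auto
  have aS: "(\<lambda>x k. a x (Suc k)) \<in> X \<rightarrow>\<^sub>M marks"
  proof (rule measurable_PiM_single')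
    show "(\<lambda>x. a x (Suc i)) \<in> X \<rightarrow>\<^sub>M P" for i by measurable
    show "(\<lambda>\<omega> i. a \<omega> (Suc i)) \<in> space X \<rightarrow> UNIV \<rightarrow>\<^sub>E space P"
      using measurable_space[OF Suc.prems(4)] by (auto simp: space_PiM PiE_iff)
  qed
  have "(\<lambda>x. jump_value F J t \<phi> n (s x + g x 0) (J (s x + g x 0) (a x 0) (F (s x) (s x + g x 0) (w x)))
          (\<lambda>k. g x (Suc k)) (\<lambda>k. a x (Suc k))) \<in> borel_measurable X"
    by (rule Suc.IH) (use gS aS in \<open>measurable\<close>)
  note [measurable] = this
  show ?case by simp measurable
qed simp

text \<open>Induction on \<open>n\<close>: the first gap and the first mark are split off the two
  product measures, what remains is the same problem started after the first jump, and
  \<open>step\<close> closes the induction because \<open>U\<close> bounds the value from there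
  on.\<close>

lemma jump_value_le:
  assumes \<phi>: "\<phi> \<in> borel_measurable N"
    and step: "\<And>s w. 0 \<le> s \<Longrightarrow> s \<le> t \<Longrightarrow>
      (\<integral>\<^sup>+u. (if t < s + u then \<phi> (F s t w)
             else \<integral>\<^sup>+b. U (s + u) (J (s + u) b (F s (s + u) w)) \<partial>P) \<partial>exp_law) \<le> U s w"
    and "0 \<le> s" "s \<le> t"
  shows "(\<integral>\<^sup>+g. \<integral>\<^sup>+a. jump_value F J t \<phi> n s w g a \<partial>marks \<partial>gaps) \<le> U s w"
  using assms(3-)
proof (induction n arbitrary: s w)
  case (Suc n)
  interpret E: prob_space exp_law by (rule prob_space_exp_law)
  interpret SE: product_prob_space "\<lambda>_::nat. exp_law" UNIV ..
  interpret SE: prob_space gaps by (rule SE.P.prob_space_axioms)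
  interpret SP: product_prob_space "\<lambda>_::nat. P" UNIV ..
  interpret SP: prob_space marks by (rule SP.P.prob_space_axioms)
  interpret PG: pair_sigma_finite gaps P ..
  note [measurable] = \<phi>
  have wN [measurable]: "w \<in> space N" for w using space_N by simp
  let ?jv = "\<lambda>n s w g a. jump_value F J t \<phi> n s w g a"
  have "(\<integral>\<^sup>+g. \<integral>\<^sup>+a. ?jv (Suc n) s w g a \<partial>marks \<partial>gaps)
     = (\<integral>\<^sup>+u. \<integral>\<^sup>+g. \<integral>\<^sup>+a. ?jv (Suc n) s w (case_nat u g) a \<partial>marks \<partial>gaps \<partial>exp_law)"
    by (rule nn_integral_sequence_space[OF prob_space_exp_law]) measurable
  also have "\<dots> = (\<integral>\<^sup>+u. \<integral>\<^sup>+g. \<integral>\<^sup>+b. \<integral>\<^sup>+a. ?jv (Suc n) s w (case_nat u g) (case_nat b a)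
                     \<partial>marks \<partial>P \<partial>gaps \<partial>exp_law)"
    by (intro nn_integral_cong nn_integral_sequence_space prob_space_axioms) measurable
  also have "\<dots> \<le> (\<integral>\<^sup>+u. (if t < s + u then \<phi> (F s t w)
             else \<integral>\<^sup>+b. U (s + u) (J (s + u) b (F s (s + u) w)) \<partial>P) \<partial>exp_law)"
  proof (rule nn_integral_mono_AE)
    have "AE u in exp_law. 0 \<le> u"
      by (subst AE_density) (auto simp: exponential_density_def)
    then show "AE u in exp_law. (\<integral>\<^sup>+g. \<integral>\<^sup>+b. \<integral>\<^sup>+a. ?jv (Suc n) s w (case_nat u g) (case_nat b a)
                     \<partial>marks \<partial>P \<partial>gaps) \<le> (if t < s + u then \<phi> (F s t w)
             else \<integral>\<^sup>+b. U (s + u) (J (s + u) b (F s (s + u) w)) \<partial>P)"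
    proof eventually_elim
      case (elim u)
      show ?case
      proof (cases "t < s + u")
        case True
        then show ?thesis
          by (simp add: SE.emeasure_space_1 SP.emeasure_space_1 emeasure_space_1)
      next
        case False
        have "(\<integral>\<^sup>+g. \<integral>\<^sup>+b. \<integral>\<^sup>+a. ?jv (Suc n) s w (case_nat u g) (case_nat b a) \<partial>marks \<partial>P \<partial>gaps)
           = (\<integral>\<^sup>+g. \<integral>\<^sup>+b. \<integral>\<^sup>+a. ?jv n (s + u) (J (s + u) b (F s (s + u) w)) g a \<partial>marks \<partial>P \<partial>gaps)"
          using False by simp
        \<comment> \<open>The induction hypothesis needs a fixed state after the first jump, so the
          first mark is moved outside the later gaps.\<close>
        also have "\<dots> = (\<integral>\<^sup>+b. \<integral>\<^sup>+g. \<integral>\<^sup>+a. ?jv n (s + u) (J (s + u) b (F s (s + u) w)) g a \<partial>marks \<partial>gaps \<partial>P)"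
          by (rule PG.Fubini'[symmetric]) measurable
        also have "\<dots> \<le> (\<integral>\<^sup>+b. U (s + u) (J (s + u) b (F s (s + u) w)) \<partial>P)"
          using False elim Suc.prems by (intro nn_integral_mono Suc.IH) auto
        finally show ?thesis using False by simp
      qed
    qed
  qed
  also have "\<dots> \<le> U s w" using Suc.prems by (intro step)
  finally show ?case .
next
  case 0
  have "jump_value F J t \<phi> 0 s w g = (\<lambda>a. 0)" for g by auto
  then show ?case by simp
qed

end

section \<open>The driving points: law of gaps and marks, non-explosion, transfer to the
  process\<close>

definition jump_time :: "(nat \<Rightarrow> real) \<Rightarrow> nat \<Rightarrow> real" where
  "jump_time T k = (case k of 0 \<Rightarrow> 0 | Suc j \<Rightarrow> T j)"

text \<open>The index shift makes piece \<open>k\<close> of a trajectory run from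
  \<open>jump_time T k\<close> to \<open>T k\<close>, with time 0 as the start of piece 0; its
  length is gap \<open>k\<close> in every case.\<close>

lemma jump_time_gap: "jump_time (\<lambda>k. T k \<omega>) (Suc k) = jump_time (\<lambda>k. T k \<omega>) k + gap T k \<omega>"
  by (cases k) (auto simp: jump_time_def gap_def)

lemma jump_value_path:
  assumes flow: "\<And>k u. S k \<le> u \<Longrightarrow> u < S (Suc k) \<Longrightarrow> w u = F (S k) u (w (S k))"
    and jump: "\<And>k. w (S (Suc k)) = J (S (Suc k)) (a k) (F (S k) (S (Suc k)) (w (S k)))"
    and "S k \<le> t" "t < S (k + n)"
  shows "jump_value F J t \<phi> n (S k) (w (S k)) (\<lambda>i. S (Suc (k + i)) - S (k + i)) (\<lambda>i. a (k + i)) = \<phi> (w t)"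
  using assms(3,4)
proof (induction n arbitrary: k)
  case (Suc n)
  show ?case
  proof (cases "t < S (Suc k)")
    case True
    then show ?thesis using flow[of k t] Suc.prems by simp
  next
    case False
    then show ?thesis using Suc.IH[of "Suc k"] Suc.prems jump[of k] by simp
  qed
qed simp

text \<open>Independence is given between the jump times and the marks. The gaps are a measurable
  image of the times, so they inherit it; both marginals are product measures, and the joint law is
  identified on rectangles.\<close>

lemma marked_poisson_law:
  fixes T :: "nat \<Rightarrow> 'w \<Rightarrow> real" and \<xi> :: "nat \<Rightarrow> 'w \<Rightarrow> 'b"
  assumes "prob_space M" and mp: "marked_poisson M P T \<xi>"
  shows "distr M (PiM UNIV (\<lambda>_. exp_law) \<Otimes>\<^sub>M PiM UNIV (\<lambda>_. P)) (\<lambda>\<omega>. (\<lambda>k. gap T k \<omega>, \<lambda>k. \<xi> k \<omega>))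
         = PiM UNIV (\<lambda>_. exp_law) \<Otimes>\<^sub>M PiM UNIV (\<lambda>_. P)"
    and "\<And>k. gap T k \<in> borel_measurable M" "\<And>k. T k \<in> borel_measurable M" "\<And>k. \<xi> k \<in> M \<rightarrow>\<^sub>M P"
proof -
  interpret prob_space M by fact
  let ?G = "PiM (UNIV :: nat set) (\<lambda>_. exp_law)" and ?B = "PiM (UNIV :: nat set) (\<lambda>_. borel :: real measure)"
  let ?P = "PiM (UNIV :: nat set) (\<lambda>_. P)"
  have ig: "indep_vars (\<lambda>_. borel) (gap T) UNIV"
    and dg: "\<And>k. distributed M lborel (gap T k) (\<lambda>x. ennreal (exponential_density 1 x))"
    and ix: "indep_vars (\<lambda>_. P) \<xi> UNIV" and dx: "\<And>k. distr M P (\<xi> k) = P"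
    and ind: "indep_set (sets (vimage_algebra (space M) (\<lambda>\<omega> k. T k \<omega>) ?B))
       (sets (vimage_algebra (space M) (\<lambda>\<omega> k. \<xi> k \<omega>) ?P))"
    using mp unfolding marked_poisson_def by auto
  have mg [measurable]: "gap T k \<in> borel_measurable M" for k
    using ig by (auto simp: indep_vars_def)
  then show "\<And>k. gap T k \<in> borel_measurable M" .
  have mx [measurable]: "\<xi> k \<in> M \<rightarrow>\<^sub>M P" for k
    using ix by (auto simp: indep_vars_def)
  then show "\<And>k. \<xi> k \<in> M \<rightarrow>\<^sub>M P" .
  have mT [measurable]: "T k \<in> borel_measurable M" for k
  proof (induction k)
    case 0
    have "T 0 = gap T 0" by (auto simp: gap_def)
    then show ?case using mg[of 0] by simp
  next
    case (Suc k)
    have "T (Suc k) = (\<lambda>\<omega>. gap T (Suc k) \<omega> + T k \<omega>)" by (auto simp: gap_def)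
    then show ?case using Suc by simp
  qed
  then show "\<And>k. T k \<in> borel_measurable M" .
  have mTs: "(\<lambda>\<omega> k. T k \<omega>) \<in> M \<rightarrow>\<^sub>M ?B"
    by (rule measurable_PiM_single') auto
  have mxs: "(\<lambda>\<omega> k. \<xi> k \<omega>) \<in> M \<rightarrow>\<^sub>M ?P"
    by (rule measurable_PiM_single') (use measurable_space[OF mx] in auto)
  let ?g = "\<lambda>\<omega> k. gap T k \<omega>" and ?x = "\<lambda>\<omega> k. \<xi> k \<omega>"
  \<comment> \<open>\<open>?d\<close> recovers the gaps from the times, so an event about the gaps
    is an event about the times.\<close>
  let ?d = "\<lambda>\<tau> k. case k of 0 \<Rightarrow> \<tau> 0 | Suc j \<Rightarrow> (\<tau> (Suc j) - \<tau> j :: real)"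
  have md: "?d \<in> ?B \<rightarrow>\<^sub>M ?B"
    by (rule measurable_PiM_single') (auto split: nat.split simp: space_PiM)
  have gd: "?g = (\<lambda>\<omega>. ?d (\<lambda>k. T k \<omega>))"
    by (auto simp: fun_eq_iff gap_def split: nat.split)
  have mgs: "?g \<in> M \<rightarrow>\<^sub>M ?B"
    by (rule measurable_PiM_single') auto
  have prod: "prob ((?g -` A \<inter> space M) \<inter> (?x -` B \<inter> space M)) = prob (?g -` A \<inter> space M) * prob (?x -` B \<inter> space M)"
    if A: "A \<in> sets ?B" and B: "B \<in> sets ?P" for A B
  proof -
    have "?g -` A \<inter> space M = (\<lambda>\<omega> k. T k \<omega>) -` (?d -` A \<inter> space ?B) \<inter> space M"
      unfolding gd by (auto simp: space_PiM)
    moreover have "?d -` A \<inter> space ?B \<in> sets ?B" using measurable_sets[OF md A] .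
    ultimately have 1: "?g -` A \<inter> space M \<in> sets (vimage_algebra (space M) (\<lambda>\<omega> k. T k \<omega>) ?B)"
      using in_vimage_algebra[of "?d -` A \<inter> space ?B" ?B "\<lambda>\<omega> k. T k \<omega>" "space M"] by simp
    have 2: "?x -` B \<inter> space M \<in> sets (vimage_algebra (space M) (\<lambda>\<omega> k. \<xi> k \<omega>) ?P)"
      using B by (rule in_vimage_algebra)
    show ?thesis using ind 1 2 unfolding indep_sets2_eq by blast
  qed
  have "distr M borel (gap T k) = exp_law" for k
  proof -
    have "distr M borel (gap T k) = distr M lborel (gap T k)" by (rule distr_cong) auto
    then show ?thesis using dg[of k] by (simp add: distributed_def)
  qed
  then have D1: "distr M ?B (\<lambda>\<omega> k. gap T k \<omega>) = ?G"
    using ig by (subst (asm) indep_vars_iff_distr_eq_PiM) (auto simp: restrict_def)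
  have D2: "distr M ?P (\<lambda>\<omega> k. \<xi> k \<omega>) = ?P"
    using ix dx by (subst (asm) indep_vars_iff_distr_eq_PiM) (auto simp: restrict_def)
  have sG: "sets ?G = sets ?B" by (rule sets_PiM_cong) auto
  have mgs' [measurable]: "?g \<in> M \<rightarrow>\<^sub>M ?G" by (rule measurable_PiM_single') auto
  note [measurable] = mxs
  interpret DG: prob_space ?G
    using prob_space_distr[OF mgs] by (simp only: D1)
  interpret DP: prob_space ?P
    using prob_space_distr[OF mxs] by (simp only: D2)
  show "distr M (?G \<Otimes>\<^sub>M ?P) (\<lambda>\<omega>. (?g \<omega>, ?x \<omega>)) = ?G \<Otimes>\<^sub>M ?P"
  proof (rule pair_measure_eqI[symmetric])
    fix A B assume A: "A \<in> sets ?G" and B: "B \<in> sets ?P"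
    then have A': "A \<in> sets ?B" using sG by simp
    have "emeasure (distr M (?G \<Otimes>\<^sub>M ?P) (\<lambda>\<omega>. (?g \<omega>, ?x \<omega>))) (A \<times> B)
        = emeasure M ((?g -` A \<inter> space M) \<inter> (?x -` B \<inter> space M))"
      using A B by (subst emeasure_distr) (auto intro!: arg_cong[where f="emeasure M"])
    also have "\<dots> = emeasure M (?g -` A \<inter> space M) * emeasure M (?x -` B \<inter> space M)"
      by (simp add: emeasure_eq_measure prod[OF A' B] ennreal_mult)
    also have "emeasure M (?g -` A \<inter> space M) = emeasure ?G A"
      using emeasure_distr[OF mgs A'] by (simp only: D1)
    also have "emeasure M (?x -` B \<inter> space M) = emeasure ?P B"
      using emeasure_distr[OF mxs B] by (simp only: D2)
    finally show "emeasure ?G A * emeasure ?P B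
        = emeasure (distr M (?G \<Otimes>\<^sub>M ?P) (\<lambda>\<omega>. (?g \<omega>, ?x \<omega>))) (A \<times> B)" ..
  qed (auto intro: DG.sigma_finite_measure_axioms DP.sigma_finite_measure_axioms)
qed

lemma marked_poisson_gap_pos:
  assumes "prob_space M" and mp: "marked_poisson M P T \<xi>"
  shows "AE \<omega> in M. \<forall>k. 0 < gap T k \<omega>"
proof (subst AE_all_countable, intro allI)
  fix k
  interpret prob_space M by fact
  note [measurable] = marked_poisson_law(2)[OF assms]
  have "distributed M lborel (gap T k) (\<lambda>x. ennreal (exponential_density 1 x))"
    using mp unfolding marked_poisson_def by auto
  from exponential_distributedD_le[OF this, of 0]
  have "\<P>(\<omega> in M. gap T k \<omega> \<le> 0) = 0" by simp
  then have "AE \<omega> in M. \<not> gap T k \<omega> \<le> 0"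
    by (subst (asm) prob_eq_0) auto
  then show "AE \<omega> in M. 0 < gap T k \<omega>" by eventually_elim simp
qed

text \<open>The first \<open>n\<close> gaps are all at most \<open>m\<close> with probability
  \<open>(1 - exp (- m)) ^ n\<close>, which tends to 0; and a single gap longer than
  \<open>m\<close> already puts a jump time beyond \<open>m\<close>.\<close>

lemma marked_poisson_unbounded:
  assumes "prob_space M" and mp: "marked_poisson M P T \<xi>"
  shows "AE \<omega> in M. \<forall>t. \<exists>n. t < T n \<omega>"
proof -
  interpret prob_space M by fact
  note mg [measurable] = marked_poisson_law(2)[OF assms]
  have "AE \<omega> in M. \<exists>n. real m < gap T n \<omega>" for m :: nat
  proof -
    let ?A = "\<lambda>n. {\<omega> \<in> space M. gap T n \<omega> \<le> real m}"
    have A: "prob (?A n) = 1 - exp (- real m)" for n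
    proof -
      have "distributed M lborel (gap T n) (\<lambda>x. ennreal (exponential_density 1 x))"
        using mp unfolding marked_poisson_def by auto
      from exponential_distributedD_le[OF this, of "real m"] show ?thesis by simp
    qed
    have le: "prob (\<Inter>n. ?A n) \<le> (1 - exp (- real m)) ^ Suc n" for n
    proof -
      have ig: "indep_vars (\<lambda>_. borel) (gap T) UNIV"
        using mp unfolding marked_poisson_def by auto
      have "prob (\<Inter>i\<in>{..n}. gap T i -` {..real m} \<inter> space M) = (\<Prod>i\<in>{..n}. prob (gap T i -` {..real m} \<inter> space M))"
        by (rule indep_varsD[OF ig]) auto
      also have "(\<Prod>i\<in>{..n}. prob (gap T i -` {..real m} \<inter> space M)) = (\<Prod>i\<in>{..n}. prob (?A i))"
        by (intro prod.cong arg_cong[where f=prob]) auto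
      also have "(\<Prod>i\<in>{..n}. prob (?A i)) = (1 - exp (- real m)) ^ Suc n" by (simp add: A)
      also have "(\<Inter>i\<in>{..n}. gap T i -` {..real m} \<inter> space M) = (\<Inter>i\<in>{..n}. ?A i)" by auto
      finally have "prob (\<Inter>i\<in>{..n}. ?A i) = (1 - exp (- real m)) ^ Suc n" .
      moreover have "prob (\<Inter>n. ?A n) \<le> prob (\<Inter>i\<in>{..n}. ?A i)"
        by (intro finite_measure_mono) auto
      ultimately show ?thesis by simp
    qed
    have "(\<lambda>n. (1 - exp (- real m)) ^ Suc n) \<longlonglongrightarrow> 0"
      by (intro LIMSEQ_Suc LIMSEQ_power_zero) auto
    then have "prob (\<Inter>n. ?A n) \<le> 0"
      by (rule LIMSEQ_le_const) (use le in auto)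
    then have "prob (\<Inter>n. ?A n) = 0" by (simp add: measure_le_0_iff)
    then have "AE \<omega> in M. \<omega> \<notin> (\<Inter>n. ?A n)"
      by (subst (asm) prob_eq_0) auto
    then show ?thesis
      using AE_space by eventually_elim (auto simp: not_le)
  qed
  then have "AE \<omega> in M. \<forall>m::nat. \<exists>n. real m < gap T n \<omega>"
    by (subst AE_all_countable) auto
  with marked_poisson_gap_pos[OF assms] show ?thesis
  proof eventually_elim
    case (elim \<omega>)
    have T0: "0 \<le> jump_time (\<lambda>k. T k \<omega>) k" for k
    proof (induction k)
      case (Suc k)
      then show ?case using elim(1)[rule_format, of k] jump_time_gap[of T \<omega> k] by simp
    qed (simp add: jump_time_def)
    have "gap T n \<omega> \<le> T n \<omega>" for n
      using T0[of n] jump_time_gap[of T \<omega> n] by (simp add: jump_time_def)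
    then have le: "gap T n \<omega> \<le> T n \<omega>" for n .
    show ?case
    proof
      fix t :: real
      obtain m :: nat where "t \<le> real m" using real_arch_simple by blast
      moreover obtain n where "real m < gap T n \<omega>" using elim(2) by blast
      ultimately have "t < T n \<omega>" using le[of n] by linarith
      then show "\<exists>n. t < T n \<omega>" ..
    qed
  qed
qed

context jump_flow
begin

text \<open>Almost surely finitely many jumps occur up to \<open>t\<close>, so the truncated values
  are eventually equal to the terminal value of the path. The bound of \<open>jump_value_le\<close>
  is uniform in \<open>n\<close>, and Fatou's lemma carries it to the limit.\<close>

lemma process_value_le:
  fixes M :: "'w measure" and T :: "nat \<Rightarrow> 'w \<Rightarrow> real" and \<xi> :: "nat \<Rightarrow> 'w \<Rightarrow> 'm" and w :: "real \<Rightarrow> 'w \<Rightarrow> 's"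
  assumes M: "prob_space M" and mp: "marked_poisson M P T \<xi>"
    and path: "AE \<omega> in M. w 0 \<omega> = w0 \<and>
      (\<forall>k. (\<forall>u. jump_time (\<lambda>k. T k \<omega>) k \<le> u \<longrightarrow> u < T k \<omega> \<longrightarrow>
               w u \<omega> = F (jump_time (\<lambda>k. T k \<omega>) k) u (w (jump_time (\<lambda>k. T k \<omega>) k) \<omega>)) \<and>
           w (T k \<omega>) \<omega> = J (T k \<omega>) (\<xi> k \<omega>)
               (F (jump_time (\<lambda>k. T k \<omega>) k) (T k \<omega>) (w (jump_time (\<lambda>k. T k \<omega>) k) \<omega>)))"
    and \<phi>: "\<phi> \<in> borel_measurable N"
    and step: "\<And>s w. 0 \<le> s \<Longrightarrow> s \<le> t \<Longrightarrow>
      (\<integral>\<^sup>+u. (if t < s + u then \<phi> (F s t w)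
             else \<integral>\<^sup>+b. U (s + u) (J (s + u) b (F s (s + u) w)) \<partial>P) \<partial>exp_law) \<le> U s w"
    and "0 \<le> t"
  shows "(\<integral>\<^sup>+\<omega>. \<phi> (w t \<omega>) \<partial>M) \<le> U 0 w0"
proof -
  interpret M: prob_space M by fact
  interpret SE: product_prob_space "\<lambda>_::nat. exp_law" UNIV
    using prob_space_exp_law by (auto intro!: product_prob_spaceI)
  interpret SE: prob_space gaps by (rule SE.P.prob_space_axioms)
  interpret SP: product_prob_space "\<lambda>_::nat. P" UNIV ..
  interpret SP: prob_space marks by (rule SP.P.prob_space_axioms)
  note law = marked_poisson_law[OF M mp]
  note [measurable] = law(2-4) \<phi>
  have w0 [measurable]: "w0 \<in> space N" using space_N by simp
  let ?v = "\<lambda>n g a. jump_value F J t \<phi> n 0 w0 g a"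
  have "AE \<omega> in M. \<phi> (w t \<omega>) = liminf (\<lambda>n. ?v n (\<lambda>k. gap T k \<omega>) (\<lambda>k. \<xi> k \<omega>))"
    using path marked_poisson_unbounded[OF M mp] marked_poisson_gap_pos[OF M mp]
  proof eventually_elim
    case (elim \<omega>)
    let ?S = "jump_time (\<lambda>k. T k \<omega>)"
    have S0: "?S 0 = 0" and SS: "?S (Suc k) = T k \<omega>" for k by (auto simp: jump_time_def)
    have gd: "T k \<omega> - ?S k = gap T k \<omega>" for k
      using jump_time_gap[of T \<omega> k] by (simp add: SS)
    have mono: "mono ?S"
      unfolding mono_iff_le_Suc using elim(3) jump_time_gap[of T \<omega>] by (simp add: less_imp_le)
    obtain m where m: "t < T m \<omega>" using elim(2) by auto
    have "?v n (\<lambda>k. gap T k \<omega>) (\<lambda>k. \<xi> k \<omega>) = \<phi> (w t \<omega>)" if "n \<ge> Suc m" for n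
    proof -
      have "t < ?S (0 + n)" using m monoD[OF mono that] SS[of m] by simp
      from jump_value_path[of ?S "\<lambda>u. w u \<omega>" F J "\<lambda>k. \<xi> k \<omega>" 0 t n \<phi>, OF _ _ _ this]
      show ?thesis using elim(1) \<open>0 \<le> t\<close> S0
        by (simp add: SS gd)
    qed
    then have "eventually (\<lambda>n. ?v n (\<lambda>k. gap T k \<omega>) (\<lambda>k. \<xi> k \<omega>) = \<phi> (w t \<omega>)) sequentially"
      by (auto simp: eventually_sequentially)
    then have "(\<lambda>n. ?v n (\<lambda>k. gap T k \<omega>) (\<lambda>k. \<xi> k \<omega>)) \<longlonglongrightarrow> \<phi> (w t \<omega>)"
      by (rule tendsto_eventually)
    then show ?case by (simp add: lim_imp_Liminf)
  qed
  then have "(\<integral>\<^sup>+\<omega>. \<phi> (w t \<omega>) \<partial>M) = (\<integral>\<^sup>+\<omega>. liminf (\<lambda>n. ?v n (\<lambda>k. gap T k \<omega>) (\<lambda>k. \<xi> k \<omega>)) \<partial>M)"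
    by (rule nn_integral_cong_AE)
  have mgs [measurable]: "(\<lambda>\<omega> k. gap T k \<omega>) \<in> M \<rightarrow>\<^sub>M gaps"
    by (rule measurable_PiM_single') auto
  have mxs [measurable]: "(\<lambda>\<omega> k. \<xi> k \<omega>) \<in> M \<rightarrow>\<^sub>M marks"
    by (rule measurable_PiM_single') (use measurable_space[OF law(4)] in auto)
  have "(\<integral>\<^sup>+\<omega>. ?v n (\<lambda>k. gap T k \<omega>) (\<lambda>k. \<xi> k \<omega>) \<partial>M) \<le> U 0 w0" for n
  proof -
    have "(\<integral>\<^sup>+\<omega>. ?v n (\<lambda>k. gap T k \<omega>) (\<lambda>k. \<xi> k \<omega>) \<partial>M)
        = (\<integral>\<^sup>+p. ?v n (fst p) (snd p) \<partial>distr M (gaps \<Otimes>\<^sub>M marks) (\<lambda>\<omega>. (\<lambda>k. gap T k \<omega>, \<lambda>k. \<xi> k \<omega>)))"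
      by (subst nn_integral_distr) auto
    also have "\<dots> = (\<integral>\<^sup>+p. ?v n (fst p) (snd p) \<partial>(gaps \<Otimes>\<^sub>M marks))"
      by (simp only: law(1))
    also have "\<dots> = (\<integral>\<^sup>+g. \<integral>\<^sup>+a. ?v n g a \<partial>marks \<partial>gaps)"
      by (subst SP.nn_integral_fst[symmetric]) auto
    also have "\<dots> \<le> U 0 w0"
      by (rule jump_value_le[OF \<phi> step]) (use \<open>0 \<le> t\<close> in auto)
    finally show ?thesis .
  qed
  then have "liminf (\<lambda>n. \<integral>\<^sup>+\<omega>. ?v n (\<lambda>k. gap T k \<omega>) (\<lambda>k. \<xi> k \<omega>) \<partial>M) \<le> U 0 w0"
    by (intro Liminf_le) auto
  moreover have "(\<integral>\<^sup>+\<omega>. liminf (\<lambda>n. ?v n (\<lambda>k. gap T k \<omega>) (\<lambda>k. \<xi> k \<omega>)) \<partial>M)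
     \<le> liminf (\<lambda>n. \<integral>\<^sup>+\<omega>. ?v n (\<lambda>k. gap T k \<omega>) (\<lambda>k. \<xi> k \<omega>) \<partial>M)"
    by (rule nn_integral_liminf) measurable
  ultimately show ?thesis
    using \<open>(\<integral>\<^sup>+\<omega>. \<phi> (w t \<omega>) \<partial>M) = _\<close> by simp
qed

end

section \<open>Supersolutions: reduction to one jump, gluing, and the differential criterion\<close>

context jump_flow
begin

text \<open>\<open>exp (s - u)\<close> is the density at \<open>u\<close> of the first jump time after \<open>s\<close>.\<close>

definition supersolution :: "real \<Rightarrow> real \<Rightarrow> (real \<Rightarrow> 's \<Rightarrow> ennreal) \<Rightarrow> bool" where
  "supersolution a b U \<longleftrightarrow>
     (\<lambda>(u, w). U u w) \<in> borel_measurable (borel \<Otimes>\<^sub>M N) \<and>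
     (\<forall>s t w. a \<le> s \<longrightarrow> s \<le> t \<longrightarrow> t \<le> b \<longrightarrow>
       (\<integral>\<^sup>+u\<in>{s..t}. ennreal (exp (s - u)) * (\<integral>\<^sup>+m. U u (J u m (F s u w)) \<partial>P) \<partial>lborel)
         + ennreal (exp (s - t)) * U t (F s t w) \<le> U s w)"

lemma U_meas:
  assumes "(\<lambda>(u, w). U u w) \<in> borel_measurable (borel \<Otimes>\<^sub>M N)"
    and "f \<in> X \<rightarrow>\<^sub>M borel" "g \<in> X \<rightarrow>\<^sub>M N"
  shows "(\<lambda>x. U (f x) (g x)) \<in> borel_measurable X"
  using measurable_compose[OF measurable_Pair[OF assms(2,3)] assms(1)] by simp

text \<open>The first jump after \<open>s\<close> comes later than \<open>t\<close> with probability
  \<open>exp (s - t)\<close> and then contributes at most \<open>U t\<close>; the earlier jumps give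
  the integral in \<open>supersolution\<close>, after a translation from the gap to the jump
  time.\<close>

lemma supersolution_step:
  assumes U: "supersolution 0 t U" and \<phi>: "\<And>w. \<phi> w \<le> U t w" and s: "0 \<le> s" "s \<le> t"
  shows "(\<integral>\<^sup>+u. (if t < s + u then \<phi> (F s t w)
             else \<integral>\<^sup>+b. U (s + u) (J (s + u) b (F s (s + u) w)) \<partial>P) \<partial>exp_law) \<le> U s w"
proof -
  note [measurable (raw)] = U_meas[OF U[unfolded supersolution_def, THEN conjunct1]]
  have wN [measurable]: "w \<in> space N" for w using space_N by simp
  define j where "j u = (\<integral>\<^sup>+b. U u (J u b (F s u w)) \<partial>P)" for u
  have j [measurable]: "j \<in> borel_measurable borel"
    unfolding j_def by measurable
  have tail: "(\<integral>\<^sup>+u\<in>{t<..}. ennreal (exp (s - u)) \<partial>lborel) = ennreal (exp (s - t))"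
  proof -
    have "(\<integral>\<^sup>+u\<in>{t..}. ennreal (exp (s - u)) \<partial>lborel) = ennreal (0 - (- exp (s - t)))"
    proof (rule nn_integral_FTC_atLeast)
      show "((\<lambda>u. - exp (s - u)) has_real_derivative exp (s - u)) (at u)" for u
        by (auto intro!: derivative_eq_intros)
      have "((\<lambda>u. exp s * exp (- u)) \<longlongrightarrow> exp s * 0) at_top"
        by (intro tendsto_intros filterlim_compose[OF exp_at_bot] filterlim_uminus_at_bot_at_top)
      then show "((\<lambda>u. - exp (s - u)) \<longlongrightarrow> 0) at_top"
        using tendsto_minus[of "\<lambda>u. exp s * exp (- u)" "exp s * 0" at_top] by (simp add: exp_add[symmetric])
    qed auto
    moreover have "(\<integral>\<^sup>+u\<in>{t<..}. ennreal (exp (s - u)) \<partial>lborel) = (\<integral>\<^sup>+u\<in>{t..}. ennreal (exp (s - u)) \<partial>lborel)"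
      by (rule nn_integral_cong_AE) (use AE_lborel_singleton[of t] in \<open>auto elim!: eventually_mono simp: indicator_def\<close>)
    ultimately show ?thesis by simp
  qed
  have "(\<integral>\<^sup>+u. (if t < s + u then \<phi> (F s t w)
             else \<integral>\<^sup>+b. U (s + u) (J (s + u) b (F s (s + u) w)) \<partial>P) \<partial>exp_law)
      \<le> (\<integral>\<^sup>+u. (if t < s + u then U t (F s t w) else j (s + u)) \<partial>exp_law)"
    unfolding j_def by (intro nn_integral_mono) (auto simp: \<phi>)
  also have "\<dots> = (\<integral>\<^sup>+u. ennreal (exponential_density 1 u) * (if t < s + u then U t (F s t w) else j (s + u)) \<partial>lborel)"
    by (rule nn_integral_density) measurable
  also have "\<dots> = (\<integral>\<^sup>+u. ennreal (exponential_density 1 (u - s)) * (if t < u then U t (F s t w) else j u) \<partial>lborel)"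
    by (subst nn_integral_real_affine[where c=1 and t=s and
          f="\<lambda>u. ennreal (exponential_density 1 (u - s)) * (if t < u then U t (F s t w) else j u)"]) (auto cong: if_cong)
  also have "\<dots> = (\<integral>\<^sup>+u. ennreal (exp (s - u)) * j u * indicator {s..t} u
                   + U t (F s t w) * (ennreal (exp (s - u)) * indicator {t<..} u) \<partial>lborel)"
    using s by (intro nn_integral_cong) (auto simp: exponential_density_def indicator_def mult_ac)
  also have "\<dots> = (\<integral>\<^sup>+u\<in>{s..t}. ennreal (exp (s - u)) * j u \<partial>lborel)
                   + U t (F s t w) * ennreal (exp (s - t))"
    by (subst nn_integral_add) (auto simp: nn_integral_cmult tail)
  also have "\<dots> \<le> U s w"
    using U s unfolding supersolution_def j_def by (auto simp: mult.commute)
  finally show ?thesis .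
qed

text \<open>Past \<open>b\<close> the density factors as \<open>exp (s - b) * exp (b - u)\<close>,
  so the inequality for \<open>U2\<close> can be applied to the flow restarted from
  \<open>F s b w\<close>, and its right side is at most \<open>U1 b\<close>. A downward step at
  \<open>b\<close> is harmless, which is what allows the weights to be changed between
  stages.\<close>

lemma supersolution_chain:
  assumes U1: "supersolution a b U1" and U2: "supersolution b c U2"
    and le: "\<And>w. U2 b w \<le> U1 b w" and ab: "a \<le> b" "b \<le> c"
    and semigroup: "\<And>s u w. a \<le> s \<Longrightarrow> s < b \<Longrightarrow> b \<le> u \<Longrightarrow> u \<le> c \<Longrightarrow> F s u w = F b u (F s b w)"
  shows "supersolution a c (\<lambda>u. if u < b then U1 u else U2 u)" (is "supersolution a c ?U")
  unfolding supersolution_def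
proof (intro conjI allI impI)
  note m1 = U_meas[OF U1[unfolded supersolution_def, THEN conjunct1]]
  note m2 = U_meas[OF U2[unfolded supersolution_def, THEN conjunct1]]
  note [measurable (raw)] = m1 m2
  have wN [measurable]: "w \<in> space N" for w using space_N by simp
  show "(\<lambda>(u, w). ?U u w) \<in> borel_measurable (borel \<Otimes>\<^sub>M N)"
    by (simp add: if_distrib[of "\<lambda>f. f _"] cong: if_cong) measurable
  fix s t w assume st: "a \<le> s" "s \<le> t" "t \<le> c"
  let ?j = "\<lambda>U u s w. ennreal (exp (s - u)) * (\<integral>\<^sup>+m. U u (J u m (F s u w)) \<partial>P)"
  have i1: "(\<integral>\<^sup>+u\<in>{s..t}. ?j U1 u s w \<partial>lborel) + ennreal (exp (s - t)) * U1 t (F s t w) \<le> U1 s w"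
    if "a \<le> s" "s \<le> t" "t \<le> b" for s t w using U1 that unfolding supersolution_def by auto
  have i2: "(\<integral>\<^sup>+u\<in>{s..t}. ?j U2 u s w \<partial>lborel) + ennreal (exp (s - t)) * U2 t (F s t w) \<le> U2 s w"
    if "b \<le> s" "s \<le> t" "t \<le> c" for s t w using U2 that unfolding supersolution_def by auto
  show "(\<integral>\<^sup>+u\<in>{s..t}. ?j ?U u s w \<partial>lborel) + ennreal (exp (s - t)) * ?U t (F s t w) \<le> ?U s w"
  proof -
    consider "t < b" | "b \<le> s" | "s < b" "b \<le> t" by linarith
    then show ?thesis
    proof cases
      case 1
      have "(\<integral>\<^sup>+u\<in>{s..t}. ?j ?U u s w \<partial>lborel) = (\<integral>\<^sup>+u\<in>{s..t}. ?j U1 u s w \<partial>lborel)"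
        by (rule nn_integral_cong) (use 1 in \<open>auto simp: indicator_def\<close>)
      then show ?thesis using i1[of s t w] st 1 by simp
    next
      case 2
      have "(\<integral>\<^sup>+u\<in>{s..t}. ?j ?U u s w \<partial>lborel) = (\<integral>\<^sup>+u\<in>{s..t}. ?j U2 u s w \<partial>lborel)"
        by (rule nn_integral_cong) (use 2 in \<open>auto simp: indicator_def\<close>)
      then show ?thesis using i2[of s t w] st 2 by simp
    next
      case 3
      let ?v = "F s b w"
      have e: "ennreal (exp (s - u)) = ennreal (exp (s - b)) * ennreal (exp (b - u))" for u
        by (simp add: ennreal_mult[symmetric] exp_add[symmetric])
      have "(\<integral>\<^sup>+u\<in>{s..t}. ?j ?U u s w \<partial>lborel)
         = (\<integral>\<^sup>+u. ?j U1 u s w * indicator {s..<b} u + ennreal (exp (s - b)) * (?j U2 u b ?v * indicator {b..t} u) \<partial>lborel)"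
      proof (rule nn_integral_cong)
        fix u
        show "?j ?U u s w * indicator {s..t} u
          = ?j U1 u s w * indicator {s..<b} u + ennreal (exp (s - b)) * (?j U2 u b ?v * indicator {b..t} u)"
          using 3 st semigroup[of s u w] by (cases "u < b") (auto simp: indicator_def e[of u] mult.assoc)
      qed
      also have "\<dots> = (\<integral>\<^sup>+u\<in>{s..<b}. ?j U1 u s w \<partial>lborel) + ennreal (exp (s - b)) * (\<integral>\<^sup>+u\<in>{b..t}. ?j U2 u b ?v \<partial>lborel)"
        by (subst nn_integral_add) (auto simp: nn_integral_cmult)
      also have "(\<integral>\<^sup>+u\<in>{s..<b}. ?j U1 u s w \<partial>lborel) \<le> (\<integral>\<^sup>+u\<in>{s..b}. ?j U1 u s w \<partial>lborel)"
        by (intro nn_integral_mono) (auto simp: indicator_def)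
      finally have "(\<integral>\<^sup>+u\<in>{s..t}. ?j ?U u s w \<partial>lborel) + ennreal (exp (s - t)) * ?U t (F s t w)
        \<le> (\<integral>\<^sup>+u\<in>{s..b}. ?j U1 u s w \<partial>lborel) + ennreal (exp (s - b)) * (\<integral>\<^sup>+u\<in>{b..t}. ?j U2 u b ?v \<partial>lborel)
           + ennreal (exp (s - b)) * (ennreal (exp (b - t)) * U2 t (F b t ?v))"
        using 3 st semigroup[of s t w] by (auto intro!: add_right_mono simp: e[of t] mult.assoc)
      also have "\<dots> = (\<integral>\<^sup>+u\<in>{s..b}. ?j U1 u s w \<partial>lborel) + ennreal (exp (s - b)) *
           ((\<integral>\<^sup>+u\<in>{b..t}. ?j U2 u b ?v \<partial>lborel) + ennreal (exp (b - t)) * U2 t (F b t ?v))"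
        by (simp add: distrib_left add.assoc)
      also have "\<dots> \<le> (\<integral>\<^sup>+u\<in>{s..b}. ?j U1 u s w \<partial>lborel) + ennreal (exp (s - b)) * U1 b ?v"
        using i2[of b t ?v] 3 st by (intro add_left_mono mult_left_mono order_trans[OF _ le]) auto
      also have "\<dots> \<le> U1 s w" using i1[of s b w] st 3 by simp
      finally show ?thesis using 3 by simp
    qed
  qed
qed

text \<open>The derivative of \<open>- (exp (s - u) * W u (F s u w))\<close> is
  \<open>exp (s - u)\<close> times \<open>W - D\<close>, and by \<open>gen\<close> this dominates
  the average of \<open>W\<close> after a jump; integrating gives the inequality. Derivatives are
  asked for in the interior only, because the drift may be singular at 0.\<close>

lemma supersolutionI:
  fixes W :: "real \<Rightarrow> 's \<Rightarrow> real"
  assumes meas: "(\<lambda>(u, w). W u w) \<in> borel_measurable (borel \<Otimes>\<^sub>M N)"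
    and nonneg: "\<And>u w. a \<le> u \<Longrightarrow> u \<le> b \<Longrightarrow> 0 \<le> W u w"
    and cont: "\<And>s w. a \<le> s \<Longrightarrow> s < b \<Longrightarrow> continuous_on {s..b} (\<lambda>u. W u (F s u w))"
    and deriv: "\<And>s u w. a \<le> s \<Longrightarrow> s < u \<Longrightarrow> u < b \<Longrightarrow>
       ((\<lambda>u. W u (F s u w)) has_real_derivative D u (F s u w)) (at u)"
    and gen: "\<And>u w. a < u \<Longrightarrow> u < b \<Longrightarrow>
       0 \<le> W u w - D u w \<and> (\<integral>\<^sup>+m. ennreal (W u (J u m w)) \<partial>P) \<le> ennreal (W u w - D u w)"
    and id: "\<And>s w. a \<le> s \<Longrightarrow> s \<le> b \<Longrightarrow> W s (F s s w) = W s w"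
  shows "supersolution a b (\<lambda>u w. ennreal (W u w))"
  unfolding supersolution_def
proof (intro conjI allI impI)
  show "(\<lambda>(u, w). ennreal (W u w)) \<in> borel_measurable (borel \<Otimes>\<^sub>M N)"
    using meas by (simp add: case_prod_beta) 
  fix s t w assume st: "a \<le> s" "s \<le> t" "t \<le> b"
  let ?j = "\<lambda>u. ennreal (exp (s - u)) * (\<integral>\<^sup>+m. ennreal (W u (J u m (F s u w))) \<partial>P)"
  show "(\<integral>\<^sup>+u\<in>{s..t}. ?j u \<partial>lborel) + ennreal (exp (s - t)) * ennreal (W t (F s t w)) \<le> ennreal (W s w)"
  proof (cases "s = t")
    case True
    have "AE u in lborel. ?j u * indicator {s..t} u = 0"
      using AE_lborel_singleton[of s] by eventually_elim (use True in \<open>auto simp: indicator_def\<close>)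
    then have "(\<integral>\<^sup>+u\<in>{s..t}. ?j u \<partial>lborel) = (\<integral>\<^sup>+(u::real). 0 \<partial>lborel)"
      by (rule nn_integral_cong_AE)
    then show ?thesis using True id[of s w] st by simp
  next
    case False
    then have s_t: "s < t" using st by simp
    \<comment> \<open>Cut to 0 at the endpoints, where \<open>gen\<close> gives no sign.\<close>
    define h where "h u = (if u \<in> {s<..<t} then exp (s - u) * (W u (F s u w) - D u (F s u w)) else 0)" for u
    have h: "(h has_integral ((- (exp (s - t) * W t (F s t w))) - (- (exp (s - s) * W s (F s s w))))) {s..t}"
    proof (rule fundamental_theorem_of_calculus_interior)
      show "continuous_on {s..t} (\<lambda>u. - (exp (s - u) * W u (F s u w)))"
        using st s_t by (intro continuous_intros continuous_on_subset[OF cont[of s w]]) auto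
      show "((\<lambda>u. - (exp (s - u) * W u (F s u w))) has_vector_derivative h u) (at u)" if "u \<in> {s<..<t}" for u
        unfolding has_real_derivative_iff_has_vector_derivative[symmetric]
        using that st by (auto intro!: derivative_eq_intros deriv simp: h_def algebra_simps)
    qed (use s_t in simp)
    have hn: "0 \<le> h u" for u using gen[of u "F s u w"] st by (auto simp: h_def)
    have "(\<integral>\<^sup>+u\<in>{s..t}. ?j u \<partial>lborel) \<le> (\<integral>\<^sup>+u. ennreal (indicator {s..t} u * h u) \<partial>lborel)"
    proof (rule nn_integral_mono_AE)
      show "AE u in lborel. ?j u * indicator {s..t} u \<le> ennreal (indicator {s..t} u * h u)"
        using AE_lborel_singleton[of s] AE_lborel_singleton[of t]
      proof eventually_elim
        case (elim u)
        show ?case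
        proof (cases "u \<in> {s<..<t}")
          case True
          then have "?j u \<le> ennreal (exp (s - u)) * ennreal (W u (F s u w) - D u (F s u w))"
            using gen[of u "F s u w"] st by (intro mult_left_mono) auto
          then show ?thesis using True gen[of u "F s u w"] st by (simp add: h_def ennreal_mult)
        qed (use elim in \<open>auto simp: indicator_def\<close>)
      qed
    qed
    also have "\<dots> = ennreal ((- (exp (s - t) * W t (F s t w))) - (- (exp (s - s) * W s (F s s w))))"
      by (rule nn_integral_has_integral_lebesgue[OF hn h])
    also have "\<dots> = ennreal (W s w - exp (s - t) * W t (F s t w))" using id[of s w] st by simp
    finally have "(\<integral>\<^sup>+u\<in>{s..t}. ?j u \<partial>lborel) + ennreal (exp (s - t)) * ennreal (W t (F s t w))
       \<le> ennreal (W s w - exp (s - t) * W t (F s t w)) + ennreal (exp (s - t) * W t (F s t w))"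
      by (simp add: ennreal_mult nonneg st add_right_mono order_trans[OF st(1,2)])
    also have "\<dots> = ennreal (W s w)"
    proof -
      have "0 \<le> W s w - exp (s - t) * W t (F s t w)"
        using has_integral_nonneg[OF h hn] id[of s w] st by simp
      then show ?thesis using nonneg[of t "F s t w"] st by (subst ennreal_plus[symmetric]) auto
    qed
    finally show ?thesis .
  qed
qed

end

section \<open>Positive semidefinite matrices\<close>

lemma outer_inner: "(x :: real^'d) \<bullet> (outer a *v y) = (x \<bullet> a) * (a \<bullet> y)"
proof -
  have "outer a *v y = (a \<bullet> y) *\<^sub>R a"
    by (simp add: outer_def inner_vec_def matrix_vector_mult_def vec_eq_iff sum_distrib_left sum_distrib_right mult_ac)
  then show ?thesis by simp
qed

lemma norm_outer_le: "norm (outer (a :: real^'d)) \<le> (norm a)\<^sup>2"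
proof -
  have "norm (outer a) = L2_set (\<lambda>i. \<bar>a $ i\<bar> * norm a) UNIV"
  proof -
    have "norm (outer a $ i) = \<bar>a $ i\<bar> * norm a" for i
    proof -
      have "outer a $ i = a $ i *\<^sub>R a" by (simp add: outer_def vec_eq_iff)
      then show ?thesis by simp
    qed
    then show ?thesis by (simp add: norm_vec_def)
  qed
  also have "\<dots> = norm a * norm a"
    by (simp add: L2_set_left_distrib[symmetric] norm_vec_def)
  finally show ?thesis by (simp add: power2_eq_square)
qed

lemma trace_outer: "(\<Sum>i\<in>UNIV. outer (a :: real^'d) $ i $ i) = (norm a)\<^sup>2"
  unfolding power2_norm_eq_inner by (simp add: outer_def inner_vec_def)

lemma outer_measurable [measurable]: "outer \<in> borel_measurable (borel :: (real^'d) measure)"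
proof -
  have "continuous_on UNIV (outer :: real^'d \<Rightarrow> _)"
    unfolding outer_def by (intro continuous_intros)
  then show ?thesis by (rule borel_measurable_continuous_onI)
qed

lemma bilinear_matrix_form: "bounded_linear (\<lambda>A :: real^'d^'d. x \<bullet> (A *v y))"
proof -
  have "linear (\<lambda>A :: real^'d^'d. x \<bullet> (A *v y))"
    by (auto intro!: linearI simp: matrix_vector_mult_add_rdistrib inner_add_right
        scaleR_matrix_vector_assoc[symmetric])
  then show ?thesis by (rule linear_conv_bounded_linear[THEN iffD1])
qed

lemma psd_cauchy_schwarz:
  fixes A :: "real^'d^'d"
  assumes sym: "transpose A = A" and psd: "\<And>x. 0 \<le> x \<bullet> (A *v x)"
  shows "(x \<bullet> (A *v y))\<^sup>2 \<le> (x \<bullet> (A *v x)) * (y \<bullet> (A *v y))"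
proof -
  have s: "y \<bullet> (A *v x) = x \<bullet> (A *v y)" for x y
    by (metis dot_lmul_matrix inner_commute sym vector_transpose_matrix)
  have q: "0 \<le> \<alpha>\<^sup>2 * (x \<bullet> (A *v x)) + 2 * \<alpha> * \<beta> * (x \<bullet> (A *v y)) + \<beta>\<^sup>2 * (y \<bullet> (A *v y))" for \<alpha> \<beta> :: real
    using psd[of "\<alpha> *\<^sub>R x + \<beta> *\<^sub>R y"] s[of y x]
    by (simp add: matrix_vector_right_distrib inner_add_left inner_add_right
        matrix_vector_mult_scaleR power2_eq_square algebra_simps)
  let ?a = "x \<bullet> (A *v x)" and ?b = "x \<bullet> (A *v y)" and ?c = "y \<bullet> (A *v y)"
  have a: "0 \<le> ?a" and c: "0 \<le> ?c" using psd by auto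
  show ?thesis
  proof (cases "?a = 0")
    case True
    have "?b = 0"
    proof (rule ccontr)
      assume "?b \<noteq> 0"
      \<comment> \<open>With \<open>?a = 0\<close> the form is affine in its first coefficient; this
        coefficient makes its value -1.\<close>
      then show False using q[of "- (?c + 1) / (2 * ?b)" 1] True c by (simp add: field_simps)
    qed
    then show ?thesis using True by simp
  next
    case False
    \<comment> \<open>At these coefficients the form equals
      \<open>?a * (?a * ?c - ?b^2)\<close>.\<close>
    then show ?thesis using q[of "- ?b" "?a"] a
      by (simp add: power2_eq_square algebra_simps)
  qed
qed

lemma symmetric_form: "transpose A = A \<Longrightarrow> (y :: real^'d) \<bullet> (A *v x) = x \<bullet> (A *v y)"
  by (metis dot_lmul_matrix inner_commute vector_transpose_matrix)

text \<open>A minimiser of the Rayleigh quotient on the unit sphere is an eigenvector.\<close>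

lemma eigenvalue_lower_bound:
  fixes A :: "real^'d^'d"
  assumes sym: "transpose A = A" and ev: "\<And>c. eigenvalue A c \<Longrightarrow> \<mu> \<le> c"
  shows "\<mu> * (x \<bullet> x) \<le> x \<bullet> (A *v x)"
proof -
  let ?S = "sphere (0 :: real^'d) 1"
  have "?S \<noteq> {}" by (simp)
  moreover have "continuous_on ?S (\<lambda>x. x \<bullet> (A *v x))"
    by (intro continuous_intros linear_continuous_on) (simp add: matrix_vector_mul_bounded_linear)
  ultimately obtain v where v: "v \<in> ?S" and min: "\<And>x. x \<in> ?S \<Longrightarrow> v \<bullet> (A *v v) \<le> x \<bullet> (A *v x)"
    using continuous_attains_inf[of ?S "\<lambda>x. x \<bullet> (A *v x)"] by (auto simp: compact_sphere)
  define c where "c = v \<bullet> (A *v v)"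
  have vv: "v \<bullet> v = 1" using v by (simp add: dot_square_norm)
  have low: "c * (x \<bullet> x) \<le> x \<bullet> (A *v x)" for x
  proof (cases "x = 0")
    case False
    have "c \<le> ((1 / norm x) *\<^sub>R x) \<bullet> (A *v ((1 / norm x) *\<^sub>R x))"
      unfolding c_def using False by (intro min) auto
    also have "\<dots> = (x \<bullet> (A *v x)) / (x \<bullet> x)"
      by (simp add: matrix_vector_mult_scaleR dot_square_norm power2_eq_square)
    finally show ?thesis using False by (simp add: field_simps)
  qed simp
  \<comment> \<open>\<open>B\<close> is positive semidefinite by minimality of \<open>c\<close>, and
    its form vanishes at \<open>v\<close>; Cauchy-Schwarz then forces \<open>B\<close> to annihilate
    \<open>v\<close>.\<close>
  define B where "B = A - mat c"
  have B: "x \<bullet> (B *v y) = x \<bullet> (A *v y) - c * (x \<bullet> y)" for x y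
  proof -
    have "mat c *v y = c *\<^sub>R y"
      by (simp add: matrix_vector_mult_def mat_def vec_eq_iff if_distrib[of "\<lambda>z. z * _"] cong: if_cong)
    then show ?thesis by (simp add: B_def matrix_vector_mult_diff_rdistrib inner_diff_right)
  qed
  have Bs: "transpose B = B"
    using sym by (auto simp: B_def transpose_def mat_def vec_eq_iff)
  have "(x \<bullet> (B *v v))\<^sup>2 \<le> 0" for x
    using psd_cauchy_schwarz[OF Bs, of x v] low B c_def vv by simp
  then have "B *v v = 0" by (metis inner_eq_zero_iff power2_less_eq_zero_iff)
  then have "x \<bullet> (A *v v - c *\<^sub>R v) = 0" for x using B[of x v] by (simp add: inner_diff_right)
  then have "A *v v = c *\<^sub>R v" by (metis eq_iff_diff_eq_0 inner_eq_zero_iff)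
  moreover have "v \<noteq> 0" using vv by auto
  ultimately have "\<mu> \<le> c" by (intro ev) (auto simp: eigenvalue_def)
  then have "\<mu> * (x \<bullet> x) \<le> c * (x \<bullet> x)" by (simp add: mult_right_mono)
  with low show ?thesis using order_trans by blast
qed

section \<open>Quadratic forms along a stochastic gradient step\<close>

locale least_squares = prob_space P for P :: "((real^'d) \<times> real) measure" +
  fixes H :: "real^'d^'d" and R2 \<kappa>' :: real
  assumes sets_P: "sets P = sets borel"
    and int_fourth: "integrable P (\<lambda>\<xi>. (norm (fst \<xi>))\<^sup>2 *\<^sub>R outer (fst \<xi>))"
    and H_def: "H = hessian P" and H_inv: "invertible H"
    and R2: "smallest_positive
           (\<lambda>r. loewner_le (\<integral>\<xi>. (norm (fst \<xi>))\<^sup>2 *\<^sub>R outer (fst \<xi>) \<partial>P) (r *\<^sub>R H)) R2"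
    and \<kappa>': "smallest_positive
           (\<lambda>r. loewner_le (\<integral>\<xi>. qnorm2 (matrix_inv H) (fst \<xi>) *\<^sub>R outer (fst \<xi>) \<partial>P) (r *\<^sub>R H)) \<kappa>'"
begin

lemma R2_pos: "0 < R2" and \<kappa>'_pos: "0 < \<kappa>'"
  using R2 \<kappa>' by (auto simp: smallest_positive_def)

lemma fst_meas [measurable]: "fst \<in> borel_measurable P" "snd \<in> borel_measurable P"
  unfolding measurable_cong_sets[OF sets_P refl] by (simp_all add: borel_prod[symmetric])

text \<open>The trace of the integrable matrix is the fourth power of the norm; the integrability of
  all forms below is derived from this moment.\<close>

lemma integrable_norm4: "integrable P (\<lambda>\<xi>. (norm (fst \<xi>))\<^sup>2 * (norm (fst \<xi>))\<^sup>2)"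
proof -
  have "bounded_linear (\<lambda>A :: real^'d^'d. \<Sum>i\<in>UNIV. A $ i $ i)"
    by (intro bounded_linear_sum bounded_linear_compose[OF bounded_linear_vec_nth bounded_linear_vec_nth])
  from integrable_bounded_linear[OF this int_fourth]
  show ?thesis by (simp add: trace_outer sum_distrib_left[symmetric])
qed

lemma integrable_weighted_outer:
  assumes [measurable]: "f \<in> borel_measurable P" and f: "\<And>\<xi>. \<bar>f \<xi>\<bar> \<le> C * (1 + (norm (fst \<xi>))\<^sup>2)" and C: "0 \<le> C"
  shows "integrable P (\<lambda>\<xi>. f \<xi> *\<^sub>R outer (fst \<xi>))"
proof (rule Bochner_Integration.integrable_bound)
  show "integrable P (\<lambda>\<xi>. 2 * C * (1 + (norm (fst \<xi>))\<^sup>2 * (norm (fst \<xi>))\<^sup>2))"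
    using integrable_norm4 by simp
  show "AE \<xi> in P. norm (f \<xi> *\<^sub>R outer (fst \<xi>)) \<le> norm (2 * C * (1 + (norm (fst \<xi>))\<^sup>2 * (norm (fst \<xi>))\<^sup>2))"
  proof (rule AE_I2)
    fix \<xi> :: "(real^'d) \<times> real"
    let ?n = "(norm (fst \<xi>))\<^sup>2"
    have "norm (f \<xi> *\<^sub>R outer (fst \<xi>)) \<le> (C * (1 + ?n)) * ?n"
      using f[of \<xi>] norm_outer_le[of "fst \<xi>"] C by (simp add: mult_mono)
    also have "\<dots> \<le> C * (2 * (1 + ?n * ?n))"
    proof -
      have "(1 + n) * n \<le> 2 * (1 + n * n)" for n :: real
        using zero_le_square[of "n - 1 / 2"] zero_le_square[of n] by (simp add: algebra_simps)
      from this[of ?n] show ?thesis using C by (simp add: mult.assoc mult_left_mono)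
    qed
    finally show "norm (f \<xi> *\<^sub>R outer (fst \<xi>)) \<le> norm (2 * C * (1 + ?n * ?n))"
      using C by (simp add: algebra_simps)
  qed
qed measurable

lemma weighted_form:
  assumes "integrable P (\<lambda>\<xi>. f \<xi> *\<^sub>R outer (fst \<xi>))"
  shows "integrable P (\<lambda>\<xi>. f \<xi> * ((x \<bullet> fst \<xi>) * (fst \<xi> \<bullet> y)))"
    and "(\<integral>\<xi>. f \<xi> * ((x \<bullet> fst \<xi>) * (fst \<xi> \<bullet> y)) \<partial>P) = x \<bullet> ((\<integral>\<xi>. f \<xi> *\<^sub>R outer (fst \<xi>) \<partial>P) *v y)"
proof -
  have e: "x \<bullet> ((f \<xi> *\<^sub>R outer (fst \<xi>)) *v y) = f \<xi> * ((x \<bullet> fst \<xi>) * (fst \<xi> \<bullet> y))" for \<xi>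
    by (simp add: scaleR_matrix_vector_assoc[symmetric] outer_inner)
  show "integrable P (\<lambda>\<xi>. f \<xi> * ((x \<bullet> fst \<xi>) * (fst \<xi> \<bullet> y)))"
    using integrable_bounded_linear[OF bilinear_matrix_form[of x y] assms] by (simp add: e)
  show "(\<integral>\<xi>. f \<xi> * ((x \<bullet> fst \<xi>) * (fst \<xi> \<bullet> y)) \<partial>P) = x \<bullet> ((\<integral>\<xi>. f \<xi> *\<^sub>R outer (fst \<xi>) \<partial>P) *v y)"
    using integral_bounded_linear[OF bilinear_matrix_form[of x y] assms] by (simp add: e)
qed

abbreviation "Hi \<equiv> matrix_inv H"

lemma H_Hi: "H *v (Hi *v x) = x" "Hi *v (H *v x) = x"
proof -
  have "H ** Hi = mat 1 \<and> Hi ** H = mat 1"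
    using H_inv unfolding invertible_def matrix_inv_def by (rule someI_ex)
  then show "H *v (Hi *v x) = x" "Hi *v (H *v x) = x"
    by (simp_all add: matrix_vector_mul_assoc)
qed

lemma H_form: "integrable P (\<lambda>\<xi>. (x \<bullet> fst \<xi>) * (fst \<xi> \<bullet> y))" "(\<integral>\<xi>. (x \<bullet> fst \<xi>) * (fst \<xi> \<bullet> y) \<partial>P) = x \<bullet> (H *v y)"
  using weighted_form[of "\<lambda>_. 1" x y] integrable_weighted_outer[of "\<lambda>_. 1" 1]
  by (simp_all add: H_def hessian_def)

lemma H_sym: "transpose H = H"
proof -
  have "loewner_le (\<integral>\<xi>. (norm (fst \<xi>))\<^sup>2 *\<^sub>R outer (fst \<xi>) \<partial>P) (R2 *\<^sub>R H)"
    using R2 by (simp add: smallest_positive_def)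
  then have "transpose (R2 *\<^sub>R H) = R2 *\<^sub>R H" by (simp add: loewner_le_def)
  then show ?thesis using R2_pos by (simp add: transpose_def vec_eq_iff)
qed

lemma H_psd: "0 \<le> x \<bullet> (H *v x)"
proof -
  have "0 \<le> (\<integral>\<xi>. (x \<bullet> fst \<xi>) * (fst \<xi> \<bullet> x) \<partial>P)"
    by (rule integral_nonneg_AE) (simp add: inner_commute)
  then show ?thesis by (simp add: H_form)
qed

lemma Hi_sym: "x \<bullet> (Hi *v y) = y \<bullet> (Hi *v x)"
  using symmetric_form[OF H_sym, of "Hi *v x" "Hi *v y"] by (simp add: H_Hi inner_commute)

definition q :: "real^'d \<Rightarrow> real" where "q v = v \<bullet> (Hi *v v)"

lemma q_nonneg: "0 \<le> q v"
  using H_psd[of "Hi *v v"] by (simp add: q_def H_Hi inner_commute)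

lemma q_add: "q (x + c *\<^sub>R y) = q x + 2 * c * (x \<bullet> (Hi *v y)) + c\<^sup>2 * q y"
  using Hi_sym[of x y]
  by (simp add: q_def matrix_vector_right_distrib matrix_vector_mult_scaleR inner_add_left inner_add_right
      power2_eq_square algebra_simps)

lemma q_cauchy_schwarz: "(x \<bullet> y)\<^sup>2 \<le> (x \<bullet> (H *v x)) * q y"
  using psd_cauchy_schwarz[OF H_sym H_psd, of x "Hi *v y"] by (simp add: H_Hi q_def inner_commute)

lemma q_continuous [continuous_intros]: "continuous_on A f \<Longrightarrow> continuous_on A (\<lambda>x. q (f x))"
  unfolding q_def
  by (intro continuous_intros bounded_linear.continuous_on[OF matrix_vector_mul_bounded_linear])

lemma q_bound: obtains C where "0 \<le> C" "\<And>v. q v \<le> C * (norm v)\<^sup>2"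
proof
  let ?C = "onorm ((*v) Hi)"
  show "0 \<le> ?C" by (rule onorm_pos_le) (rule matrix_vector_mul_bounded_linear)
  fix v :: "real^'d"
  have "q v \<le> norm v * norm (Hi *v v)" unfolding q_def by (rule norm_cauchy_schwarz)
  also have "\<dots> \<le> norm v * (?C * norm v)"
    by (intro mult_left_mono onorm matrix_vector_mul_bounded_linear) simp
  finally show "q v \<le> ?C * (norm v)\<^sup>2" by (simp add: power2_eq_square mult_ac)
qed

lemma fourth_moment:
  "integrable P (\<lambda>\<xi>. (norm (fst \<xi>))\<^sup>2 * (x \<bullet> fst \<xi>)\<^sup>2)"
  "(\<integral>\<xi>. (norm (fst \<xi>))\<^sup>2 * (x \<bullet> fst \<xi>)\<^sup>2 \<partial>P) \<le> R2 * (x \<bullet> (H *v x))"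
proof -
  note w = weighted_form[OF int_fourth, of x x]
  show "integrable P (\<lambda>\<xi>. (norm (fst \<xi>))\<^sup>2 * (x \<bullet> fst \<xi>)\<^sup>2)"
    using w(1) by (simp add: power2_eq_square inner_commute)
  have "0 \<le> x \<bullet> ((R2 *\<^sub>R H - (\<integral>\<xi>. (norm (fst \<xi>))\<^sup>2 *\<^sub>R outer (fst \<xi>) \<partial>P)) *v x)"
    using R2 by (simp add: smallest_positive_def loewner_le_def)
  then show "(\<integral>\<xi>. (norm (fst \<xi>))\<^sup>2 * (x \<bullet> fst \<xi>)\<^sup>2 \<partial>P) \<le> R2 * (x \<bullet> (H *v x))"
    using w(2) by (simp add: power2_eq_square inner_commute matrix_vector_mult_diff_rdistrib inner_diff_right
        scaleR_matrix_vector_assoc[symmetric])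
qed

lemma weighted_fourth_moment:
  "integrable P (\<lambda>\<xi>. q (fst \<xi>) * (x \<bullet> fst \<xi>)\<^sup>2)"
  "(\<integral>\<xi>. q (fst \<xi>) * (x \<bullet> fst \<xi>)\<^sup>2 \<partial>P) \<le> \<kappa>' * (x \<bullet> (H *v x))"
proof -
  obtain C where C: "0 \<le> C" "\<And>v. q v \<le> C * (norm v)\<^sup>2" using q_bound by blast
  have qm: "q \<in> borel_measurable borel"
    by (rule borel_measurable_continuous_onI) (intro continuous_intros)
  \<comment> \<open>Integrability comes first: otherwise the integral in the definition of \<kappa>'
    would be the default value 0 and the Loewner bound would say nothing about the moment.\<close>
  have "integrable P (\<lambda>\<xi>. q (fst \<xi>) *\<^sub>R outer (fst \<xi>))"
  proof (rule integrable_weighted_outer[OF _ _ C(1)])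
    show "(\<lambda>\<xi>. q (fst \<xi>)) \<in> borel_measurable P"
      by (rule measurable_compose[OF fst_meas(1) qm])
    show "\<bar>q (fst \<xi>)\<bar> \<le> C * (1 + (norm (fst \<xi>))\<^sup>2)" for \<xi>
      using C(2)[of "fst \<xi>"] q_nonneg[of "fst \<xi>"] C(1) by (simp add: distrib_left)
  qed
  note w = weighted_form[OF this, of x x]
  show "integrable P (\<lambda>\<xi>. q (fst \<xi>) * (x \<bullet> fst \<xi>)\<^sup>2)"
    using w(1) by (simp add: power2_eq_square inner_commute)
  have "0 \<le> x \<bullet> ((\<kappa>' *\<^sub>R H - (\<integral>\<xi>. qnorm2 Hi (fst \<xi>) *\<^sub>R outer (fst \<xi>) \<partial>P)) *v x)"
    using \<kappa>' by (simp add: smallest_positive_def loewner_le_def)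
  then show "(\<integral>\<xi>. q (fst \<xi>) * (x \<bullet> fst \<xi>)\<^sup>2 \<partial>P) \<le> \<kappa>' * (x \<bullet> (H *v x))"
    using w(2) by (simp add: power2_eq_square inner_commute matrix_vector_mult_diff_rdistrib inner_diff_right
        scaleR_matrix_vector_assoc[symmetric] qnorm2_def q_def)
qed

lemma norm_jump:
  "integrable P (\<lambda>\<xi>. (norm (x - \<gamma> *\<^sub>R ((x \<bullet> fst \<xi>) *\<^sub>R fst \<xi>)))\<^sup>2)" (is "integrable P ?f")
  "(\<integral>\<xi>. (norm (x - \<gamma> *\<^sub>R ((x \<bullet> fst \<xi>) *\<^sub>R fst \<xi>)))\<^sup>2 \<partial>P)
     \<le> (norm x)\<^sup>2 - (2 * \<gamma> - \<gamma>\<^sup>2 * R2) * (x \<bullet> (H *v x))"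
proof -
  have e: "?f \<xi> = (norm x)\<^sup>2 - 2 * \<gamma> * ((x \<bullet> fst \<xi>) * (fst \<xi> \<bullet> x)) + \<gamma>\<^sup>2 * ((norm (fst \<xi>))\<^sup>2 * (x \<bullet> fst \<xi>)\<^sup>2)" for \<xi>
    unfolding power2_norm_eq_inner
    by (simp add: inner_diff_left inner_diff_right inner_commute power2_eq_square algebra_simps)
  show "integrable P ?f" unfolding e using H_form(1)[of x x] fourth_moment(1)[of x] by simp
  have "(\<integral>\<xi>. ?f \<xi> \<partial>P) = (norm x)\<^sup>2 - 2 * \<gamma> * (x \<bullet> (H *v x)) + \<gamma>\<^sup>2 * (\<integral>\<xi>. (norm (fst \<xi>))\<^sup>2 * (x \<bullet> fst \<xi>)\<^sup>2 \<partial>P)"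
    unfolding e using H_form[of x x] fourth_moment(1)[of x] by (simp add: prob_space)
  also have "\<dots> \<le> (norm x)\<^sup>2 - 2 * \<gamma> * (x \<bullet> (H *v x)) + \<gamma>\<^sup>2 * (R2 * (x \<bullet> (H *v x)))"
    by (intro add_left_mono mult_left_mono fourth_moment) simp
  finally show "(\<integral>\<xi>. ?f \<xi> \<partial>P) \<le> (norm x)\<^sup>2 - (2 * \<gamma> - \<gamma>\<^sup>2 * R2) * (x \<bullet> (H *v x))"
    by (simp add: algebra_simps)
qed

text \<open>The first-order term pairs \<open>Hi *v v\<close> with \<open>H *v x\<close>, so the two
  matrices cancel and \<open>v \<bullet> x\<close> is left. The second-order term is the moment that
  \<kappa>' bounds.\<close>

lemma q_jump:
  "integrable P (\<lambda>\<xi>. q (v - \<gamma> *\<^sub>R ((x \<bullet> fst \<xi>) *\<^sub>R fst \<xi>)))" (is "integrable P ?f")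
  "(\<integral>\<xi>. q (v - \<gamma> *\<^sub>R ((x \<bullet> fst \<xi>) *\<^sub>R fst \<xi>)) \<partial>P)
     \<le> q v - 2 * \<gamma> * (v \<bullet> x) + \<gamma>\<^sup>2 * \<kappa>' * (x \<bullet> (H *v x))"
proof -
  have e: "?f \<xi> = q v - 2 * \<gamma> * (((Hi *v v) \<bullet> fst \<xi>) * (fst \<xi> \<bullet> x)) + \<gamma>\<^sup>2 * (q (fst \<xi>) * (x \<bullet> fst \<xi>)\<^sup>2)" for \<xi>
    using q_add[of v "- \<gamma> * (x \<bullet> fst \<xi>)" "fst \<xi>"] Hi_sym[of v "fst \<xi>"]
    by (simp add: inner_commute power_mult_distrib mult_ac)
  have i: "integrable P (\<lambda>\<xi>. ((Hi *v v) \<bullet> fst \<xi>) * (fst \<xi> \<bullet> x))" by (rule H_form)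
  have "(Hi *v v) \<bullet> (H *v x) = v \<bullet> x"
    using symmetric_form[OF H_sym, of "Hi *v v" x] by (simp add: H_Hi inner_commute)
  then have v: "(\<integral>\<xi>. ((Hi *v v) \<bullet> fst \<xi>) * (fst \<xi> \<bullet> x) \<partial>P) = v \<bullet> x" by (simp add: H_form)
  show "integrable P ?f" unfolding e using i weighted_fourth_moment(1)[of x] by simp
  have "(\<integral>\<xi>. ?f \<xi> \<partial>P) = q v - 2 * \<gamma> * (v \<bullet> x) + \<gamma>\<^sup>2 * (\<integral>\<xi>. q (fst \<xi>) * (x \<bullet> fst \<xi>)\<^sup>2 \<partial>P)"
    unfolding e using i v weighted_fourth_moment(1)[of x] by (simp add: prob_space)
  also have "\<dots> \<le> q v - 2 * \<gamma> * (v \<bullet> x) + \<gamma>\<^sup>2 * (\<kappa>' * (x \<bullet> (H *v x)))"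
    by (intro add_left_mono mult_left_mono weighted_fourth_moment) simp
  finally show "(\<integral>\<xi>. ?f \<xi> \<partial>P) \<le> q v - 2 * \<gamma> * (v \<bullet> x) + \<gamma>\<^sup>2 * \<kappa>' * (x \<bullet> (H *v x))"
    by (simp add: mult.assoc)
qed

lemma form_jump:
  fixes x z :: "real^'d"
  assumes "0 \<le> p" "0 \<le> b" "0 \<le> k"
  defines "h \<equiv> x \<bullet> (H *v x)"
  shows "(\<integral>\<^sup>+\<xi>. ennreal (p * (norm (x - \<gamma> *\<^sub>R ((x \<bullet> fst \<xi>) *\<^sub>R fst \<xi>)))\<^sup>2
             + b * q (z - \<gamma>' *\<^sub>R ((x \<bullet> fst \<xi>) *\<^sub>R fst \<xi>))
             + k * q ((z - \<gamma>' *\<^sub>R ((x \<bullet> fst \<xi>) *\<^sub>R fst \<xi>)) - (x - \<gamma> *\<^sub>R ((x \<bullet> fst \<xi>) *\<^sub>R fst \<xi>)))) \<partial>P)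
     \<le> ennreal (p * ((norm x)\<^sup>2 - (2 * \<gamma> - \<gamma>\<^sup>2 * R2) * h)
          + b * (q z - 2 * \<gamma>' * (z \<bullet> x) + \<gamma>'\<^sup>2 * \<kappa>' * h)
          + k * (q (z - x) - 2 * (\<gamma>' - \<gamma>) * ((z - x) \<bullet> x) + (\<gamma>' - \<gamma>)\<^sup>2 * \<kappa>' * h))"
  (is "?I \<le> ennreal ?R")
    and "0 \<le> p * ((norm x)\<^sup>2 - (2 * \<gamma> - \<gamma>\<^sup>2 * R2) * h)
          + b * (q z - 2 * \<gamma>' * (z \<bullet> x) + \<gamma>'\<^sup>2 * \<kappa>' * h)
          + k * (q (z - x) - 2 * (\<gamma>' - \<gamma>) * ((z - x) \<bullet> x) + (\<gamma>' - \<gamma>)\<^sup>2 * \<kappa>' * h)"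
proof -
  let ?v = "\<lambda>\<xi>. (x \<bullet> fst \<xi>) *\<^sub>R fst \<xi>"
  let ?f = "\<lambda>\<xi>. p * (norm (x - \<gamma> *\<^sub>R ?v \<xi>))\<^sup>2 + b * q (z - \<gamma>' *\<^sub>R ?v \<xi>)
             + k * q ((z - \<gamma>' *\<^sub>R ?v \<xi>) - (x - \<gamma> *\<^sub>R ?v \<xi>))"
  have u: "(z - \<gamma>' *\<^sub>R ?v \<xi>) - (x - \<gamma> *\<^sub>R ?v \<xi>) = (z - x) - (\<gamma>' - \<gamma>) *\<^sub>R ?v \<xi>" for \<xi>
    by (simp add: algebra_simps)
  note i = norm_jump(1)[of x \<gamma>] q_jump(1)[of z \<gamma>' x] q_jump(1)[of "z - x" "\<gamma>' - \<gamma>" x]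
  have nn: "0 \<le> ?f \<xi>" for \<xi> using assms q_nonneg by simp
  have "integrable P ?f" unfolding u using i by simp
  then have "?I = ennreal (\<integral>\<xi>. ?f \<xi> \<partial>P)" by (intro nn_integral_eq_integral AE_I2 nn)
  moreover have "(\<integral>\<xi>. ?f \<xi> \<partial>P) = p * (\<integral>\<xi>. (norm (x - \<gamma> *\<^sub>R ?v \<xi>))\<^sup>2 \<partial>P) + b * (\<integral>\<xi>. q (z - \<gamma>' *\<^sub>R ?v \<xi>) \<partial>P)
      + k * (\<integral>\<xi>. q ((z - x) - (\<gamma>' - \<gamma>) *\<^sub>R ?v \<xi>) \<partial>P)"
    unfolding u using i by simp
  moreover have "\<dots> \<le> ?R"
    unfolding h_def using assms by (intro add_mono mult_left_mono norm_jump q_jump)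
  moreover have "0 \<le> (\<integral>\<xi>. ?f \<xi> \<partial>P)" by (intro integral_nonneg_AE AE_I2 nn)
  ultimately show "?I \<le> ennreal ?R" "0 \<le> ?R" by (auto intro!: ennreal_leI)
qed

end

section \<open>Trajectories of the averaged process\<close>

type_synonym 'd state = "(real^'d) \<times> (real^'d)"

text \<open>Both coordinates drift along \<open>z - x\<close>, so two scalar coefficients describe
  the whole flow.\<close>

definition mix_flow :: "(real \<Rightarrow> real \<Rightarrow> real) \<Rightarrow> (real \<Rightarrow> real \<Rightarrow> real) \<Rightarrow> real \<Rightarrow> real \<Rightarrow> ('d :: finite) state \<Rightarrow> 'd state" where
  "mix_flow p r s u w = (fst w + p s u *\<^sub>R (snd w - fst w), snd w + r s u *\<^sub>R (fst w - snd w))"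

text \<open>The jump in coordinates centred at the optimum: for a noiseless mark the residual is
  linear in the centred \<open>x\<close>, and \<open>b\<close> disappears.\<close>

definition sgd_jump ::
    "(real \<Rightarrow> real) \<Rightarrow> (real \<Rightarrow> real) \<Rightarrow> real \<Rightarrow> (real^'d) \<times> real \<Rightarrow> ('d :: finite) state \<Rightarrow> 'd state" where
  "sgd_jump \<gamma> \<gamma>' u \<xi> w = (fst w - \<gamma> u *\<^sub>R ((fst w \<bullet> fst \<xi>) *\<^sub>R fst \<xi>),
                          snd w - \<gamma>' u *\<^sub>R ((fst w \<bullet> fst \<xi>) *\<^sub>R fst \<xi>))"

lemma jump_flow_mix_sgd:
  fixes P :: "((real^'d) \<times> real) measure"
  assumes "prob_space P" and P: "sets P = sets borel"
    and p: "(\<lambda>(s, u). p s u) \<in> borel_measurable borel" and r: "(\<lambda>(s, u). r s u) \<in> borel_measurable borel"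
    and [measurable]: "\<gamma> \<in> borel_measurable borel" "\<gamma>' \<in> borel_measurable borel"
  shows "jump_flow P borel (mix_flow p r) (sgd_jump \<gamma> \<gamma>')"
proof -
  interpret prob_space P by fact
  show ?thesis
  proof
    have [measurable]: "(\<lambda>w :: real \<times> real \<times> 'd state. p (fst w) (fst (snd w))) \<in> borel_measurable borel"
      "(\<lambda>w :: real \<times> real \<times> 'd state. r (fst w) (fst (snd w))) \<in> borel_measurable borel"
      using measurable_compose[OF _ p, of "\<lambda>w :: real \<times> real \<times> 'd state. (fst w, fst (snd w))" borel]
        measurable_compose[OF _ r, of "\<lambda>w :: real \<times> real \<times> 'd state. (fst w, fst (snd w))" borel]
      by (auto simp: borel_prod[symmetric])
    have [measurable]: "(\<lambda>w :: real \<times> real \<times> 'd state. fst (snd (snd w))) \<in> borel_measurable borel"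
      "(\<lambda>w :: real \<times> real \<times> 'd state. snd (snd (snd w))) \<in> borel_measurable borel"
      by (auto intro!: borel_measurable_continuous_onI continuous_intros)
    have "(\<lambda>w :: real \<times> real \<times> 'd state. mix_flow p r (fst w) (fst (snd w)) (snd (snd w))) \<in> borel_measurable borel"
      unfolding mix_flow_def by (intro borel_measurable_Pair borel_measurable_add borel_measurable_scaleR borel_measurable_diff) measurable
    then show "(\<lambda>(s, t, w :: 'd state). mix_flow p r s t w) \<in> borel \<Otimes>\<^sub>M borel \<Otimes>\<^sub>M borel \<rightarrow>\<^sub>M borel"
      by (simp add: borel_prod case_prod_beta)
    have "(\<lambda>w :: real \<times> ((real^'d) \<times> real) \<times> 'd state. sgd_jump \<gamma> \<gamma>' (fst w) (fst (snd w)) (snd (snd w))) \<in> borel_measurable borel"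
    proof -
      have [measurable]: "(\<lambda>w :: real \<times> ((real^'d) \<times> real) \<times> 'd state. fst (snd (snd w))) \<in> borel_measurable borel"
        "(\<lambda>w :: real \<times> ((real^'d) \<times> real) \<times> 'd state. snd (snd (snd w))) \<in> borel_measurable borel"
        "(\<lambda>w :: real \<times> ((real^'d) \<times> real) \<times> 'd state. fst (fst (snd w))) \<in> borel_measurable borel"
        "(\<lambda>w :: real \<times> ((real^'d) \<times> real) \<times> 'd state. fst w) \<in> borel_measurable borel"
        by (auto intro!: borel_measurable_continuous_onI continuous_intros)
      show ?thesis
        unfolding sgd_jump_def by (intro borel_measurable_Pair borel_measurable_diff borel_measurable_scaleR) measurable
    qed
    then show "(\<lambda>(u, a, w :: 'd state). sgd_jump \<gamma> \<gamma>' u a w) \<in> borel \<Otimes>\<^sub>M P \<Otimes>\<^sub>M borel \<rightarrow>\<^sub>M borel"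
      by (subst measurable_cong_sets[where M'="borel \<Otimes>\<^sub>M borel \<Otimes>\<^sub>M borel", OF sets_pair_measure_cong[OF refl sets_pair_measure_cong[OF P refl]] refl])
        (simp add: borel_prod case_prod_beta)
  qed simp
qed

text \<open>At the left end only right continuity is recorded: this is what a path provides after a
  jump, and also at time 0, where the coefficients may blow up.\<close>

definition ode_on :: "(real \<Rightarrow> real) \<Rightarrow> (real \<Rightarrow> real) \<Rightarrow> real \<Rightarrow> real \<Rightarrow> (real \<Rightarrow> real^'d) \<Rightarrow> (real \<Rightarrow> real^'d) \<Rightarrow> bool" where
  "ode_on \<eta> \<eta>' s t x z \<longleftrightarrow>
     (x \<longlongrightarrow> x s) (at_right s) \<and> (z \<longlongrightarrow> z s) (at_right s) \<and>
     (\<forall>u\<in>{s<..<t}. (x has_vector_derivative \<eta> u *\<^sub>R (z u - x u)) (at u) \<and>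
                  (z has_vector_derivative \<eta>' u *\<^sub>R (x u - z u)) (at u))"

text \<open>Every solution has to agree with the flow, so uniqueness is included. Continuity in time
  is part of it because the value of the flow at a jump time has to be the left limit of the path.
  The argument \<open>d\<close> fixes the dimension.\<close>

definition solves :: "(real \<Rightarrow> real \<Rightarrow> real) \<Rightarrow> (real \<Rightarrow> real \<Rightarrow> real) \<Rightarrow> (real \<Rightarrow> real) \<Rightarrow> (real \<Rightarrow> real) \<Rightarrow> ('d :: finite) itself \<Rightarrow> bool" where
  "solves p r \<eta> \<eta>' d \<longleftrightarrow>
     (\<forall>s u (x :: real \<Rightarrow> real^'d) z t. 0 \<le> s \<longrightarrow> s < u \<longrightarrow> u < t \<longrightarrow> ode_on \<eta> \<eta>' s t x z \<longrightarrow>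
        (x u, z u) = mix_flow p r s u (x s, z s)) \<and>
     (\<forall>s. p s s = 0 \<and> r s s = 0) \<and>
     (\<forall>s u. 0 \<le> s \<longrightarrow> s < u \<longrightarrow> isCont (p s) u \<and> isCont (r s) u)"

text \<open>No jump time lies strictly between \<open>jump_time T k\<close> and \<open>T k\<close>,
  so the equations hold on the whole piece and the path follows the flow there; continuity of the
  flow then identifies the left limits that enter the jump.\<close>

lemma continuized_path_flow:
  fixes x z :: "real \<Rightarrow> real^'d" and xs :: "real^'d"
  assumes path: "continuized_path \<eta> \<eta>' \<gamma> \<gamma>' T \<xi> x z"
    and T: "\<And>k. jump_time T k < T k"
    and marks: "\<And>k. snd (\<xi> k) = xs \<bullet> fst (\<xi> k)"
    and solves: "solves p r \<eta> \<eta>' TYPE('d)"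
  defines "w \<equiv> \<lambda>t. (x t - xs, z t - xs)"
  shows "jump_time T k \<le> u \<Longrightarrow> u < T k \<Longrightarrow> w u = mix_flow p r (jump_time T k) u (w (jump_time T k))"
    and "w (T k) = sgd_jump \<gamma> \<gamma>' (T k) (\<xi> k) (mix_flow p r (jump_time T k) (T k) (w (jump_time T k)))"
proof -
  let ?S = "jump_time T"
  have SS: "?S (Suc k) = T k" for k by (simp add: jump_time_def)
  have mono: "mono ?S" unfolding mono_iff_le_Suc using T by (simp add: SS less_imp_le)
  have S0: "0 \<le> ?S k" for k using monoD[OF mono, of 0 k] by (simp add: jump_time_def)
  have noT: "v \<notin> range T" if "?S k < v" "v < T k" for v k
  proof
    assume "v \<in> range T"
    then obtain j where "v = ?S (Suc j)" by (auto simp: SS)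
    show False
    proof (cases "Suc j \<le> k")
      case True
      then show False using monoD[OF mono True] that(1) \<open>v = ?S (Suc j)\<close> by linarith
    next
      case False
      then have "?S (Suc k) \<le> ?S (Suc j)" by (intro monoD[OF mono]) simp
      then show False using that(2) \<open>v = ?S (Suc j)\<close> SS[of k] by linarith
    qed
  qed
  have ode: "ode_on \<eta> \<eta>' (?S k) (T k) (\<lambda>t. x t - xs) (\<lambda>t. z t - xs)" for k
    unfolding ode_on_def
  proof (intro conjI ballI)
    show "((\<lambda>t. x t - xs) \<longlongrightarrow> x (?S k) - xs) (at_right (?S k))" "((\<lambda>t. z t - xs) \<longlongrightarrow> z (?S k) - xs) (at_right (?S k))"
      using path S0[of k] by (auto simp: continuized_path_def cadlag_def intro!: tendsto_intros)
    fix v assume v: "v \<in> {?S k<..<T k}"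
    then have "(x has_vector_derivative \<eta> v *\<^sub>R (z v - x v)) (at v)" "(z has_vector_derivative \<eta>' v *\<^sub>R (x v - z v)) (at v)"
      using path noT[of k v] S0[of k] by (auto simp: continuized_path_def)
    then show "((\<lambda>t. x t - xs) has_vector_derivative \<eta> v *\<^sub>R (z v - xs - (x v - xs))) (at v)"
      "((\<lambda>t. z t - xs) has_vector_derivative \<eta>' v *\<^sub>R (x v - xs - (z v - xs))) (at v)"
      by (simp_all add: has_vector_derivative_diff_const)
  qed
  have flow: "w u = mix_flow p r (?S k) u (w (?S k))" if "?S k \<le> u" "u < T k" for u k
  proof (cases "u = ?S k")
    case True
    then show ?thesis using solves by (simp add: solves_def mix_flow_def)
  next
    case False
    then have "?S k < u" using that by simp
    from solves[unfolded solves_def, THEN conjunct1, rule_format, OF S0[of k] this that(2) ode]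
    show ?thesis unfolding w_def .
  qed
  then show "?S k \<le> u \<Longrightarrow> u < T k \<Longrightarrow> w u = mix_flow p r (?S k) u (w (?S k))" .
  let ?f = "\<lambda>u. mix_flow p r (?S k) u (w (?S k))"
  have cont: "isCont ?f (T k)"
  proof -
    have "isCont (p (?S k)) (T k)" "isCont (r (?S k)) (T k)"
      using solves S0[of k] T[of k] unfolding solves_def by blast+
    then show ?thesis unfolding mix_flow_def by (intro continuous_intros)
  qed
  have "eventually (\<lambda>u. ?f u = w u) (at_left (T k))"
  proof -
    have "?f u = w u" if "?S k < u" "u < T k" for u
      using flow[of k u] that by simp
    then show ?thesis unfolding eventually_at_left_field using T[of k] by blast
  qed
  then have "(w \<longlongrightarrow> ?f (T k)) (at_left (T k))"
    using cont[unfolded isCont_def, THEN tendsto_within_subset[OF _ subset_UNIV]]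
    by (rule Lim_transform_eventually[rotated])
  from tendsto_add[OF this tendsto_const[of "(xs, xs)"]]
  have lim: "((\<lambda>t. (x t, z t)) \<longlongrightarrow> ?f (T k) + (xs, xs)) (at_left (T k))"
    by (simp add: w_def)
  have lx: "left_lim x (T k) = fst (?f (T k)) + xs" and lz: "left_lim z (T k) = snd (?f (T k)) + xs"
    unfolding left_lim_def using tendsto_fst[OF lim] tendsto_snd[OF lim]
    by (auto intro!: tendsto_Lim)
  have "x (T k) = left_lim x (T k) - \<gamma> (T k) *\<^sub>R sgrad (left_lim x (T k)) (\<xi> k)"
    "z (T k) = left_lim z (T k) - \<gamma>' (T k) *\<^sub>R sgrad (left_lim x (T k)) (\<xi> k)"
    using path by (auto simp: continuized_path_def)
  moreover have "sgrad (left_lim x (T k)) (\<xi> k) = (fst (?f (T k)) \<bullet> fst (\<xi> k)) *\<^sub>R fst (\<xi> k)"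
    by (simp add: sgrad_def lx marks inner_add_left algebra_simps)
  ultimately show "w (T k) = sgd_jump \<gamma> \<gamma>' (T k) (\<xi> k) (?f (T k))"
    by (simp add: w_def sgd_jump_def lx lz)
qed

text \<open>This serves as the uniqueness argument: solutions are recovered from first integrals,
  which are constant inside the interval, and the one-sided limit at \<open>s\<close> identifies the
  constant even where the coefficients are singular.\<close>

lemma constant_from_right:
  fixes f :: "real \<Rightarrow> 'a :: real_normed_vector"
  assumes "(f \<longlongrightarrow> l) (at_right s)" and "\<And>v. v \<in> {s<..<t} \<Longrightarrow> (f has_vector_derivative 0) (at v)"
    and "s < u" "u < t"
  shows "f u = l"
proof -
  have "\<exists>c. \<forall>v\<in>{s<..<t}. f v = c"
    using has_vector_derivative_zero_constant[of "{s<..<t}" f] assms(2)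
    by (metis convex_real_interval(8) has_vector_derivative_at_within)
  then obtain c where c: "\<And>v. v \<in> {s<..<t} \<Longrightarrow> f v = c" by blast
  have "eventually (\<lambda>v. c = f v) (at_right s)"
    using c assms(3,4) unfolding eventually_at_right_field by (intro exI[of _ t]) auto
  then have "(f \<longlongrightarrow> c) (at_right s)"
    by (rule Lim_transform_eventually[OF tendsto_const])
  then have "c = l" using assms(1) by (intro tendsto_unique[of "at_right s" f]) auto
  then show ?thesis using c assms(3,4) by auto
qed

text \<open>The branch matters at \<open>s = u = 0\<close>, where division by zero would turn the
  other expression into 1, while a flow has to start with coefficient 0.\<close>

abbreviation nesterov_mix :: "real \<Rightarrow> real \<Rightarrow> real" where
  "nesterov_mix s u \<equiv> (if u \<le> s then 0 else 1 - (s / u)\<^sup>2)"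

text \<open>The first integrals are \<open>z\<close> and \<open>x - z\<close> scaled by
  \<open>u^2\<close>. For \<open>s = 0\<close> the second one is 0, so the flow puts
  \<open>x\<close> on \<open>z\<close> at once.\<close>

lemma solves_nesterov: "solves nesterov_mix (\<lambda>_ _. 0) (\<lambda>t. 2 / t) (\<lambda>_. 0) TYPE('d :: finite)"
  unfolding solves_def
proof (intro conjI allI impI)
  fix s u t :: real and x z :: "real \<Rightarrow> real^'d"
  assume s: "0 \<le> s" "s < u" "u < t" and o: "ode_on (\<lambda>t. 2 / t) (\<lambda>_. 0) s t x z"
  have z: "z u = z s"
    by (rule constant_from_right[of z _ s t]) (use o s in \<open>auto simp: ode_on_def\<close>)
  have "u\<^sup>2 *\<^sub>R (x u - z u) = s\<^sup>2 *\<^sub>R (x s - z s)"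
  proof (rule constant_from_right[of "\<lambda>u. u\<^sup>2 *\<^sub>R (x u - z u)" _ s t])
    show "((\<lambda>u. u\<^sup>2 *\<^sub>R (x u - z u)) \<longlongrightarrow> s\<^sup>2 *\<^sub>R (x s - z s)) (at_right s)"
      using o by (auto simp: ode_on_def intro!: tendsto_intros)
    fix v assume v: "v \<in> {s<..<t}"
    have "((\<lambda>u. u\<^sup>2 *\<^sub>R (x u - z u)) has_vector_derivative
        (v\<^sup>2 *\<^sub>R ((2 / v) *\<^sub>R (z v - x v) - 0 *\<^sub>R (x v - z v)) + (2 * v) *\<^sub>R (x v - z v))) (at v)"
      using o v by (intro has_vector_derivative_scaleR has_vector_derivative_diff)
        (auto simp: ode_on_def intro!: derivative_eq_intros)
    also have "v\<^sup>2 *\<^sub>R ((2 / v) *\<^sub>R (z v - x v) - 0 *\<^sub>R (x v - z v)) + (2 * v) *\<^sub>R (x v - z v) = 0"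
      using v s by (simp add: power2_eq_square algebra_simps)
    finally show "((\<lambda>u. u\<^sup>2 *\<^sub>R (x u - z u)) has_vector_derivative 0) (at v)" .
  qed (use s in auto)
  have "x u - z u = (s / u)\<^sup>2 *\<^sub>R (x s - z s)"
  proof -
    have "(1 / u\<^sup>2) *\<^sub>R (u\<^sup>2 *\<^sub>R (x u - z u)) = (1 / u\<^sup>2) *\<^sub>R (s\<^sup>2 *\<^sub>R (x s - z s))"
      using \<open>u\<^sup>2 *\<^sub>R (x u - z u) = _\<close> by (rule arg_cong)
    then show ?thesis using s by (simp add: power_divide)
  qed
  then have "x u = z s + (s / u)\<^sup>2 *\<^sub>R (x s - z s)" using z by (simp add: algebra_simps)
  then show "(x u, z u) = mix_flow nesterov_mix (\<lambda>_ _. 0) s u (x s, z s)"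
    using s z by (simp add: mix_flow_def algebra_simps)
next
  fix s u :: real assume s: "0 \<le> s" "s < u"
  have "isCont (\<lambda>u. 1 - (s / u)\<^sup>2) u" using s by (intro continuous_intros) auto
  moreover have "eventually (\<lambda>v. (1 - (s / v)\<^sup>2) = nesterov_mix s v) (nhds u)"
    using eventually_nhds_in_open[of "{s<..}" u] s by (auto elim!: eventually_mono)
  ultimately show "isCont (nesterov_mix s) u"
    by (subst isCont_cong[symmetric])
qed auto

abbreviation exp_mix :: "real \<Rightarrow> real \<Rightarrow> real \<Rightarrow> real" where
  "exp_mix \<omega> s u \<equiv> (1 - exp (- 2 * \<omega> * (u - s))) / 2"

text \<open>The sum \<open>x + z\<close> is conserved and the difference \<open>x - z\<close> decays
  at rate 2 \<omega>; the coefficients come from solving for \<open>x\<close> and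
  \<open>z\<close>.\<close>

lemma solves_exp: "solves (exp_mix \<omega>) (exp_mix \<omega>) (\<lambda>_. \<omega>) (\<lambda>_. \<omega>) TYPE('d :: finite)"
  unfolding solves_def
proof (intro conjI allI impI)
  fix s u t :: real and x z :: "real \<Rightarrow> real^'d"
  assume s: "0 \<le> s" "s < u" "u < t" and o: "ode_on (\<lambda>_. \<omega>) (\<lambda>_. \<omega>) s t x z"
  have 1: "x u + z u = x s + z s"
  proof (rule constant_from_right[of "\<lambda>u. x u + z u" _ s t])
    show "((\<lambda>u. x u + z u) \<longlongrightarrow> x s + z s) (at_right s)"
      using o by (auto simp: ode_on_def intro!: tendsto_intros)
    fix v assume "v \<in> {s<..<t}"
    then have "((\<lambda>u. x u + z u) has_vector_derivative (\<omega> *\<^sub>R (z v - x v) + \<omega> *\<^sub>R (x v - z v))) (at v)"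
      using o by (intro has_vector_derivative_add) (auto simp: ode_on_def)
    then show "((\<lambda>u. x u + z u) has_vector_derivative 0) (at v)" by (simp add: algebra_simps)
  qed (use s in auto)
  have "exp (2 * \<omega> * (u - s)) *\<^sub>R (x u - z u) = exp (2 * \<omega> * (s - s)) *\<^sub>R (x s - z s)"
  proof (rule constant_from_right[of "\<lambda>u. exp (2 * \<omega> * (u - s)) *\<^sub>R (x u - z u)" _ s t])
    show "((\<lambda>u. exp (2 * \<omega> * (u - s)) *\<^sub>R (x u - z u)) \<longlongrightarrow> exp (2 * \<omega> * (s - s)) *\<^sub>R (x s - z s)) (at_right s)"
      using o by (intro tendsto_intros) (auto simp: ode_on_def)
    fix v assume v: "v \<in> {s<..<t}"
    have "((\<lambda>u. exp (2 * \<omega> * (u - s)) *\<^sub>R (x u - z u)) has_vector_derivative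
       (exp (2 * \<omega> * (v - s)) *\<^sub>R (\<omega> *\<^sub>R (z v - x v) - \<omega> *\<^sub>R (x v - z v))
        + (exp (2 * \<omega> * (v - s)) * (2 * \<omega>)) *\<^sub>R (x v - z v))) (at v)"
      using o v by (intro has_vector_derivative_scaleR has_vector_derivative_diff)
        (auto simp: ode_on_def intro!: derivative_eq_intros)
    also have "exp (2 * \<omega> * (v - s)) *\<^sub>R (\<omega> *\<^sub>R (z v - x v) - \<omega> *\<^sub>R (x v - z v))
        + (exp (2 * \<omega> * (v - s)) * (2 * \<omega>)) *\<^sub>R (x v - z v) = 0"
      by (simp add: scaleR_diff_right scaleR_scaleR[symmetric] scaleR_2 del: scaleR_scaleR)
    finally show "((\<lambda>u. exp (2 * \<omega> * (u - s)) *\<^sub>R (x u - z u)) has_vector_derivative 0) (at v)" .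
  qed (use s in auto)
  then have "exp (- (2 * \<omega> * (u - s))) *\<^sub>R (exp (2 * \<omega> * (u - s)) *\<^sub>R (x u - z u)) = exp (- (2 * \<omega> * (u - s))) *\<^sub>R (x s - z s)"
    by simp
  then have 2: "x u - z u = exp (- 2 * \<omega> * (u - s)) *\<^sub>R (x s - z s)"
    by (simp add: exp_minus)
  let ?e = "exp (- 2 * \<omega> * (u - s))"
  define e where "e = ?e"
  have c: "x u $ i + z u $ i = x s $ i + z s $ i" "x u $ i - z u $ i = e * (x s $ i - z s $ i)" for i
    using arg_cong[OF 1, of "\<lambda>v. v $ i"] arg_cong[OF 2, of "\<lambda>v. v $ i"] by (simp_all add: e_def)
  have "x u = x s + ((1 - e) / 2) *\<^sub>R (z s - x s)"
    unfolding vec_eq_iff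
  proof
    fix i
    show "x u $ i = (x s + ((1 - e) / 2) *\<^sub>R (z s - x s)) $ i"
      using c[of i] by (simp add: field_simps)
  qed
  moreover have "z u = z s + ((1 - e) / 2) *\<^sub>R (x s - z s)"
    unfolding vec_eq_iff
  proof
    fix i
    show "z u $ i = (z s + ((1 - e) / 2) *\<^sub>R (x s - z s)) $ i"
      using c[of i] by (simp add: field_simps)
  qed
  ultimately show "(x u, z u) = mix_flow (exp_mix \<omega>) (exp_mix \<omega>) s u (x s, z s)"
    by (simp add: mix_flow_def e_def)
qed (auto intro!: continuous_intros)

section \<open>Quadratic Lyapunov functions\<close>

context least_squares
begin

definition form :: "(real \<Rightarrow> real) \<Rightarrow> (real \<Rightarrow> real) \<Rightarrow> (real \<Rightarrow> real) \<Rightarrow> real \<Rightarrow> 'd state \<Rightarrow> real" where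
  "form A B K t w = A t * (norm (fst w))\<^sup>2 + B t * q (snd w) + K t * q (snd w - fst w)"

lemma q_meas [measurable]: "q \<in> borel_measurable borel"
  by (rule borel_measurable_continuous_onI) (intro continuous_intros)

lemma form_measurable:
  assumes [measurable]: "A \<in> borel_measurable borel" "B \<in> borel_measurable borel" "K \<in> borel_measurable borel"
  shows "(\<lambda>(t, w). form A B K t w) \<in> borel_measurable (borel \<Otimes>\<^sub>M borel)"
proof -
  have [measurable]: "(\<lambda>w :: real \<times> 'd state. fst (snd w)) \<in> borel_measurable borel"
    "(\<lambda>w :: real \<times> 'd state. snd (snd w)) \<in> borel_measurable borel"
    "(\<lambda>w :: real \<times> 'd state. fst w) \<in> borel_measurable borel"
    by (auto intro!: borel_measurable_continuous_onI continuous_intros)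
  have "(\<lambda>w :: real \<times> 'd state. form A B K (fst w) (snd w)) \<in> borel_measurable borel"
    unfolding form_def by measurable
  then show ?thesis by (simp add: borel_prod case_prod_beta)
qed

lemma form_mix:
  "form A B K u (mix_flow p r s u w) =
     A u * ((norm (fst w))\<^sup>2 + 2 * p s u * (fst w \<bullet> (snd w - fst w)) + (p s u)\<^sup>2 * (norm (snd w - fst w))\<^sup>2)
     + B u * (q (snd w) - 2 * r s u * (snd w \<bullet> (Hi *v (snd w - fst w))) + (r s u)\<^sup>2 * q (snd w - fst w))
     + K u * ((1 - p s u - r s u)\<^sup>2 * q (snd w - fst w))"
proof -
  let ?d = "snd w - fst w"
  have 1: "snd w + r s u *\<^sub>R (fst w - snd w) = snd w + (- r s u) *\<^sub>R ?d" by (simp add: algebra_simps)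
  have 2: "snd w + r s u *\<^sub>R (fst w - snd w) - (fst w + p s u *\<^sub>R ?d) = (1 - p s u - r s u) *\<^sub>R ?d"
    by (simp add: algebra_simps)
  have 3: "q (c *\<^sub>R v) = c\<^sup>2 * q v" for c v using q_add[of 0 c v] by (simp add: q_def)
  have 4: "(norm (fst w + c *\<^sub>R ?d))\<^sup>2 = (norm (fst w))\<^sup>2 + 2 * c * (fst w \<bullet> ?d) + c\<^sup>2 * (norm ?d)\<^sup>2" for c
    unfolding power2_norm_eq_inner
    by (simp only: inner_add_left inner_add_right inner_scaleR_left inner_scaleR_right inner_commute[of ?d "fst w"])
      (simp add: power2_eq_square algebra_simps)
  show ?thesis
    unfolding form_def mix_flow_def fst_conv snd_conv 2 3 4 unfolding 1 q_add by simp
qed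

end

text \<open>The flow multiplies \<open>z - x\<close> by \<open>1 - p s u - r s u\<close>, so the two
  derivative rules say that the flow itself satisfies the equations from every state;
  \<open>solves\<close> is the converse statement about given solutions.\<close>

locale averaged_sgd = least_squares P H R2 \<kappa>'
  for P :: "((real^'d) \<times> real) measure" and H :: "real^'d^'d" and R2 \<kappa>' :: real +
  fixes p r :: "real \<Rightarrow> real \<Rightarrow> real" and \<eta> \<eta>' \<gamma> \<gamma>' :: "real \<Rightarrow> real"
  assumes p_meas: "(\<lambda>(s, u). p s u) \<in> borel_measurable borel" and r_meas: "(\<lambda>(s, u). r s u) \<in> borel_measurable borel"
    and \<gamma>_meas: "\<gamma> \<in> borel_measurable borel" and \<gamma>'_meas: "\<gamma>' \<in> borel_measurable borel"
    and solves: "solves p r \<eta> \<eta>' TYPE('d)"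
    and p_deriv: "\<And>s u. 0 \<le> s \<Longrightarrow> s < u \<Longrightarrow> (p s has_real_derivative \<eta> u * (1 - p s u - r s u)) (at u)"
    and r_deriv: "\<And>s u. 0 \<le> s \<Longrightarrow> s < u \<Longrightarrow> (r s has_real_derivative \<eta>' u * (1 - p s u - r s u)) (at u)"

sublocale averaged_sgd \<subseteq> jump_flow P borel "mix_flow p r" "sgd_jump \<gamma> \<gamma>'"
  by (rule jump_flow_mix_sgd[OF prob_space_axioms sets_P p_meas r_meas \<gamma>_meas \<gamma>'_meas])

context averaged_sgd
begin

text \<open>The generator applied to \<open>form\<close>, bounded from above. The terms with \<eta>
  and \<eta>' are the drift, those with \<gamma> and \<gamma>' the averaged jump increments, where
  \<open>R2\<close> and \<kappa>' stand in for the exact second-order moments.\<close>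

definition generator_bound :: "real \<Rightarrow> real \<Rightarrow> real \<Rightarrow> real \<Rightarrow> real \<Rightarrow> real \<Rightarrow> real \<Rightarrow> real^'d \<Rightarrow> real^'d \<Rightarrow> real" where
  "generator_bound u A B K A' B' K' x z =
     A' * (norm x)\<^sup>2 + 2 * A * \<eta> u * (x \<bullet> (z - x)) + B' * q z - 2 * B * \<eta>' u * (z \<bullet> (Hi *v (z - x)))
     + (K' - 2 * K * (\<eta> u + \<eta>' u)) * q (z - x)
     - A * (2 * \<gamma> u - (\<gamma> u)\<^sup>2 * R2) * (x \<bullet> (H *v x))
     + B * (- 2 * \<gamma>' u * (z \<bullet> x) + (\<gamma>' u)\<^sup>2 * \<kappa>' * (x \<bullet> (H *v x)))
     + K * (- 2 * (\<gamma>' u - \<gamma> u) * ((z - x) \<bullet> x) + (\<gamma>' u - \<gamma> u)\<^sup>2 * \<kappa>' * (x \<bullet> (H *v x)))"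

text \<open>Continuity is required of the form along the flow and not of the flow: with drift
  \<open>2 / t\<close> the flow started at 0 is discontinuous there, and the form stays continuous
  only through weights that vanish at 0.\<close>

lemma form_supersolution:
  assumes a: "0 \<le> a"
    and meas: "A \<in> borel_measurable borel" "B \<in> borel_measurable borel" "K \<in> borel_measurable borel"
    and nonneg: "\<And>u. a \<le> u \<Longrightarrow> u \<le> b \<Longrightarrow> 0 \<le> A u \<and> 0 \<le> B u \<and> 0 \<le> K u"
    and cont: "\<And>s w. a \<le> s \<Longrightarrow> s < b \<Longrightarrow> continuous_on {s..b} (\<lambda>u. form A B K u (mix_flow p r s u w))"
    and deriv: "\<And>u. a < u \<Longrightarrow> u < b \<Longrightarrow> (A has_real_derivative A' u) (at u)"
      "\<And>u. a < u \<Longrightarrow> u < b \<Longrightarrow> (B has_real_derivative B' u) (at u)"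
      "\<And>u. a < u \<Longrightarrow> u < b \<Longrightarrow> (K has_real_derivative K' u) (at u)"
    and gen: "\<And>u x z. a < u \<Longrightarrow> u < b \<Longrightarrow> generator_bound u (A u) (B u) (K u) (A' u) (B' u) (K' u) x z \<le> 0"
  shows "supersolution a b (\<lambda>u w. ennreal (form A B K u w))"
proof (rule supersolutionI)
  show "(\<lambda>(u, w). form A B K u w) \<in> borel_measurable (borel \<Otimes>\<^sub>M borel)"
    by (rule form_measurable[OF meas])
  show "0 \<le> form A B K u w" if "a \<le> u" "u \<le> b" for u w
    using nonneg[OF that] q_nonneg by (simp add: form_def)
  show "form A B K s (mix_flow p r s s w) = form A B K s w" for s w
    using solves by (simp add: solves_def mix_flow_def)
  let ?D = "\<lambda>u w. A' u * (norm (fst w))\<^sup>2 + 2 * A u * \<eta> u * (fst w \<bullet> (snd w - fst w))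
     + B' u * q (snd w) - 2 * B u * \<eta>' u * (snd w \<bullet> (Hi *v (snd w - fst w)))
     + (K' u - 2 * K u * (\<eta> u + \<eta>' u)) * q (snd w - fst w)"
  show "((\<lambda>u. form A B K u (mix_flow p r s u w)) has_real_derivative ?D u (mix_flow p r s u w)) (at u)"
    if s: "a \<le> s" "s < u" and "u < b" for s u w
  proof -
    have u: "a < u" "u < b" using that by auto
    let ?x = "fst w" and ?z = "snd w" and ?d = "snd w - fst w"
    define pu ru where "pu = p s u" and "ru = r s u"
    define X c n Q1 Q2 Q3 where "X = (norm ?x)\<^sup>2" and "c = ?x \<bullet> ?d" and "n = (norm ?d)\<^sup>2"
      and "Q1 = q ?z" and "Q2 = ?z \<bullet> (Hi *v ?d)" and "Q3 = q ?d"
    have dp: "(p s has_real_derivative \<eta> u * (1 - pu - ru)) (at u)"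
      and dr: "(r s has_real_derivative \<eta>' u * (1 - pu - ru)) (at u)"
      unfolding pu_def ru_def using a s by (auto intro!: p_deriv r_deriv)
    note ders = deriv(1)[OF u] deriv(2)[OF u] deriv(3)[OF u] dp dr
    have "((\<lambda>u. A u * (X + 2 * p s u * c + (p s u)\<^sup>2 * n) + B u * (Q1 - 2 * r s u * Q2 + (r s u)\<^sup>2 * Q3)
           + K u * ((1 - p s u - r s u)\<^sup>2 * Q3)) has_real_derivative
        (A' u * (X + 2 * pu * c + pu\<^sup>2 * n) + A u * (2 * (\<eta> u * (1 - pu - ru)) * c + 2 * pu * (\<eta> u * (1 - pu - ru)) * n)
         + (B' u * (Q1 - 2 * ru * Q2 + ru\<^sup>2 * Q3) + B u * (- 2 * (\<eta>' u * (1 - pu - ru)) * Q2 + 2 * ru * (\<eta>' u * (1 - pu - ru)) * Q3))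
         + (K' u * ((1 - pu - ru)\<^sup>2 * Q3) - K u * (2 * (1 - pu - ru) * ((\<eta> u + \<eta>' u) * (1 - pu - ru)) * Q3)))) (at u)"
      by (rule derivative_eq_intros ders refl)+ (simp add: pu_def ru_def power2_eq_square algebra_simps)
    moreover
    let ?w = "mix_flow p r s u w"
    have fz: "snd ?w = ?z + (- ru) *\<^sub>R ?d" and fx: "fst ?w = ?x + pu *\<^sub>R ?d" and fd: "snd ?w - fst ?w = (1 - pu - ru) *\<^sub>R ?d"
      by (simp_all add: mix_flow_def pu_def ru_def algebra_simps)
    have q3: "q (c *\<^sub>R v) = c\<^sup>2 * q v" for c v using q_add[of 0 c v] by (simp add: q_def)
    have e1: "(norm (fst ?w))\<^sup>2 = X + 2 * pu * c + pu\<^sup>2 * n"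
      unfolding fx X_def c_def n_def power2_norm_eq_inner
      by (simp only: inner_add_left inner_add_right inner_scaleR_left inner_scaleR_right inner_commute[of ?d ?x])
        (simp add: power2_eq_square algebra_simps)
    have e2: "fst ?w \<bullet> (snd ?w - fst ?w) = (1 - pu - ru) * (c + pu * n)"
      unfolding fd unfolding fx c_def n_def power2_norm_eq_inner
      by (simp only: inner_add_left inner_scaleR_left inner_scaleR_right)
    have e3: "q (snd ?w) = Q1 - 2 * ru * Q2 + ru\<^sup>2 * Q3"
      unfolding fz q_add Q1_def Q2_def Q3_def by simp
    have e4: "snd ?w \<bullet> (Hi *v (snd ?w - fst ?w)) = (1 - pu - ru) * (Q2 - ru * Q3)"
      unfolding fd unfolding fz Q2_def Q3_def q_def
      by (simp only: inner_add_left inner_scaleR_left inner_scaleR_right matrix_vector_mult_scaleR)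
        (simp add: algebra_simps)
    have e5: "q (snd ?w - fst ?w) = (1 - pu - ru)\<^sup>2 * Q3"
      unfolding fd q3 Q3_def ..
    have "?D u ?w = A' u * (X + 2 * pu * c + pu\<^sup>2 * n) + A u * (2 * (\<eta> u * (1 - pu - ru)) * c + 2 * pu * (\<eta> u * (1 - pu - ru)) * n)
         + (B' u * (Q1 - 2 * ru * Q2 + ru\<^sup>2 * Q3) + B u * (- 2 * (\<eta>' u * (1 - pu - ru)) * Q2 + 2 * ru * (\<eta>' u * (1 - pu - ru)) * Q3))
         + (K' u * ((1 - pu - ru)\<^sup>2 * Q3) - K u * (2 * (1 - pu - ru) * ((\<eta> u + \<eta>' u) * (1 - pu - ru)) * Q3))"
      unfolding e1 e2 e3 e4 e5 by (simp add: power2_eq_square algebra_simps)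
    ultimately show ?thesis
      unfolding form_mix X_def c_def n_def Q1_def Q2_def Q3_def by simp
  qed
  show "0 \<le> form A B K u w - ?D u w \<and>
        (\<integral>\<^sup>+m. ennreal (form A B K u (sgd_jump \<gamma> \<gamma>' u m w)) \<partial>P) \<le> ennreal (form A B K u w - ?D u w)"
    if u: "a < u" "u < b" for u w
  proof -
    let ?x = "fst w" and ?z = "snd w" and ?h = "fst w \<bullet> (H *v fst w)"
    let ?R = "A u * ((norm ?x)\<^sup>2 - (2 * \<gamma> u - (\<gamma> u)\<^sup>2 * R2) * ?h)
          + B u * (q ?z - 2 * \<gamma>' u * (?z \<bullet> ?x) + (\<gamma>' u)\<^sup>2 * \<kappa>' * ?h)
          + K u * (q (?z - ?x) - 2 * (\<gamma>' u - \<gamma> u) * ((?z - ?x) \<bullet> ?x) + (\<gamma>' u - \<gamma> u)\<^sup>2 * \<kappa>' * ?h)"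
    have nn: "0 \<le> A u" "0 \<le> B u" "0 \<le> K u" using nonneg[of u] u by auto
    have "?R \<le> form A B K u w - ?D u w"
      using gen[OF u, of ?x ?z] by (simp add: form_def generator_bound_def algebra_simps)
    moreover note form_jump[OF nn, of ?x "\<gamma> u" ?z "\<gamma>' u"]
    ultimately show ?thesis
      by (auto simp: form_def sgd_jump_def intro: order_trans ennreal_leI)
  qed
qed (use cont in auto)

lemma process_bound:
  fixes M :: "'w measure" and T :: "nat \<Rightarrow> 'w \<Rightarrow> real" and \<xi> :: "nat \<Rightarrow> 'w \<Rightarrow> (real^'d) \<times> real"
    and xs x0 z0 :: "real^'d"
  assumes M: "prob_space M" and mp: "marked_poisson M P T \<xi>"
    and noiseless: "AE \<xi> in P. snd \<xi> = xs \<bullet> fst \<xi>"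
    and proc: "continuized_process M T \<xi> \<eta> \<eta>' \<gamma> \<gamma>' x0 z0 x z"
    and U: "supersolution 0 t U" and t: "0 \<le> t"
    and terminal: "\<And>w. ennreal (c * (norm (fst w))\<^sup>2) \<le> U t w"
    and initial: "U 0 (x0 - xs, z0 - xs) \<le> ennreal C" and "0 < c" "0 \<le> C"
  shows "integrable M (\<lambda>\<omega>. (norm (x t \<omega> - xs))\<^sup>2)" "c * (\<integral>\<omega>. (norm (x t \<omega> - xs))\<^sup>2 \<partial>M) \<le> C"
proof -
  interpret M: prob_space M by fact
  note law = marked_poisson_law[OF M mp]
  have xm [measurable]: "x t \<in> borel_measurable M" using proc t by (simp add: continuized_process_def)
  have marks: "AE \<omega> in M. \<forall>k. snd (\<xi> k \<omega>) = xs \<bullet> fst (\<xi> k \<omega>)"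
  proof (subst AE_all_countable, intro allI)
    fix k
    have d: "distr M P (\<xi> k) = P" using mp by (simp add: marked_poisson_def)
    have "AE a in distr M P (\<xi> k). snd a = xs \<bullet> fst a" unfolding d by (rule noiseless)
    from AE_distrD[OF law(4) this]
    show "AE \<omega> in M. snd (\<xi> k \<omega>) = xs \<bullet> fst (\<xi> k \<omega>)" .
  qed
  let ?w = "\<lambda>t \<omega>. (x t \<omega> - xs, z t \<omega> - xs)"
  have "(\<integral>\<^sup>+\<omega>. ennreal (c * (norm (fst (?w t \<omega>)))\<^sup>2) \<partial>M) \<le> U 0 (x0 - xs, z0 - xs)"
  proof (rule process_value_le[OF M mp, where \<phi>="\<lambda>w. ennreal (c * (norm (fst w))\<^sup>2)" and w="?w" and t=t])
    show "AE \<omega> in M. ?w 0 \<omega> = (x0 - xs, z0 - xs) \<and>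
      (\<forall>k. (\<forall>u. jump_time (\<lambda>k. T k \<omega>) k \<le> u \<longrightarrow> u < T k \<omega> \<longrightarrow>
               ?w u \<omega> = mix_flow p r (jump_time (\<lambda>k. T k \<omega>) k) u (?w (jump_time (\<lambda>k. T k \<omega>) k) \<omega>)) \<and>
           ?w (T k \<omega>) \<omega> = sgd_jump \<gamma> \<gamma>' (T k \<omega>) (\<xi> k \<omega>)
               (mix_flow p r (jump_time (\<lambda>k. T k \<omega>) k) (T k \<omega>) (?w (jump_time (\<lambda>k. T k \<omega>) k) \<omega>)))"
      using proc[unfolded continuized_process_def, THEN conjunct2] marks marked_poisson_gap_pos[OF M mp]
    proof eventually_elim
      case (elim \<omega>)
      have "jump_time (\<lambda>k. T k \<omega>) k < T k \<omega>" for k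
        using elim(3)[rule_format, of k] jump_time_gap[of T \<omega> k] by (simp add: jump_time_def)
      note fl = continuized_path_flow[OF conjunct2[OF conjunct2[OF elim(1)]] this _ solves, of xs]
      show ?case using fl elim(1,2) by auto
    qed
    show "(\<lambda>w :: 'd state. ennreal (c * (norm (fst w))\<^sup>2)) \<in> borel_measurable borel"
      by (intro measurable_compose[OF _ measurable_ennreal] borel_measurable_continuous_onI continuous_intros)
  qed (use supersolution_step[OF U terminal] t in auto)
  also note initial
  finally have le: "(\<integral>\<^sup>+\<omega>. ennreal (c * (norm (x t \<omega> - xs))\<^sup>2) \<partial>M) \<le> ennreal C" by simp
  have i: "integrable M (\<lambda>\<omega>. c * (norm (x t \<omega> - xs))\<^sup>2)"
    by (rule integrableI_bounded) (use le \<open>0 < c\<close> in \<open>auto intro: le_less_trans\<close>)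
  then show "integrable M (\<lambda>\<omega>. (norm (x t \<omega> - xs))\<^sup>2)" using \<open>0 < c\<close> by simp
  have "ennreal (\<integral>\<omega>. c * (norm (x t \<omega> - xs))\<^sup>2 \<partial>M) \<le> ennreal C"
    using le by (subst nn_integral_eq_integral[OF i, symmetric]) (use \<open>0 < c\<close> in auto)
  then show "c * (\<integral>\<omega>. (norm (x t \<omega> - xs))\<^sup>2 \<partial>M) \<le> C" using \<open>0 \<le> C\<close> by simp
qed

end

section \<open>The strongly convex rate\<close>

context least_squares
begin

text \<open>The eigenvalue bound is applied at \<open>Hi *v x\<close>, where the form of
  \<open>H\<close> equals \<open>q x\<close>. Inserted into the square of
  \<open>q x \<le> norm x * norm (Hi *v x)\<close>, it lets one factor \<open>q x\<close>
  cancel.\<close>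

lemma q_le_of_eigenvalues:
  assumes "\<And>c. eigenvalue H c \<Longrightarrow> \<mu> \<le> c" "0 < \<mu>"
  shows "\<mu> * q x \<le> (norm x)\<^sup>2"
proof -
  let ?w = "Hi *v x"
  have 1: "\<mu> * (norm ?w)\<^sup>2 \<le> q x"
    using eigenvalue_lower_bound[OF H_sym assms(1), of ?w]
    by (simp add: H_Hi q_def power2_norm_eq_inner inner_commute)
  have "q x \<le> norm x * norm ?w" unfolding q_def by (rule norm_cauchy_schwarz)
  then have "(\<mu> * q x)\<^sup>2 \<le> (\<mu> * (norm x * norm ?w))\<^sup>2"
    using assms(2) q_nonneg[of x] by (intro power_mono mult_left_mono) auto
  also have "\<dots> = (norm x)\<^sup>2 * \<mu> * (\<mu> * (norm ?w)\<^sup>2)" by (simp add: power_mult_distrib power2_eq_square)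
  also have "\<dots> \<le> (norm x)\<^sup>2 * \<mu> * q x" using 1 assms(2) by (intro mult_left_mono) auto
  finally have "(\<mu> * q x) * (\<mu> * q x) \<le> (norm x)\<^sup>2 * (\<mu> * q x)" by (simp add: power2_eq_square)
  then show ?thesis
    using assms(2) q_nonneg[of x] by (cases "q x = 0") (auto simp: mult_le_cancel_right)
qed

lemma strongly_convex_rate:
  fixes M :: "'w measure" and T :: "nat \<Rightarrow> 'w \<Rightarrow> real" and \<xi> :: "nat \<Rightarrow> 'w \<Rightarrow> (real^'d) \<times> real"
    and xs x0 z0 :: "real^'d"
  assumes M: "prob_space M" and mp: "marked_poisson M P T \<xi>"
    and noiseless: "AE \<xi> in P. snd \<xi> = xs \<bullet> fst \<xi>"
    and \<mu>: "0 < \<mu>" and ev: "\<And>c. eigenvalue H c \<Longrightarrow> \<mu> \<le> c" and \<kappa>: "\<kappa> = R2 / \<mu>"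
    and proc: "continuized_process M T \<xi> (\<lambda>t. 1 / sqrt (\<kappa> * \<kappa>')) (\<lambda>t. 1 / sqrt (\<kappa> * \<kappa>'))
              (\<lambda>t. 1 / R2) (\<lambda>t. 1 / R2 * sqrt (\<kappa> / \<kappa>')) x0 z0 x z"
    and t: "0 \<le> t"
  shows "integrable M (\<lambda>\<omega>. (norm (x t \<omega> - xs))\<^sup>2)"
    "1/2 * (\<integral>\<omega>. (norm (x t \<omega> - xs))\<^sup>2 \<partial>M)
       \<le> (1/2 * (norm (x0 - xs))\<^sup>2 + \<mu>/2 * q (z0 - xs)) * exp (- (t / sqrt (\<kappa> * \<kappa>')))"
proof -
  define \<omega> where "\<omega> = 1 / sqrt (\<kappa> * \<kappa>')"
  define \<gamma>' where "\<gamma>' = 1 / R2 * sqrt (\<kappa> / \<kappa>')"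
  have \<kappa>_pos: "0 < \<kappa>" using \<kappa> \<mu> R2_pos by simp
  have \<omega>: "0 < \<omega>" using \<kappa>_pos \<kappa>'_pos by (simp add: \<omega>_def)
  \<comment> \<open>The origin of the step sizes: this identity cancels the inner products of
    \<open>x\<close> and \<open>z\<close> between drift and jumps, the next one cancels the terms in
    \<open>x \<bullet> (H *v x)\<close>.\<close>
  have \<mu>\<gamma>': "\<mu> * \<gamma>' = \<omega>"
    using \<mu> R2_pos \<kappa>_pos \<kappa>'_pos by (simp add: \<gamma>'_def \<omega>_def \<kappa> real_sqrt_divide real_sqrt_mult field_simps)
  have \<gamma>'2: "\<mu> * \<gamma>'\<^sup>2 * \<kappa>' = 1 / R2"
    using \<mu> R2_pos \<kappa>_pos \<kappa>'_pos by (simp add: \<gamma>'_def power_mult_distrib power_divide \<kappa>) (simp add: field_simps power2_eq_square)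
  interpret S: averaged_sgd P H R2 \<kappa>' "exp_mix \<omega>" "exp_mix \<omega>" "\<lambda>_. \<omega>" "\<lambda>_. \<omega>" "\<lambda>_. 1 / R2" "\<lambda>_. \<gamma>'"
  proof
    show "(\<lambda>(s, u). exp_mix \<omega> s u) \<in> borel_measurable borel"
      unfolding case_prod_beta by (intro borel_measurable_continuous_onI continuous_intros) auto
    show "(exp_mix \<omega> s has_real_derivative \<omega> * (1 - exp_mix \<omega> s u - exp_mix \<omega> s u)) (at u)" for s u
      by (auto intro!: derivative_eq_intros simp: field_simps)
  qed (rule solves_exp | simp)+
  define A B where "A t = exp (\<omega> * t) / 2" and "B t = \<mu> * exp (\<omega> * t) / 2" for t
  have super: "S.supersolution 0 t (\<lambda>u w. ennreal (form A B (\<lambda>_. 0) u w))"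
  proof (rule S.form_supersolution[where A'="\<lambda>u. \<omega> * A u" and B'="\<lambda>u. \<omega> * B u" and K'="\<lambda>_. 0"])
    show "A \<in> borel_measurable borel" "B \<in> borel_measurable borel"
      unfolding A_def B_def by measurable
    show "continuous_on {s..t} (\<lambda>u. form A B (\<lambda>_. 0) u (mix_flow (exp_mix \<omega>) (exp_mix \<omega>) s u w))" for s w
      unfolding form_mix A_def B_def by (intro continuous_intros) auto
    show "(A has_real_derivative \<omega> * A u) (at u)" "(B has_real_derivative \<omega> * B u) (at u)" for u
      unfolding A_def B_def by (auto intro!: derivative_eq_intros)
    fix u x z
    let ?h = "x \<bullet> (H *v x)"
    have q2: "2 * (z \<bullet> (Hi *v x)) \<le> q z + q x"
      using q_nonneg[of "z + (-1) *\<^sub>R x"] unfolding q_add by simp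
    have "S.generator_bound u (A u) (B u) 0 (\<omega> * A u) (\<omega> * B u) 0 x z
        = A u * (\<omega> * (norm x)\<^sup>2 + 2 * \<omega> * (x \<bullet> (z - x)) + \<omega> * \<mu> * q z - 2 * \<mu> * \<omega> * (z \<bullet> (Hi *v (z - x)))
            - (1 / R2) * ?h + (- 2 * (\<mu> * \<gamma>') * (z \<bullet> x) + (\<mu> * \<gamma>'\<^sup>2 * \<kappa>') * ?h))"
      using R2_pos by (simp add: S.generator_bound_def A_def B_def power2_eq_square field_simps)
    also have "\<dots> = A u * (\<omega> * (\<mu> * (2 * (z \<bullet> (Hi *v x)) - q z) - (norm x)\<^sup>2))"
      unfolding \<mu>\<gamma>' \<gamma>'2
      by (simp add: inner_diff_right matrix_vector_mult_diff_distrib q_def power2_norm_eq_inner inner_commute[of z x] algebra_simps)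
    also have "\<dots> \<le> 0"
    proof -
      have "\<mu> * (2 * (z \<bullet> (Hi *v x)) - q z) \<le> \<mu> * q x" using q2 \<mu> by (intro mult_left_mono) auto
      also have "\<dots> \<le> (norm x)\<^sup>2" by (rule q_le_of_eigenvalues[OF ev \<mu>])
      finally show ?thesis using \<omega> by (auto simp: A_def mult_le_0_iff)
    qed
    finally show "S.generator_bound u (A u) (B u) 0 (\<omega> * A u) (\<omega> * B u) 0 x z \<le> 0" .
  qed (use \<mu> in \<open>auto simp: A_def B_def\<close>)
  have C: "0 \<le> 1/2 * (norm (x0 - xs))\<^sup>2 + \<mu>/2 * q (z0 - xs)" using \<mu> q_nonneg by simp
  have terminal: "ennreal (A t * (norm (fst w))\<^sup>2) \<le> ennreal (form A B (\<lambda>_. 0) t w)" for w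
    using \<mu> q_nonneg by (intro ennreal_leI) (simp add: form_def B_def)
  have initial: "ennreal (form A B (\<lambda>_. 0) 0 (x0 - xs, z0 - xs)) \<le> ennreal (1/2 * (norm (x0 - xs))\<^sup>2 + \<mu>/2 * q (z0 - xs))"
    by (simp add: form_def A_def B_def)
  have "0 < A t" by (simp add: A_def)
  note b = S.process_bound[OF M mp noiseless proc[folded \<omega>_def \<gamma>'_def] super t terminal initial this C]
  show "integrable M (\<lambda>\<omega>. (norm (x t \<omega> - xs))\<^sup>2)" by (rule b)
  have "1/2 * (\<integral>\<omega>. (norm (x t \<omega> - xs))\<^sup>2 \<partial>M) = exp (- (\<omega> * t)) * (A t * (\<integral>\<omega>. (norm (x t \<omega> - xs))\<^sup>2 \<partial>M))"
    by (simp add: A_def exp_minus)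
  also have "\<dots> \<le> exp (- (\<omega> * t)) * (1/2 * (norm (x0 - xs))\<^sup>2 + \<mu>/2 * q (z0 - xs))"
    by (intro mult_left_mono b) simp
  also have "\<dots> = (1/2 * (norm (x0 - xs))\<^sup>2 + \<mu>/2 * q (z0 - xs)) * exp (- (t / sqrt (\<kappa> * \<kappa>')))"
    by (simp add: \<omega>_def mult.commute)
  finally show "1/2 * (\<integral>\<omega>. (norm (x t \<omega> - xs))\<^sup>2 \<partial>M)
       \<le> (1/2 * (norm (x0 - xs))\<^sup>2 + \<mu>/2 * q (z0 - xs)) * exp (- (t / sqrt (\<kappa> * \<kappa>')))" .
qed

end

section \<open>Schedules for the Nesterov weights\<close>

lemma young_from_cauchy_schwarz:
  fixes c g q Y A Q :: real
  assumes "g\<^sup>2 \<le> Y * Q" "c\<^sup>2 \<le> q * A" "0 \<le> q" "0 \<le> A" "0 \<le> Y" "0 \<le> Q"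
  shows "2 * c * g \<le> q * Q + A * Y"
proof -
  have "c\<^sup>2 * g\<^sup>2 \<le> (q * A) * (Y * Q)" by (rule mult_mono) (use assms in simp_all)
  then have "(2 * c * g)\<^sup>2 \<le> 4 * ((q * A) * (Y * Q))" by (simp add: power_mult_distrib)
  also have "\<dots> = (q * Q + A * Y)\<^sup>2 - (q * Q - A * Y)\<^sup>2"
    by (simp add: power2_eq_square algebra_simps)
  also have "\<dots> \<le> (q * Q + A * Y)\<^sup>2" by simp
  finally show ?thesis by (rule power2_le_imp_le) (use assms in simp)
qed

text \<open>The two alternatives absorb the cross term of \<open>z - x\<close> and \<open>x\<close> either in the decay of
  the form in \<open>z - x\<close>, or, after writing it as a cross term of \<open>z\<close> and \<open>x\<close>, in the decrease of \<open>b\<close>.\<close>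

definition admissible :: "real \<Rightarrow> real \<Rightarrow> real \<Rightarrow> real \<Rightarrow> real \<Rightarrow> real \<Rightarrow> real \<Rightarrow> bool" where
  "admissible \<theta> S b k S' b' k' \<longleftrightarrow>
     (let c = S - b - k * (1 - 2 / \<theta>); A = S - b - k * (1 - 2 / \<theta>)\<^sup>2; d = 4 * k / \<theta> - k' in
      0 \<le> A \<and> 0 \<le> d \<and> b' \<le> 0 \<and>
      (c\<^sup>2 \<le> d * A \<and> S' + 2 * S / \<theta> \<le> 4 * b / \<theta> \<or>
       c\<^sup>2 \<le> - b' * A \<and> S' + 2 * S / \<theta> \<le> 4 * b / \<theta> + 4 * c / \<theta>))"

lemma admissible_bound:
  fixes X Y g Qz Qu :: real
  assumes adm: "admissible \<theta> S b k S' b' k'" and \<theta>: "0 < \<theta>"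
    and nn: "0 \<le> X" "0 \<le> Y" "0 \<le> Qz" "0 \<le> Qu" and g: "g\<^sup>2 \<le> Y * Qu" "(g + X)\<^sup>2 \<le> Y * Qz"
  shows "(S' * \<theta>\<^sup>2 / 8 + S * \<theta> / 4) * X + (S * \<theta> / 2) * g + b' / 2 * Qz + (k' / 2 - 2 * k / \<theta>) * Qu
      - S * \<theta>\<^sup>2 / 8 * Y + (b / 2) * (- \<theta> * (g + X) + \<theta>\<^sup>2 / 4 * Y)
      + (k / 2) * (- (\<theta> - 2) * g + (\<theta> / 2 - 1)\<^sup>2 * Y) \<le> 0" (is "?E \<le> 0")
proof -
  have half: "e \<le> 0" if "2 * e \<le> 0" for e :: real using that by simp
  have lin: "V + v - r - s \<le> 0" if "v + R \<le> s" "V - R \<le> 0" "0 \<le> r" for V v r s R :: real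
    using that by linarith
  define c where "c = S - b - k * (1 - 2 / \<theta>)"
  define A where "A = S - b - k * (1 - 2 / \<theta>)\<^sup>2"
  define d where "d = 4 * k / \<theta> - k'"
  define Z G y where "Z = \<theta>\<^sup>2 * X / 4" and "G = \<theta> * g / 2" and "y = \<theta>\<^sup>2 * Y / 4"
  have adm': "0 \<le> A" "0 \<le> d" "b' \<le> 0"
    "c\<^sup>2 \<le> d * A \<and> S' + 2 * S / \<theta> \<le> 4 * b / \<theta> \<or> c\<^sup>2 \<le> - b' * A \<and> S' + 2 * S / \<theta> \<le> 4 * b / \<theta> + 4 * c / \<theta>"
    using adm unfolding admissible_def Let_def c_def A_def d_def by auto
  have nn': "0 \<le> Z" "0 \<le> y" using nn by (simp_all add: Z_def y_def)
  have G1: "G\<^sup>2 \<le> y * Qu"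
    using mult_left_mono[OF g(1), of "\<theta>\<^sup>2 / 4"] by (simp add: G_def y_def power_mult_distrib power_divide field_simps)
  \<comment> \<open>This is the inner product of \<open>z\<close> with \<open>x\<close> scaled by
    \<theta> / 2. Trading \<open>G\<close> for it adds \<open>4 * c / \<theta>\<close> to the room
    for \<open>Z\<close>, which is the difference between the two alternatives.\<close>
  have GZ: "G + 2 * Z / \<theta> = \<theta> / 2 * (g + X)" using \<theta> by (simp add: G_def Z_def power2_eq_square field_simps)
  have "(G + 2 * Z / \<theta>)\<^sup>2 = \<theta>\<^sup>2 / 4 * (g + X)\<^sup>2"
    unfolding GZ by (simp add: power_mult_distrib power_divide)
  also have "\<dots> \<le> \<theta>\<^sup>2 / 4 * (Y * Qz)" by (intro mult_left_mono g) simp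
  finally have G2: "(G + 2 * Z / \<theta>)\<^sup>2 \<le> y * Qz" by (simp add: y_def)
  have E: "2 * ?E = Z * (S' + 2 * S / \<theta> - 4 * b / \<theta>) + 2 * c * G + b' * Qz - d * Qu - A * y"
  proof -
    define \<theta>i where "\<theta>i = 1 / \<theta>"
    have i: "w / \<theta> = w * \<theta>i" for w by (simp add: \<theta>i_def)
    have i1: "\<theta> * \<theta>i = 1" "\<theta> * (\<theta>i * w) = w" for w using \<theta> by (simp_all add: \<theta>i_def)
    show ?thesis
      unfolding Z_def G_def y_def c_def A_def d_def i power2_eq_square by (simp add: algebra_simps add_divide_distrib i1)
  qed
  have "Z * (S' + 2 * S / \<theta> - 4 * b / \<theta>) + 2 * c * G + b' * Qz - d * Qu - A * y \<le> 0"
    using adm'(4)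
  proof
    assume a: "c\<^sup>2 \<le> d * A \<and> S' + 2 * S / \<theta> \<le> 4 * b / \<theta>"
    have "2 * c * G \<le> d * Qu + A * y"
      by (rule young_from_cauchy_schwarz[OF G1 conjunct1[OF a] adm'(2,1) nn'(2) nn(4)])
    moreover have "Z * (S' + 2 * S / \<theta> - 4 * b / \<theta>) \<le> 0" using a nn' by (simp add: mult_nonneg_nonpos)
    moreover have "b' * Qz \<le> 0" using adm' nn by (simp add: mult_nonpos_nonneg)
    ultimately show ?thesis by linarith
  next
    assume a: "c\<^sup>2 \<le> - b' * A \<and> S' + 2 * S / \<theta> \<le> 4 * b / \<theta> + 4 * c / \<theta>"
    have "2 * c * (G + 2 * Z / \<theta>) \<le> - b' * Qz + A * y"
      by (rule young_from_cauchy_schwarz[OF G2 conjunct1[OF a] _ adm'(1) nn'(2) nn(3)]) (use adm'(3) in simp)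
    then have "(2 * c * G + b' * Qz) + Z * (4 * c / \<theta>) \<le> A * y" by (simp add: algebra_simps)
    moreover have "Z * (S' + 2 * S / \<theta> - 4 * b / \<theta>) - Z * (4 * c / \<theta>) \<le> 0"
      using mult_nonneg_nonpos[of Z "S' + 2 * S / \<theta> - 4 * b / \<theta> - 4 * c / \<theta>"] a nn' by (simp add: algebra_simps)
    moreover have "0 \<le> d * Qu" using adm' nn by simp
    ultimately show ?thesis using lin[of "2 * c * G + b' * Qz"] by (simp only: add.assoc)
  qed
  then have "2 * ?E \<le> 0" by (simp only: E)
  then show ?thesis by (rule half)
qed

section \<open>The Nesterov process in rescaled time\<close>

context least_squares
begin

interpretation N: averaged_sgd P H R2 \<kappa>' nesterov_mix "\<lambda>_ _. 0" "\<lambda>t. 2 / t" "\<lambda>_. 0" "\<lambda>_. 1 / R2" "\<lambda>t. t / (2 * R2 * \<kappa>')"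
proof
  have [measurable]: "(fst :: real \<times> real \<Rightarrow> real) \<in> borel_measurable borel" "(snd :: real \<times> real \<Rightarrow> real) \<in> borel_measurable borel"
    by (auto simp: borel_prod[symmetric])
  show "(\<lambda>(s, u). nesterov_mix s u) \<in> borel_measurable borel"
    unfolding case_prod_beta by measurable
  show "(nesterov_mix s has_real_derivative 2 / u * (1 - nesterov_mix s u - 0)) (at u)" if "0 \<le> s" "s < u" for s u
  proof -
    have "((\<lambda>u. 1 - (s / u)\<^sup>2) has_real_derivative 2 / u * (s / u)\<^sup>2) (at u)"
      using that by (auto intro!: derivative_eq_intros simp: power2_eq_square field_simps)
    then have "(nesterov_mix s has_real_derivative 2 / u * (s / u)\<^sup>2) (at u)"
      by (rule has_field_derivative_transform_within_open[where S="{s<..}"]) (use that in auto)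
    then show ?thesis using that by simp
  qed
qed (rule solves_nesterov | simp)+

text \<open>In the time unit \<open>\<kappa>'\<close>, with \<open>\<theta> = u / \<kappa>'\<close>, jumps move \<open>z\<close> and \<open>(\<theta> / 2) x\<close> by the same vector;
  \<open>S\<close> is twice the weight of \<open>\<parallel>(\<theta> / 2) x\<parallel>\<^sup>2\<close>.\<close>

definition nform :: "(real \<Rightarrow> real) \<Rightarrow> (real \<Rightarrow> real) \<Rightarrow> (real \<Rightarrow> real) \<Rightarrow> real \<Rightarrow> 'd state \<Rightarrow> ennreal" where
  "nform S b k u w = ennreal (form (\<lambda>u. S (u / \<kappa>') * (u / \<kappa>')\<^sup>2 / 8) (\<lambda>u. R2 / \<kappa>' * b (u / \<kappa>') / 2) (\<lambda>u. R2 / \<kappa>' * k (u / \<kappa>') / 2) u w)"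

definition nsuper :: "real \<Rightarrow> real \<Rightarrow> (real \<Rightarrow> 'd state \<Rightarrow> ennreal) \<Rightarrow> bool" where
  "nsuper a b U \<longleftrightarrow> N.supersolution (\<kappa>' * a) (\<kappa>' * b) U"

text \<open>The flow scales \<open>x - z\<close> by \<open>(s / u)^2\<close>, which is
  multiplicative through the intermediate time.\<close>

lemma nesterov_mix_flow_compose:
  assumes "0 \<le> s" "s < c" "c \<le> u"
  shows "mix_flow nesterov_mix (\<lambda>_ _. 0) s u w =
         mix_flow nesterov_mix (\<lambda>_ _. 0) c u (mix_flow nesterov_mix (\<lambda>_ _. 0) s c w)"
proof (cases "u = c")
  case False
  have "s / u = (c / u) * (s / c)" using assms by simp
  then have "(s / u)\<^sup>2 = (c / u)\<^sup>2 * (s / c)\<^sup>2" by (simp only: power_mult_distrib)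
  then have "1 - (s / u)\<^sup>2 = (1 - (s / c)\<^sup>2) + (1 - (c / u)\<^sup>2) * (1 - (1 - (s / c)\<^sup>2))"
    by (simp add: algebra_simps)
  then show ?thesis using False assms by (simp add: mix_flow_def vec_eq_iff algebra_simps)
qed (simp add: mix_flow_def)

lemma nsuper_chain:
  assumes "nsuper a b U1" "nsuper b c U2" "\<And>w. U2 (\<kappa>' * b) w \<le> U1 (\<kappa>' * b) w" "0 \<le> a" "a \<le> b" "b \<le> c"
  shows "nsuper a c (\<lambda>u. if u < \<kappa>' * b then U1 u else U2 u)"
  unfolding nsuper_def
proof (rule N.supersolution_chain)
  fix s u w assume s: "\<kappa>' * a \<le> s" "s < \<kappa>' * b" "\<kappa>' * b \<le> u"
  have "0 \<le> \<kappa>' * a" using assms(4) \<kappa>'_pos by simp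
  then show "mix_flow nesterov_mix (\<lambda>_ _. 0) s u w = mix_flow nesterov_mix (\<lambda>_ _. 0) (\<kappa>' * b) u (mix_flow nesterov_mix (\<lambda>_ _. 0) s (\<kappa>' * b) w)"
    using s by (intro nesterov_mix_flow_compose) auto
qed (use assms \<kappa>'_pos in \<open>auto simp: nsuper_def\<close>)

text \<open>With time in units of \<kappa>' and \<open>q\<close> scaled by
  \<open>R2 / \<kappa>'\<close>, all constants leave the generator inequality except an overall
  factor \<open>1 / \<kappa>'\<close>, and the numerical condition \<open>admissible\<close>
  remains. The factor \<theta>^2 and \<open>k 0 = 0\<close> keep the form continuous at 0.\<close>

lemma nsuperI:
  assumes a: "0 \<le> a" and meas: "S \<in> borel_measurable borel" "b \<in> borel_measurable borel" "k \<in> borel_measurable borel"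
    and nonneg: "\<And>\<theta>. a \<le> \<theta> \<Longrightarrow> \<theta> \<le> e \<Longrightarrow> 0 \<le> S \<theta> \<and> 0 \<le> b \<theta> \<and> 0 \<le> k \<theta>"
    and k0: "a = 0 \<Longrightarrow> k 0 = 0"
    and cont: "continuous_on {a..e} S" "continuous_on {a..e} b" "continuous_on {a..e} k"
    and deriv: "\<And>\<theta>. a < \<theta> \<Longrightarrow> \<theta> < e \<Longrightarrow> (S has_real_derivative S' \<theta>) (at \<theta>)"
      "\<And>\<theta>. a < \<theta> \<Longrightarrow> \<theta> < e \<Longrightarrow> (b has_real_derivative b' \<theta>) (at \<theta>)"
      "\<And>\<theta>. a < \<theta> \<Longrightarrow> \<theta> < e \<Longrightarrow> (k has_real_derivative k' \<theta>) (at \<theta>)"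
    and adm: "\<And>\<theta>. a < \<theta> \<Longrightarrow> \<theta> < e \<Longrightarrow> admissible \<theta> (S \<theta>) (b \<theta>) (k \<theta>) (S' \<theta>) (b' \<theta>) (k' \<theta>)"
  shows "nsuper a e (nform S b k)"
proof -
  note [measurable] = meas
  let ?c = "R2 / \<kappa>'"
  let ?A = "\<lambda>u. S (u / \<kappa>') * (u / \<kappa>')\<^sup>2 / 8" and ?B = "\<lambda>u. ?c * b (u / \<kappa>') / 2" and ?K = "\<lambda>u. ?c * k (u / \<kappa>') / 2"
  have c: "0 < ?c" using R2_pos \<kappa>'_pos by simp
  have sc: "\<kappa>' * a \<le> u \<longleftrightarrow> a \<le> u / \<kappa>'" "u \<le> \<kappa>' * e \<longleftrightarrow> u / \<kappa>' \<le> e"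
    "\<kappa>' * a < u \<longleftrightarrow> a < u / \<kappa>'" "u < \<kappa>' * e \<longleftrightarrow> u / \<kappa>' < e" for u
    using \<kappa>'_pos by (auto simp: field_simps)
  have c1: "continuous_on {\<kappa>' * a..\<kappa>' * e} (\<lambda>u. f (u / \<kappa>'))" if "continuous_on {a..e} f" for f :: "real \<Rightarrow> real"
    by (rule continuous_on_compose2[OF that]) (use \<kappa>'_pos in \<open>auto simp: sc intro!: continuous_intros\<close>)
  have "N.supersolution (\<kappa>' * a) (\<kappa>' * e) (\<lambda>u w. ennreal (form ?A ?B ?K u w))"
  proof (rule N.form_supersolution[where A'="\<lambda>u. (S' (u / \<kappa>') * (u / \<kappa>')\<^sup>2 / 8 + S (u / \<kappa>') * (u / \<kappa>') / 4) / \<kappa>'"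
        and B'="\<lambda>u. ?c * b' (u / \<kappa>') / 2 / \<kappa>'" and K'="\<lambda>u. ?c * k' (u / \<kappa>') / 2 / \<kappa>'"])
    show "0 \<le> \<kappa>' * a" using a \<kappa>'_pos by simp
    show "?A \<in> borel_measurable borel" "?B \<in> borel_measurable borel" "?K \<in> borel_measurable borel" by measurable
    show "0 \<le> ?A u \<and> 0 \<le> ?B u \<and> 0 \<le> ?K u" if "\<kappa>' * a \<le> u" "u \<le> \<kappa>' * e" for u
      using nonneg[of "u / \<kappa>'"] that R2_pos \<kappa>'_pos by (auto simp: sc)
    fix s and w :: "'d state" assume s: "\<kappa>' * a \<le> s" "s < \<kappa>' * e"
    have s0: "0 \<le> s" using s(1) a \<kappa>'_pos by (meson less_imp_le mult_nonneg_nonneg order_trans)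
    have sub: "{s..\<kappa>' * e} \<subseteq> {\<kappa>' * a..\<kappa>' * e}" using s by auto
    note cc = c1[OF cont(1), THEN continuous_on_subset, OF sub] c1[OF cont(2), THEN continuous_on_subset, OF sub]
      c1[OF cont(3), THEN continuous_on_subset, OF sub]
    show "continuous_on {s..\<kappa>' * e} (\<lambda>u. form ?A ?B ?K u (mix_flow nesterov_mix (\<lambda>_ _. 0) s u w))"
    proof (cases "s = 0")
      case True
      then have "a = 0" using s(1) a \<kappa>'_pos by (simp add: mult_le_0_iff)
      then have "continuous_on {s..\<kappa>' * e} (\<lambda>u. ?A u * (norm (snd w))\<^sup>2 + ?B u * q (snd w))"
        by (intro continuous_intros cc) (use \<kappa>'_pos in auto)
      then show ?thesis
      proof (rule continuous_on_eq)
        fix u assume "u \<in> {s..\<kappa>' * e}"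
        then show "?A u * (norm (snd w))\<^sup>2 + ?B u * q (snd w) = form ?A ?B ?K u (mix_flow nesterov_mix (\<lambda>_ _. 0) s u w)"
          using True k0[OF \<open>a = 0\<close>] by (cases "u = 0") (auto simp: form_def mix_flow_def q_def)
      qed
    next
      case False
      have "continuous_on {s..\<kappa>' * e} (nesterov_mix s)"
        by (rule continuous_on_eq[of _ "\<lambda>u. 1 - (s / u)\<^sup>2"])
          (use False s0 in \<open>auto intro!: continuous_intros\<close>)
      then show ?thesis
        unfolding form_mix by (intro continuous_intros cc) (use \<kappa>'_pos in auto)
    qed
  next
    fix u assume u: "\<kappa>' * a < u" "u < \<kappa>' * e"
    then have \<theta>: "a < u / \<kappa>'" "u / \<kappa>' < e" by (auto simp: sc)
    have scale: "((\<lambda>u. u / \<kappa>') has_real_derivative 1 / \<kappa>') (at u)"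
      using \<kappa>'_pos by (auto intro!: derivative_eq_intros)
    have ch: "((\<lambda>u. f (u / \<kappa>')) has_real_derivative f' / \<kappa>') (at u)" if "(f has_real_derivative f') (at (u / \<kappa>'))" for f f'
      using DERIV_chain2[where f=f and g="\<lambda>u. u / \<kappa>'" and x=u, OF that scale] by simp
    have "((\<lambda>\<theta>. S \<theta> * \<theta>\<^sup>2 / 8) has_real_derivative D * v\<^sup>2 / 8 + S v * v / 4) (at v)"
      if "(S has_real_derivative D) (at v)" for v D
      using DERIV_cdivide[OF DERIV_mult[OF that DERIV_power[OF DERIV_ident, of 2]], of 8]
      by (simp add: add_divide_distrib ac_simps)
    note this[OF deriv(1)[OF \<theta>]]
    from ch[OF this]
    show "(?A has_real_derivative (S' (u / \<kappa>') * (u / \<kappa>')\<^sup>2 / 8 + S (u / \<kappa>') * (u / \<kappa>') / 4) / \<kappa>') (at u)" .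
    have "((\<lambda>\<theta>. ?c * b \<theta> / 2) has_real_derivative ?c * b' (u / \<kappa>') / 2) (at (u / \<kappa>'))"
      using DERIV_cdivide[OF DERIV_cmult[OF deriv(2)[OF \<theta>]]] by simp
    from ch[OF this]
    show "(?B has_real_derivative ?c * b' (u / \<kappa>') / 2 / \<kappa>') (at u)" .
    have "((\<lambda>\<theta>. ?c * k \<theta> / 2) has_real_derivative ?c * k' (u / \<kappa>') / 2) (at (u / \<kappa>'))"
      using DERIV_cdivide[OF DERIV_cmult[OF deriv(3)[OF \<theta>]]] by simp
    from ch[OF this]
    show "(?K has_real_derivative ?c * k' (u / \<kappa>') / 2 / \<kappa>') (at u)" .
    fix x z :: "real^'d"
    define t where "t = u / \<kappa>'"
    have t: "0 < t" using \<theta>(1) a by (simp add: t_def)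
    have ut: "u = \<kappa>' * t" using \<kappa>'_pos by (simp add: t_def)
    define h g Qz Qu where "h = x \<bullet> (H *v x)" and "g = x \<bullet> (z - x)" and "Qz = q z" and "Qu = q (z - x)"
    define X where "X = (norm x)\<^sup>2"
    have zx: "z \<bullet> x = g + X" "(z - x) \<bullet> x = g"
      by (simp_all add: g_def X_def power2_norm_eq_inner inner_diff_right inner_diff_left inner_commute)
    have nn: "0 \<le> X" "0 \<le> \<kappa>' / R2 * h" "0 \<le> ?c * Qz" "0 \<le> ?c * Qu"
      using H_psd q_nonneg c R2_pos \<kappa>'_pos by (auto simp: X_def h_def Qz_def Qu_def)
    \<comment> \<open>The scalings of \<open>h\<close> and \<open>q\<close> are inverse to each
      other, so Cauchy-Schwarz keeps its form.\<close>
    have e: "\<kappa>' / R2 * h * (?c * Q) = h * Q" for Q using R2_pos \<kappa>'_pos by simp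
    have g: "g\<^sup>2 \<le> \<kappa>' / R2 * h * (?c * Qu)" "(g + X)\<^sup>2 \<le> \<kappa>' / R2 * h * (?c * Qz)"
      unfolding e using q_cauchy_schwarz[of x "z - x"] q_cauchy_schwarz[of x z] zx
      by (simp_all add: g_def h_def Qu_def Qz_def inner_commute)
    have \<gamma>: "2 * (1 / R2) - (1 / R2)\<^sup>2 * R2 = 1 / R2" "u / (2 * R2 * \<kappa>') = t / (2 * R2)"
        "t / (2 * R2) - 1 / R2 = (t / 2 - 1) / R2"
      using R2_pos \<kappa>'_pos by (simp_all add: ut power2_eq_square field_simps)
    have i1: "2 * (S t * t\<^sup>2 / 8) * (2 / u) * g = (S t * t / 2) * g / \<kappa>'"
      using t \<kappa>'_pos by (simp add: ut power2_eq_square field_simps)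
    have i2: "?c * b' t / 2 / \<kappa>' * Qz = b' t / 2 * (?c * Qz) / \<kappa>'" by (simp add: ac_simps)
    have i3: "(?c * k' t / 2 / \<kappa>' - 2 * (?c * k t / 2) * (2 / u + 0)) * Qu = (k' t / 2 - 2 * k t / t) * (?c * Qu) / \<kappa>'"
      using t \<kappa>'_pos by (simp add: ut field_simps)
    have i4: "S t * t\<^sup>2 / 8 * (1 / R2) * h = S t * t\<^sup>2 / 8 * (\<kappa>' / R2 * h) / \<kappa>'"
      using \<kappa>'_pos by simp
    have i5: "?c * b t / 2 * (- 2 * (t / (2 * R2)) * (g + X) + (t / (2 * R2))\<^sup>2 * \<kappa>' * h)
        = (b t / 2) * (- t * (g + X) + t\<^sup>2 / 4 * (\<kappa>' / R2 * h)) / \<kappa>'"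
      using \<kappa>'_pos R2_pos by (simp add: power2_eq_square field_simps)
    have i6: "?c * k t / 2 * (- 2 * ((t / 2 - 1) / R2) * g + ((t / 2 - 1) / R2)\<^sup>2 * \<kappa>' * h)
        = (k t / 2) * (- (t - 2) * g + (t / 2 - 1)\<^sup>2 * (\<kappa>' / R2 * h)) / \<kappa>'"
    proof -
      have "?c * k t / 2 * (- 2 * (m / R2) * g + (m / R2)\<^sup>2 * \<kappa>' * h) = (k t / 2) * (- (2 * m) * g + m\<^sup>2 * (\<kappa>' / R2 * h)) / \<kappa>'" for m
        using \<kappa>'_pos R2_pos by (simp add: power2_eq_square field_simps)
      from this[of "t / 2 - 1"] show ?thesis by simp
    qed
    have i0: "(S' t * t\<^sup>2 / 8 + S t * t / 4) / \<kappa>' * X = (S' t * t\<^sup>2 / 8 + S t * t / 4) * X / \<kappa>'"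
      "2 * (?c * b t / 2) * 0 * v = 0" for v by simp_all
    have "N.generator_bound u (?A u) (?B u) (?K u)
       ((S' (u / \<kappa>') * (u / \<kappa>')\<^sup>2 / 8 + S (u / \<kappa>') * (u / \<kappa>') / 4) / \<kappa>')
       (?c * b' (u / \<kappa>') / 2 / \<kappa>') (?c * k' (u / \<kappa>') / 2 / \<kappa>') x z
      = (S' t * t\<^sup>2 / 8 + S t * t / 4) * X / \<kappa>' + (S t * t / 2) * g / \<kappa>' + b' t / 2 * (?c * Qz) / \<kappa>' - 0
        + (k' t / 2 - 2 * k t / t) * (?c * Qu) / \<kappa>' - S t * t\<^sup>2 / 8 * (\<kappa>' / R2 * h) / \<kappa>'
        + (b t / 2) * (- t * (g + X) + t\<^sup>2 / 4 * (\<kappa>' / R2 * h)) / \<kappa>'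
        + (k t / 2) * (- (t - 2) * g + (t / 2 - 1)\<^sup>2 * (\<kappa>' / R2 * h)) / \<kappa>'"
      unfolding N.generator_bound_def zx t_def[symmetric] \<gamma> g_def[symmetric] h_def[symmetric] Qz_def[symmetric]
        Qu_def[symmetric] X_def[symmetric] i0 i1 i2 i3 i4 i5 i6
      by (rule refl)
    also have "\<dots> = ((S' t * t\<^sup>2 / 8 + S t * t / 4) * X + (S t * t / 2) * g + b' t / 2 * (?c * Qz) + (k' t / 2 - 2 * k t / t) * (?c * Qu)
      - S t * t\<^sup>2 / 8 * (\<kappa>' / R2 * h) + (b t / 2) * (- t * (g + X) + t\<^sup>2 / 4 * (\<kappa>' / R2 * h))
      + (k t / 2) * (- (t - 2) * g + (t / 2 - 1)\<^sup>2 * (\<kappa>' / R2 * h))) / \<kappa>'"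
      by (simp only: add_divide_distrib diff_divide_distrib diff_zero)
    also have "\<dots> \<le> 0"
      using admissible_bound[OF adm[OF \<theta>, folded t_def] t nn g] \<kappa>'_pos by (simp add: divide_nonpos_pos)
    finally show "N.generator_bound u (?A u) (?B u) (?K u)
       ((S' (u / \<kappa>') * (u / \<kappa>')\<^sup>2 / 8 + S (u / \<kappa>') * (u / \<kappa>') / 4) / \<kappa>')
       (?c * b' (u / \<kappa>') / 2 / \<kappa>') (?c * k' (u / \<kappa>') / 2 / \<kappa>') x z \<le> 0" .
  qed
  then show ?thesis unfolding nsuper_def nform_def .
qed

lemma nform_mono:
  assumes "S2 \<theta> \<le> S1 \<theta>" "b2 \<theta> \<le> b1 \<theta>" "k2 \<theta> \<le> k1 \<theta>"
  shows "nform S2 b2 k2 (\<kappa>' * \<theta>) w \<le> nform S1 b1 k1 (\<kappa>' * \<theta>) w"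
proof -
  have e: "\<kappa>' * \<theta> / \<kappa>' = \<theta>" using \<kappa>'_pos by simp
  have "S2 \<theta> * \<theta>\<^sup>2 / 8 \<le> S1 \<theta> * \<theta>\<^sup>2 / 8" using assms by (simp add: mult_right_mono)
  moreover have "R2 / \<kappa>' * b2 \<theta> / 2 \<le> R2 / \<kappa>' * b1 \<theta> / 2" "R2 / \<kappa>' * k2 \<theta> / 2 \<le> R2 / \<kappa>' * k1 \<theta> / 2"
    using assms R2_pos \<kappa>'_pos by (auto intro!: divide_right_mono mult_left_mono)
  ultimately show ?thesis
    unfolding nform_def form_def e using q_nonneg by (intro ennreal_leI add_mono mult_right_mono) auto
qed

text \<open>The terminal weight \<open>(t / \<kappa>')^2 / 4\<close> is that of \<open>nform\<close>
  with \<open>S = 2\<close>; with \<open>S = 1\<close> the same computation would give twice the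
  bound.\<close>

lemma accelerated_rate:
  fixes M :: "'w measure" and T :: "nat \<Rightarrow> 'w \<Rightarrow> real" and \<xi> :: "nat \<Rightarrow> 'w \<Rightarrow> (real^'d) \<times> real"
    and xs x0 z0 :: "real^'d"
  assumes M: "prob_space M" and mp: "marked_poisson M P T \<xi>"
    and noiseless: "AE \<xi> in P. snd \<xi> = xs \<bullet> fst \<xi>"
    and proc: "continuized_process M T \<xi> (\<lambda>t. 2 / t) (\<lambda>t. 0) (\<lambda>t. 1 / R2) (\<lambda>t. t / (2 * R2 * \<kappa>')) x0 z0 x z"
    and t: "0 < t"
    and U: "nsuper 0 (t / \<kappa>') U" "U 0 (x0 - xs, z0 - xs) \<le> ennreal (R2 / \<kappa>' / 2 * q (z0 - xs))"
      "\<And>w. ennreal ((t / \<kappa>')\<^sup>2 / 4 * (norm (fst w))\<^sup>2) \<le> U t w"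
  shows "integrable M (\<lambda>\<omega>. (norm (x t \<omega> - xs))\<^sup>2)"
    "1/2 * (\<integral>\<omega>. (norm (x t \<omega> - xs))\<^sup>2 \<partial>M) \<le> R2 * \<kappa>' * q (z0 - xs) / t\<^sup>2"
proof -
  have s: "N.supersolution 0 t U" using U(1) \<kappa>'_pos by (simp add: nsuper_def)
  have C: "0 \<le> R2 / \<kappa>' / 2 * q (z0 - xs)" and c: "0 < (t / \<kappa>')\<^sup>2 / 4"
    using R2_pos \<kappa>'_pos q_nonneg t by auto
  note b = N.process_bound[OF M mp noiseless proc s less_imp_le[OF t] U(3,2) c C]
  show "integrable M (\<lambda>\<omega>. (norm (x t \<omega> - xs))\<^sup>2)" by (rule b(1))
  show "1/2 * (\<integral>\<omega>. (norm (x t \<omega> - xs))\<^sup>2 \<partial>M) \<le> R2 * \<kappa>' * q (z0 - xs) / t\<^sup>2"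
    using b(2) t \<kappa>'_pos by (simp add: power_divide power2_eq_square field_simps)
qed

end

section \<open>Numerical inequalities behind the calibration\<close>

text \<open>The inequality of \<open>calibration\<close> with \<open>s = 2 * x^2\<close> and the
  denominator \<open>5 - 8 * x\<close> cleared; the range comes from
  \<open>1 / sqrt 8 < 354 / 1000\<close>. Higher powers are bounded through the right endpoint until
  a linear inequality is left.\<close>

lemma calibration_polynomial:
  fixes x :: real
  assumes x: "0 \<le> x" "x \<le> 354 / 1000"
  shows "0 \<le> 2 - 20/3 * x + 25/2 * x^2 - 28/3 * x^3 - 126 * x^4 + 216 * x^5"
proof -
  define a :: real where "a = 354 / 1000"
  have x2: "x^2 \<le> a * x" using mult_right_mono[OF x(2,1)] by (simp add: power2_eq_square a_def)
  have "0 \<le> (a - x) * (126 * (a + x) - 216 * (a^2 + a * x + x^2))"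
    by (intro mult_nonneg_nonneg) (use x x2 in \<open>simp_all add: a_def power2_eq_square\<close>)
  then have "126 * x^2 - 216 * x^3 \<le> 126 * a^2 - 216 * a^3"
    by (simp add: power2_eq_square power3_eq_cube algebra_simps)
  then have "126 * x^2 - 216 * x^3 \<le> 621/100" by (simp add: a_def power2_eq_square power3_eq_cube)
  from mult_left_mono[OF this, of "x^2"] have 1: "126 * x^4 - 216 * x^5 \<le> 621/100 * x^2"
    by (simp add: eval_nat_numeral algebra_simps)
  have 2: "x^3 \<le> a * x^2"
    using mult_right_mono[OF x2 x(1)] by (simp add: eval_nat_numeral)
  have "0 \<le> (x - a)^2" by simp
  then have 3: "2 * a * x - a^2 \<le> x^2" by (simp add: power2_eq_square algebra_simps)
  have "a^2 = 31329 / 250000" by (simp add: a_def power2_eq_square)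
  then have "177 / 250 * x - 31329 / 250000 \<le> x^2" "x^3 \<le> 177 / 500 * x^2" using 2 3 by (simp_all add: a_def)
  then show ?thesis using 1 x by linarith
qed

text \<open>Here and in the next lemma the expansion at \<open>s = 0\<close> is exact to first
  order, and the coefficient of \<open>s^2\<close> is weakened enough to absorb all higher
  terms.\<close>

lemma rho_fourth_le:
  fixes s :: real
  assumes "0 \<le> s" "s \<le> 1 / 4"
  shows "(1 - s * (1/2 + 5/4 * s))^4 \<le> 1 - 2 * s - 27/20 * s^2"
proof -
  have "0 \<le> s^2 * (43/20 - 7 * s - 91/16 * s^2 + s^3 * (35/4 + 175/32 * s - 125/32 * s^2 - 625/256 * s^3))"
  proof (intro mult_nonneg_nonneg add_nonneg_nonneg)
    have "s^2 \<le> 1/16" "s^3 \<le> 1" using assms power_mono[of s "1/4" 2] power_le_one[of s 3] by (auto simp: power2_eq_square)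
    then show "0 \<le> 43/20 - 7 * s - 91/16 * s^2" "0 \<le> 35/4 + 175/32 * s - 125/32 * s^2 - 625/256 * s^3"
      using assms by linarith+
  qed (use assms in auto)
  then show ?thesis by (simp add: eval_nat_numeral algebra_simps add_divide_distrib diff_divide_distrib)
qed

lemma rho_cubic_ge:
  fixes s :: real
  assumes "0 \<le> s" "s \<le> 1 / 4" and \<rho>: "\<rho> = 1 - s * (1/2 + 5/4 * s)"
  shows "1 + 5/4 * s - 63/10 * s^2 \<le> \<rho>^2 * (1/2 + 5/4 * s) * (1 + \<rho>)"
proof -
  have "0 \<le> s^2 * ((s - 33/140)^2 * (35/4) + (55/100 - 33/140 * 33/140 * 35/4) + s^3 * (175/32 - 125/32 * s - 625/256 * s^2))"
  proof (intro mult_nonneg_nonneg add_nonneg_nonneg)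
    have "s^2 \<le> 1/16" using assms power_mono[of s "1/4" 2] by (auto simp: power2_eq_square)
    then show "0 \<le> 175/32 - 125/32 * s - 625/256 * s^2" using assms by linarith
  qed (use assms in auto)
  then show ?thesis unfolding \<rho> by (simp add: eval_nat_numeral algebra_simps add_divide_distrib diff_divide_distrib)
qed

text \<open>Square and cube are replaced by their tangents at \<open>s = 1 / 4\<close>, the end of
  the range where little room is left.\<close>

lemma final_stage_polynomial:
  fixes s :: real
  assumes s: "0 \<le> s" "s \<le> 1 / 4"
  shows "0 \<le> 7/8 - 453319/80000 * s + 22157/3200 * s^2 + 143657/12800 * s^3
            - 25/8 * s^4 - 125/16 * s^5 - 625/256 * s^6"
proof -
  have s2: "s^2 \<le> 1/16" "s^3 \<le> 1/64"
    using s power_mono[of s "1/4" 2] power_mono[of s "1/4" 3] by (auto simp: power2_eq_square power3_eq_cube)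
  have "0 \<le> s^3 * ((143657/12800 - 99/10) - 25/8 * s - 125/16 * s^2 - 625/256 * s^3)"
    by (intro mult_nonneg_nonneg) (use s s2 in \<open>simp, linarith\<close>)
  then have 1: "99/10 * s^3 \<le> 143657/12800 * s^3 - 25/8 * s^4 - 125/16 * s^5 - 625/256 * s^6"
    by (simp add: eval_nat_numeral algebra_simps)
  have "0 \<le> (s - 1/4)^2 * (s + 1/2)" using s by simp
  then have 2: "3/16 * s - 1/32 \<le> s^3" by (simp add: power2_eq_square power3_eq_cube algebra_simps add_divide_distrib)
  have "0 \<le> (s - 1/4)^2" by simp
  then have 3: "1/2 * s - 1/16 \<le> s^2" by (simp add: power2_eq_square algebra_simps)
  show ?thesis using 1 2 3 s by linarith
qed

text \<open>The expression is the terminal value of \<open>b\<close> in the last stage. It is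
  nondecreasing in \<open>b1\<close>, so the lower bound for \<open>b1\<close> may be inserted;
  multiplication by \<open>3 - D\<close> then leaves a polynomial in \<open>s\<close>.\<close>

lemma final_stage_nonneg:
  fixes s b1 :: real
  assumes s: "0 \<le> s" "s \<le> 1 / 4" and b1: "1 - 4343/10000 * s \<le> b1"
    and D: "D = 1/2 + 5/4 * s" and \<rho>: "\<rho> = 1 - s * D"
    and be: "be1 = b1 - 2 * \<rho>^2" "be2 = be1 - 4 * \<rho> * s" and g: "g = (12 * s^2 - 3 * be2) / (3 - D)"
  shows "0 \<le> b1 + be1 * D + be2 * D^2 / 2 - g * D^3 / 6"
proof -
  define c where "c = 1 - 4343/10000 * s"
  have D3: "0 < 3 - D" "0 \<le> D" using s D by auto
  have "0 \<le> (3 - D) * (c + (c - 2 * \<rho>^2) * D + (c - 2 * \<rho>^2 - 4 * \<rho> * s) * D^2 / 2)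
      - (12 * s^2 - 3 * (c - 2 * \<rho>^2 - 4 * \<rho> * s)) * D^3 / 6"
    using final_stage_polynomial[OF s] unfolding c_def \<rho> D
    by (simp add: eval_nat_numeral algebra_simps add_divide_distrib diff_divide_distrib)
  also have "\<dots> \<le> (3 - D) * (b1 + be1 * D + be2 * D^2 / 2) - (12 * s^2 - 3 * be2) * D^3 / 6"
  proof -
    have "c \<le> b1" "c - 2 * \<rho>^2 \<le> be1" "c - 2 * \<rho>^2 - 4 * \<rho> * s \<le> be2" using b1 by (simp_all add: c_def be)
    then show ?thesis
      using D3 by (intro diff_mono mult_left_mono add_mono mult_right_mono divide_right_mono) auto
  qed
  also have "\<dots> = (3 - D) * (b1 + be1 * D + be2 * D^2 / 2 - g * D^3 / 6)"
  proof -
    have e: "12 * s^2 - 3 * be2 = (3 - D) * g" using D3(1) by (simp add: g)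
    show ?thesis unfolding e by (simp add: right_diff_distrib)
  qed
  finally show ?thesis using D3(1) by (simp add: zero_le_mult_iff)
qed

text \<open>It ensures that \<open>S\<close> at the end of the plateau reaches the value
  \<open>2 * \<rho>^2\<close> with which the last stage begins. Since
  \<open>\<rho>^2 - \<rho>^4 = \<rho>^2 * (1 - \<rho>) * (1 + \<rho>)\<close> and
  \<open>1 - \<rho> = s * (1/2 + 5/4 * s)\<close>, a factor \<open>s\<close> cancels, and the
  quadratic bounds above apply.\<close>

lemma calibration:
  fixes \<sigma> s y \<rho> :: real
  assumes \<sigma>: "0 \<le> \<sigma>" "\<sigma> \<le> 354 / 1000" and s: "s = 2 * \<sigma>^2" "s \<le> 1 / 4" and y: "y = \<sigma> / (5 - 8 * \<sigma>)"
    and \<rho>: "\<rho> = 1 - s * (1/2 + 5/4 * s)"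
  shows "\<rho>^4 * (1 + 8/3 * s * y) \<le> \<rho>^2 - s * (3/5 + 4/5 * y)"
proof -
  have s0: "0 \<le> s" using s by simp
  have y5: "(5 - 8 * \<sigma>) * y = \<sigma>" and y0: "0 \<le> y" using \<sigma> by (auto simp: y)
  have "\<sigma> * (4/5 + 8/3 * (1 - 2 * s - 27/20 * s^2)) \<le> (5 - 8 * \<sigma>) * (2/5 + 5/4 * s - 63/10 * s^2)"
    using calibration_polynomial[OF \<sigma>] unfolding s by (simp add: eval_nat_numeral algebra_simps add_divide_distrib diff_divide_distrib)
  then have "(5 - 8 * \<sigma>) * (y * (4/5 + 8/3 * (1 - 2 * s - 27/20 * s^2))) \<le> (5 - 8 * \<sigma>) * (2/5 + 5/4 * s - 63/10 * s^2)"
    by (simp only: mult.assoc[symmetric] y5)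
  then have "y * (4/5 + 8/3 * (1 - 2 * s - 27/20 * s^2)) \<le> 2/5 + 5/4 * s - 63/10 * s^2"
    using \<sigma> by (simp only: mult_le_cancel_left)
  moreover have "y * (4/5 + 8/3 * \<rho>^4) \<le> y * (4/5 + 8/3 * (1 - 2 * s - 27/20 * s^2))"
    using rho_fourth_le[OF s0 s(2)] y0 by (intro mult_left_mono) (auto simp: \<rho>)
  ultimately have "y * (4/5 + 8/3 * \<rho>^4) + 3/5 \<le> \<rho>^2 * (1/2 + 5/4 * s) * (1 + \<rho>)"
    using rho_cubic_ge[OF s0 s(2) \<rho>] by linarith
  from mult_left_mono[OF this s0]
  have "s * (y * (4/5 + 8/3 * \<rho>^4) + 3/5) \<le> \<rho>^2 * (s * (1/2 + 5/4 * s)) * (1 + \<rho>)" by (simp add: ac_simps)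
  also have "s * (1/2 + 5/4 * s) = 1 - \<rho>" by (simp add: \<rho>)
  finally show ?thesis by (simp add: eval_nat_numeral algebra_simps)
qed

section \<open>The stages of the weights\<close>

definition schedule :: "real \<Rightarrow> real \<Rightarrow> (real \<Rightarrow> real) \<Rightarrow> (real \<Rightarrow> real) \<Rightarrow> (real \<Rightarrow> real) \<Rightarrow> bool" where
  "schedule a e S b k \<longleftrightarrow> 0 \<le> a \<and> {S, b, k} \<subseteq> borel_measurable borel \<and>
     (\<forall>\<theta>\<in>{a..e}. 0 \<le> S \<theta> \<and> 0 \<le> b \<theta> \<and> 0 \<le> k \<theta>) \<and>
     (\<exists>S' b' k'. (\<forall>\<theta>\<in>{a..e}. (S has_real_derivative S' \<theta>) (at \<theta>) \<and> (b has_real_derivative b' \<theta>) (at \<theta>) \<and>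
        (k has_real_derivative k' \<theta>) (at \<theta>)) \<and>
        (\<forall>\<theta>\<in>{a<..<e}. admissible \<theta> (S \<theta>) (b \<theta>) (k \<theta>) (S' \<theta>) (b' \<theta>) (k' \<theta>)))"

lemma scheduleI:
  assumes "0 \<le> a" "S \<in> borel_measurable borel" "b \<in> borel_measurable borel" "k \<in> borel_measurable borel"
    and "\<And>\<theta>. a \<le> \<theta> \<Longrightarrow> \<theta> \<le> e \<Longrightarrow> 0 \<le> S \<theta> \<and> 0 \<le> b \<theta> \<and> 0 \<le> k \<theta>"
    and "\<And>\<theta>. a \<le> \<theta> \<Longrightarrow> \<theta> \<le> e \<Longrightarrow> (S has_real_derivative S' \<theta>) (at \<theta>)"
    and "\<And>\<theta>. a \<le> \<theta> \<Longrightarrow> \<theta> \<le> e \<Longrightarrow> (b has_real_derivative b' \<theta>) (at \<theta>)"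
    and "\<And>\<theta>. a \<le> \<theta> \<Longrightarrow> \<theta> \<le> e \<Longrightarrow> (k has_real_derivative k' \<theta>) (at \<theta>)"
    and "\<And>\<theta>. a < \<theta> \<Longrightarrow> \<theta> < e \<Longrightarrow> admissible \<theta> (S \<theta>) (b \<theta>) (k \<theta>) (S' \<theta>) (b' \<theta>) (k' \<theta>)"
  shows "schedule a e S b k"
  unfolding schedule_def using assms
  by (intro conjI exI[of _ S'] exI[of _ b'] exI[of _ k'] ballI) simp_all

text \<open>The stages are computed in terms of \<open>m\<close>, the excess of \<open>S\<close>
  over \<open>b\<close>.\<close>

lemma admissible_first:
  assumes "c = m - k * (1 - 2 / \<theta>)" "A = m - k * (1 - 2 / \<theta>)\<^sup>2" "d = 4 * k / \<theta> - k'"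
    and "0 \<le> A" "0 \<le> d" "b' \<le> 0" "c\<^sup>2 \<le> d * A" "S' + 2 * (b + m) / \<theta> \<le> 4 * b / \<theta>"
  shows "admissible \<theta> (b + m) b k S' b' k'"
  using assms unfolding admissible_def Let_def by simp

lemma admissible_second:
  assumes "c = m - k * (1 - 2 / \<theta>)" "A = m - k * (1 - 2 / \<theta>)\<^sup>2" "d = 4 * k / \<theta> - k'"
    and "0 \<le> A" "0 \<le> d" "b' \<le> 0" "c\<^sup>2 \<le> - b' * A" "S' + 2 * (b + m) / \<theta> \<le> 4 * b / \<theta> + 4 * c / \<theta>"
  shows "admissible \<theta> (b + m) b k S' b' k'"
  using assms unfolding admissible_def Let_def by simp

text \<open>With \<open>S = b\<close> and \<open>k = 0\<close> every cross term vanishes, and the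
  remaining condition holds with a factor 2 to spare.\<close>

lemma schedule_constant:
  assumes "0 \<le> e"
  shows "schedule 0 e (\<lambda>_. 1) (\<lambda>_. 1) (\<lambda>_. 0)"
proof (rule scheduleI)
  show "admissible \<theta> 1 1 0 0 0 0" if "0 < \<theta>" for \<theta>
    using that by (simp add: admissible_def divide_right_mono)
qed simp_all

text \<open>The weights solve \<open>d = 0\<close> and \<open>c\<^sup>2 = - b' A\<close>.\<close>

lemma schedule_start:
  assumes K: "0 \<le> K" "32 / 3 * K \<le> 1"
  shows "schedule 0 2 (\<lambda>\<theta>. (1 - 8 * K * (2 * \<theta>^3 / 3 - \<theta>^4 / 4)) + K * (8 * \<theta>^2 - 6 * \<theta>^3 + \<theta>^4))
           (\<lambda>\<theta>. 1 - 8 * K * (2 * \<theta>^3 / 3 - \<theta>^4 / 4)) (\<lambda>\<theta>. K * \<theta>^4)"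
proof (rule scheduleI)
  \<comment> \<open>Given \<open>k\<close>, the excess \<open>?m\<close> minimises the loss
    \<open>c^2 / A\<close>, which happens at \<open>c = 2 * A\<close>. It vanishes at 2, so
    \<open>S\<close> and \<open>b\<close> agree again when the stage ends.\<close>
  let ?b = "\<lambda>\<theta>. 1 - 8 * K * (2 * \<theta>^3 / 3 - \<theta>^4 / 4)" and ?m = "\<lambda>\<theta>. K * (8 * \<theta>^2 - 6 * \<theta>^3 + \<theta>^4)"
  have b: "0 \<le> ?b \<theta>" if "0 \<le> \<theta>" "\<theta> \<le> 2" for \<theta>
  proof -
    \<comment> \<open>The bracket in \<open>?b\<close> is largest at 2, with value
      \<open>4 / 3\<close>; the bound on \<open>K\<close> comes from there.\<close>
    have "0 \<le> (2 - \<theta>)^2 * (3 * \<theta>^2 + 4 * \<theta> + 4)" using that by simp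
    then have "2 * \<theta>^3 / 3 - \<theta>^4 / 4 \<le> 4 / 3" by (simp add: eval_nat_numeral algebra_simps)
    then have "8 * K * (2 * \<theta>^3 / 3 - \<theta>^4 / 4) \<le> 8 * K * (4 / 3)" using K by (intro mult_left_mono) auto
    then show ?thesis using K by linarith
  qed
  have m: "?m \<theta> = K * (\<theta>^2 * (2 - \<theta>) * (4 - \<theta>))" for \<theta> by (simp add: eval_nat_numeral algebra_simps)
  show "0 \<le> ?b \<theta> + ?m \<theta> \<and> 0 \<le> ?b \<theta> \<and> 0 \<le> K * \<theta>^4" if "0 \<le> \<theta>" "\<theta> \<le> 2" for \<theta>
    using b[OF that] that K unfolding m by simp
  show "(?b has_real_derivative - (8 * K * (\<theta>^2 * (2 - \<theta>)))) (at \<theta>)" for \<theta>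
    by (auto intro!: derivative_eq_intros simp: eval_nat_numeral algebra_simps)
  show "((\<lambda>\<theta>. ?b \<theta> + ?m \<theta>) has_real_derivative - (8 * K * (\<theta>^2 * (2 - \<theta>))) + K * (16 * \<theta> - 18 * \<theta>^2 + 4 * \<theta>^3)) (at \<theta>)" for \<theta>
    by (auto intro!: derivative_eq_intros simp: eval_nat_numeral algebra_simps)
  show "((\<lambda>\<theta>. K * \<theta>^4) has_real_derivative 4 * K * \<theta>^3) (at \<theta>)" for \<theta>
    by (auto intro!: derivative_eq_intros)
  fix \<theta> :: real assume \<theta>: "0 < \<theta>" "\<theta> < 2"
  show "admissible \<theta> (?b \<theta> + ?m \<theta>) (?b \<theta>) (K * \<theta>^4)
     (- (8 * K * (\<theta>^2 * (2 - \<theta>))) + K * (16 * \<theta> - 18 * \<theta>^2 + 4 * \<theta>^3)) (- (8 * K * (\<theta>^2 * (2 - \<theta>)))) (4 * K * \<theta>^3)"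
  proof (rule admissible_second[where c="4 * K * (\<theta>^2 * (2 - \<theta>))" and A="2 * K * (\<theta>^2 * (2 - \<theta>))" and d=0])
    show "4 * K * (\<theta>^2 * (2 - \<theta>)) = ?m \<theta> - K * \<theta>^4 * (1 - 2 / \<theta>)"
      "2 * K * (\<theta>^2 * (2 - \<theta>)) = ?m \<theta> - K * \<theta>^4 * (1 - 2 / \<theta>)\<^sup>2" "0 = 4 * (K * \<theta>^4) / \<theta> - 4 * K * \<theta>^3"
      using \<theta> by (simp_all add: eval_nat_numeral field_simps)
    show "(4 * K * (\<theta>^2 * (2 - \<theta>)))\<^sup>2 \<le> - (- (8 * K * (\<theta>^2 * (2 - \<theta>)))) * (2 * K * (\<theta>^2 * (2 - \<theta>)))"
      by (simp add: power2_eq_square)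
    have "\<theta> * (- (8 * K * (\<theta>^2 * (2 - \<theta>))) + K * (16 * \<theta> - 18 * \<theta>^2 + 4 * \<theta>^3)) + 2 * (?b \<theta> + ?m \<theta>)
       = 4 * ?b \<theta> + 4 * (4 * K * (\<theta>^2 * (2 - \<theta>))) - (2 * ?b \<theta> + K * \<theta>^3 * (30 - 14 * \<theta>))"
      by (simp add: eval_nat_numeral algebra_simps)
    also have "\<dots> \<le> 4 * ?b \<theta> + 4 * (4 * K * (\<theta>^2 * (2 - \<theta>)))"
    proof -
      have "0 \<le> K * \<theta>^3 * (30 - 14 * \<theta>)" using K \<theta> by simp
      moreover have "0 \<le> ?b \<theta>" using b[of \<theta>] \<theta> by simp
      moreover have "x - (2 * v + w) \<le> x" if "0 \<le> w" "0 \<le> v" for x v w :: real using that by simp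
      ultimately show ?thesis by blast
    qed
    finally have "(\<theta> * (- (8 * K * (\<theta>^2 * (2 - \<theta>))) + K * (16 * \<theta> - 18 * \<theta>^2 + 4 * \<theta>^3)) + 2 * (?b \<theta> + ?m \<theta>)) / \<theta>
      \<le> (4 * ?b \<theta> + 4 * (4 * K * (\<theta>^2 * (2 - \<theta>)))) / \<theta>"
      using \<theta> by (intro divide_right_mono) auto
    then show "- (8 * K * (\<theta>^2 * (2 - \<theta>))) + K * (16 * \<theta> - 18 * \<theta>^2 + 4 * \<theta>^3) + 2 * (?b \<theta> + ?m \<theta>) / \<theta>
      \<le> 4 * ?b \<theta> / \<theta> + 4 * (4 * K * (\<theta>^2 * (2 - \<theta>))) / \<theta>"
      using \<theta> by (simp only: add_divide_distrib nonzero_mult_div_cancel_left less_imp_neq[OF \<theta>(1), symmetric] not_False_eq_True)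
  qed (use K \<theta> in simp_all)
qed measurable

text \<open>Here and on the plateau \<open>k = m * \<theta>^2 / (\<theta>^2 - 4)\<close> with
  \<open>m\<close> the excess of \<open>S\<close> over \<open>b\<close>. Then
  \<open>A = 2 * c\<close>, and the first alternative reduces to \<open>c \<le> 2 * d\<close>, so
  the decay of the \<open>k\<close> term pays for the growth and \<open>b\<close> stays constant.
  Growth can last until \<open>S' + 2 * S / \<theta>\<close> reaches
  \<open>4 * b / \<theta>\<close>, which is the hypothesis on \<tau>.\<close>

lemma schedule_growth:
  assumes K: "0 \<le> K" and b: "0 \<le> b" and \<tau>: "K * (\<tau>^2 * (5 * \<tau> - 8)) \<le> 2 * b"
  shows "schedule 2 \<tau> (\<lambda>\<theta>. b + K * (\<theta>^2 * (\<theta> - 2))) (\<lambda>_. b) (\<lambda>\<theta>. K * \<theta>^4 / (\<theta> + 2))"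
proof (rule scheduleI)
  show "(\<lambda>_. b) \<in> borel_measurable borel" "(\<lambda>\<theta>. b + K * (\<theta>^2 * (\<theta> - 2))) \<in> borel_measurable borel"
    "(\<lambda>\<theta>. K * \<theta>^4 / (\<theta> + 2)) \<in> borel_measurable borel" by measurable
  show "0 \<le> b + K * (\<theta>^2 * (\<theta> - 2)) \<and> 0 \<le> b \<and> 0 \<le> K * \<theta>^4 / (\<theta> + 2)" if "2 \<le> \<theta>" for \<theta>
    using that K b by simp
  show "((\<lambda>_. b) has_real_derivative 0) (at \<theta>)" for \<theta> by simp
  show "((\<lambda>\<theta>. b + K * (\<theta>^2 * (\<theta> - 2))) has_real_derivative K * (3 * \<theta>^2 - 4 * \<theta>)) (at \<theta>)" for \<theta>
    by (auto intro!: derivative_eq_intros simp: power2_eq_square algebra_simps)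
  show "((\<lambda>\<theta>. K * \<theta>^4 / (\<theta> + 2)) has_real_derivative 4 * K * \<theta>^3 / (\<theta> + 2) - K * \<theta>^4 / (\<theta> + 2)^2) (at \<theta>)"
    if "2 \<le> \<theta>" for \<theta>
    using that by (auto intro!: derivative_eq_intros simp: power2_eq_square diff_divide_distrib)
  fix \<theta> :: real assume \<theta>: "2 < \<theta>" "\<theta> < \<tau>"
  define i where "i = 1 / (\<theta> + 2)"
  have i: "0 < i" "i * (\<theta> + 2) = 1" and di: "x / (\<theta> + 2) = x * i" "x / (\<theta> + 2)^2 = x * i^2" for x
    using \<theta> by (simp_all add: i_def power_divide)
  have i': "\<theta> * i = 1 - 2 * i" "\<theta> * (i * x) = x - 2 * (i * x)" for x
    using i(2) by (simp_all add: algebra_simps) (metis distrib_left mult.left_commute mult_1_right mult_2)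
  let ?c = "2 * K * \<theta>^2 * (\<theta> - 2) * i" and ?A = "4 * K * \<theta>^2 * (\<theta> - 2) * i" and ?d = "K * \<theta>^4 * i^2"
  show "admissible \<theta> (b + K * (\<theta>^2 * (\<theta> - 2))) b (K * \<theta>^4 / (\<theta> + 2))
     (K * (3 * \<theta>^2 - 4 * \<theta>)) 0 (4 * K * \<theta>^3 / (\<theta> + 2) - K * \<theta>^4 / (\<theta> + 2)^2)"
    unfolding di
  proof (rule admissible_first[where c="?c" and A="?A" and d="?d"])
    have k1: "K * \<theta>^4 * i * (1 - 2 / \<theta>) = K * \<theta>^2 * (\<theta> - 2) * (\<theta> * i)"
      "K * \<theta>^4 * i * (1 - 2 / \<theta>)\<^sup>2 = K * \<theta>^2 * (\<theta> - 2) * ((\<theta> - 2) * i)"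
      using \<theta> by (simp_all add: eval_nat_numeral field_simps)
    have e: "(\<theta> - 2) * i = 1 - 4 * i" using i'(1) by (simp add: left_diff_distrib)
    show "?c = K * (\<theta>^2 * (\<theta> - 2)) - K * \<theta>^4 * i * (1 - 2 / \<theta>)"
      unfolding k1 i'(1) by (simp only: right_diff_distrib mult_1_right mult_ac)
    show "?A = K * (\<theta>^2 * (\<theta> - 2)) - K * \<theta>^4 * i * (1 - 2 / \<theta>)\<^sup>2"
      unfolding k1 e by (simp only: right_diff_distrib mult_1_right mult_ac)
    show "?d = 4 * (K * \<theta>^4 * i) / \<theta> - (4 * K * \<theta>^3 * i - K * \<theta>^4 * i^2)"
      using \<theta> by (simp add: eval_nat_numeral)
    have "?c\<^sup>2 = 4 * K^2 * \<theta>^4 * (\<theta> - 2) * i^3 * (\<theta>^2 - 4)"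
    proof -
      have "?c\<^sup>2 = 4 * K^2 * \<theta>^4 * (\<theta> - 2) * i^2 * (\<theta> - 2) * (i * (\<theta> + 2))"
      proof -
        have "(2 * K * \<theta>^2 * w * i)\<^sup>2 = 4 * K^2 * \<theta>^4 * w * i^2 * w * 1" for w
          by (simp add: eval_nat_numeral)
        then show ?thesis unfolding i .
      qed
      also have "\<dots> = 4 * K^2 * \<theta>^4 * (\<theta> - 2) * i^3 * ((\<theta> - 2) * (\<theta> + 2))" by (simp only: eval_nat_numeral power_Suc power_0 mult_1_right mult_ac)
      also have "(\<theta> - 2) * (\<theta> + 2) = \<theta>^2 - 4" by (simp add: power2_eq_square algebra_simps)
      finally show ?thesis .
    qed
    also have "\<dots> \<le> 4 * K^2 * \<theta>^4 * (\<theta> - 2) * i^3 * \<theta>^2" using \<theta> i by (intro mult_left_mono) auto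
    also have "\<dots> = ?d * ?A" by (simp add: eval_nat_numeral)
    finally show "?c\<^sup>2 \<le> ?d * ?A" .
    have "\<theta>^2 * (5 * \<theta> - 8) \<le> \<tau>^2 * (5 * \<tau> - 8)" using \<theta> by (intro mult_mono power_mono) auto
    from mult_left_mono[OF this K] have "K * (\<theta>^2 * (5 * \<theta> - 8)) \<le> 2 * b" using \<tau> by linarith
    moreover have "\<theta> * (K * (3 * \<theta>^2 - 4 * \<theta>)) + 2 * (b + K * (\<theta>^2 * (\<theta> - 2))) = 2 * b + K * (\<theta>^2 * (5 * \<theta> - 8))"
      by (simp add: power2_eq_square algebra_simps)
    ultimately have "(\<theta> * (K * (3 * \<theta>^2 - 4 * \<theta>)) + 2 * (b + K * (\<theta>^2 * (\<theta> - 2)))) / \<theta> \<le> (4 * b) / \<theta>"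
      using \<theta> by (intro divide_right_mono) auto
    then show "K * (3 * \<theta>^2 - 4 * \<theta>) + 2 * (b + K * (\<theta>^2 * (\<theta> - 2))) / \<theta> \<le> 4 * b / \<theta>"
      using \<theta> by (simp add: add_divide_distrib)
  qed (use K \<theta> i in simp_all)
qed simp

text \<open>Here \<open>S' + 2 S / \<theta> = 4 b / \<theta>\<close>; the constant \<open>c\<close> makes the weights continuous at \<open>\<tau>\<close> with those
  of the preceding lemma, when equality holds in its last hypothesis.\<close>

lemma schedule_plateau:
  assumes b: "0 \<le> b" and \<tau>: "2 < \<tau>" and c: "c = \<tau>^2 * (3 * \<tau> - 4) / (5 * \<tau> - 8)"
  shows "schedule \<tau> e (\<lambda>\<theta>. b + b * (1 - c / \<theta>^2)) (\<lambda>_. b) (\<lambda>\<theta>. b * (\<theta>^2 - c) / (\<theta>^2 - 4))"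
proof (rule scheduleI)
  have c\<tau>: "0 \<le> 1 - c / \<tau>^2" and c': "(1 - c / \<tau>^2) * (5 * \<tau> - 8) = 2 * (\<tau> - 2)" "c * (5 * \<tau> - 8) = \<tau>^2 * (3 * \<tau> - 4)" "0 \<le> c"
    using \<tau> by (simp_all add: c field_simps)
  have mono: "1 - c / \<tau>^2 \<le> 1 - c / \<theta>^2" if "\<tau> \<le> \<theta>" for \<theta>
    using that \<tau> c'(3) by (intro diff_mono divide_left_mono power_mono) auto
  have sq: "4 < \<theta>^2" if "\<tau> \<le> \<theta>" for \<theta> using that \<tau> power_strict_mono[of 2 \<theta> 2] by simp
  have m: "b * (\<theta>^2 - c) = \<theta>^2 * (b * (1 - c / \<theta>^2))" if "\<tau> \<le> \<theta>" for \<theta> using sq[OF that] by (cases "\<theta> = 0") (simp_all add: algebra_simps)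
  have m0: "0 \<le> b * (1 - c / \<theta>^2)" if "\<tau> \<le> \<theta>" for \<theta> using mono[OF that] c\<tau> b by simp
  show "(\<lambda>_. b) \<in> borel_measurable borel" "(\<lambda>\<theta>. b + b * (1 - c / \<theta>^2)) \<in> borel_measurable borel"
    "(\<lambda>\<theta>. b * (\<theta>^2 - c) / (\<theta>^2 - 4)) \<in> borel_measurable borel" by measurable
  show "0 \<le> b + b * (1 - c / \<theta>^2) \<and> 0 \<le> b \<and> 0 \<le> b * (\<theta>^2 - c) / (\<theta>^2 - 4)" if "\<tau> \<le> \<theta>" for \<theta>
    using m0[OF that] sq[OF that] b unfolding m[OF that] by (auto intro!: divide_nonneg_nonneg mult_nonneg_nonneg)
  show "((\<lambda>_. b) has_real_derivative 0) (at \<theta>)" for \<theta> by simp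
  show "((\<lambda>\<theta>. b + b * (1 - c / \<theta>^2)) has_real_derivative 2 * b * c / \<theta>^3) (at \<theta>)" if "\<tau> \<le> \<theta>" for \<theta>
    using that \<tau> by (auto intro!: derivative_eq_intros simp: eval_nat_numeral)
  show "((\<lambda>\<theta>. b * (\<theta>^2 - c) / (\<theta>^2 - 4)) has_real_derivative 2 * b * \<theta> * (c - 4) / (\<theta>^2 - 4)^2) (at \<theta>)" if "\<tau> \<le> \<theta>" for \<theta>
    using sq[OF that] by (auto intro!: derivative_eq_intros simp: power2_eq_square algebra_simps)
  fix \<theta> :: real assume \<theta>: "\<tau> < \<theta>" "\<theta> < e"
  define m where "m = b * (1 - c / \<theta>^2)"
  have mn: "0 \<le> m" using m0[of \<theta>] \<theta> by (simp add: m_def)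
  have \<theta>2: "2 < \<theta>" using \<theta> \<tau> by simp
  have s4: "\<theta>^2 - 4 = (\<theta> - 2) * (\<theta> + 2)" by (simp add: power2_eq_square algebra_simps)
  let ?k = "b * (\<theta>^2 - c) / (\<theta>^2 - 4)"
  let ?d = "4 * ?k / \<theta> - 2 * b * \<theta> * (c - 4) / (\<theta>^2 - 4)^2"
  have k: "?k = \<theta>^2 * m / ((\<theta> - 2) * (\<theta> + 2))" using m[of \<theta>] \<theta> by (simp add: m_def s4)
  have kn: "?k * (1 - 2 / \<theta>) = m * (\<theta> / (\<theta> + 2))" "?k * (1 - 2 / \<theta>)\<^sup>2 = m * ((\<theta> - 2) / (\<theta> + 2))"
    unfolding k using \<theta>2 by (simp_all add: divide_simps) (simp_all add: power2_eq_square algebra_simps)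
  have d: "m / (\<theta> + 2) \<le> ?d"
  proof -
    \<comment> \<open>The claim follows from
      \<open>2 * (c - 4) \<le> (1 - c / \<theta>^2) * ?\<psi> \<theta>\<close>. Both factors on the
      right increase with \<theta>, so \<tau> is the critical point; there the margin is
      \<open>4 * (\<tau> - 2)^2\<close> up to positive factors.\<close>
    let ?\<psi> = "\<lambda>\<theta>. 3 * \<theta>^2 + 2 * \<theta> - 12 - 8 / \<theta>"
    have "\<tau> * (c * (5 * \<tau> - 8) - 4 * (5 * \<tau> - 8)) + 4 * (\<tau> - 2)^2 = (\<tau> - 2) * (3 * \<tau>^3 + 2 * \<tau>^2 - 12 * \<tau> - 8)"
      unfolding c'(2) by (simp add: eval_nat_numeral algebra_simps)
    also have "3 * \<tau>^3 + 2 * \<tau>^2 - 12 * \<tau> - 8 = \<tau> * ?\<psi> \<tau>"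
      using \<tau> by (simp add: eval_nat_numeral algebra_simps)
    finally have "\<tau> * ((c - 4) * (5 * \<tau> - 8)) \<le> \<tau> * ((\<tau> - 2) * ?\<psi> \<tau>)"
      using zero_le_power2[of "\<tau> - 2"] by (simp only: left_diff_distrib mult.left_commute)
    then have "(c - 4) * (5 * \<tau> - 8) \<le> (\<tau> - 2) * ?\<psi> \<tau>" using \<tau> by simp
    then have "2 * ((c - 4) * (5 * \<tau> - 8)) \<le> 2 * ((\<tau> - 2) * ?\<psi> \<tau>)" by (rule mult_left_mono) simp
    then have "2 * (c - 4) * (5 * \<tau> - 8) \<le> (1 - c / \<tau>^2) * (5 * \<tau> - 8) * ?\<psi> \<tau>"
      unfolding c'(1) by (simp only: mult.assoc)
    then have "2 * (c - 4) * (5 * \<tau> - 8) \<le> ((1 - c / \<tau>^2) * ?\<psi> \<tau>) * (5 * \<tau> - 8)" by (simp only: mult_ac)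
    then have "2 * (c - 4) \<le> (1 - c / \<tau>^2) * ?\<psi> \<tau>"
      by (rule mult_right_le_imp_le) (use \<tau> in simp)
    also have "\<dots> \<le> (1 - c / \<theta>^2) * ?\<psi> \<theta>"
    proof (rule mult_mono)
      have "\<tau>^2 \<le> \<theta>^2" "8 / \<theta> \<le> 8 / \<tau>" using \<theta> \<tau> by (auto intro!: power_mono divide_left_mono)
      then show "?\<psi> \<tau> \<le> ?\<psi> \<theta>" using \<theta> by linarith
      have "8 / \<tau> \<le> 4" using \<tau> by (simp add: field_simps)
      then show "0 \<le> ?\<psi> \<tau>" using sq[of \<tau>] \<tau> by linarith
    qed (use mono[of \<theta>] c\<tau> \<theta> in auto)
    finally have "b * (2 * (c - 4)) \<le> b * ((1 - c / \<theta>^2) * ?\<psi> \<theta>)" using b by (rule mult_left_mono)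
    then have "\<theta> * (b * (2 * (c - 4))) \<le> \<theta> * (b * ((1 - c / \<theta>^2) * ?\<psi> \<theta>))" by (rule mult_left_mono) (use \<theta>2 in simp)
    also have "\<dots> = m * (\<theta> * ?\<psi> \<theta>)" by (simp add: m_def)
    also have "\<theta> * ?\<psi> \<theta> = (\<theta>^2 - 4) * (4 * \<theta> - (\<theta> - 2))"
      using \<theta>2 by (simp add: eval_nat_numeral algebra_simps)
    finally have "2 * b * \<theta> * (c - 4) + m * (\<theta> - 2) * (\<theta>^2 - 4) \<le> 4 * \<theta> * m * (\<theta>^2 - 4)"
      by (simp add: algebra_simps)
    then have "(2 * b * \<theta> * (c - 4) + m * (\<theta> - 2) * (\<theta>^2 - 4)) / (\<theta>^2 - 4)^2 \<le> 4 * \<theta> * m * (\<theta>^2 - 4) / (\<theta>^2 - 4)^2"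
      by (rule divide_right_mono) simp
    moreover have "m * (\<theta> - 2) * (\<theta>^2 - 4) / (\<theta>^2 - 4)^2 = m / (\<theta> + 2)"
      using \<theta>2 unfolding s4 by (simp add: power2_eq_square)
    moreover have "4 * \<theta> * m * (\<theta>^2 - 4) / (\<theta>^2 - 4)^2 = 4 * ?k / \<theta>"
      using \<theta>2 unfolding k unfolding s4 by (simp add: power2_eq_square)
    ultimately show ?thesis by (simp add: add_divide_distrib)
  qed
  show "admissible \<theta> (b + b * (1 - c / \<theta>^2)) b ?k (2 * b * c / \<theta>^3) 0 (2 * b * \<theta> * (c - 4) / (\<theta>^2 - 4)^2)"
    unfolding m_def[symmetric]
  proof (rule admissible_first[where c="2 * m / (\<theta> + 2)" and A="4 * m / (\<theta> + 2)" and d="?d"])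
    show "2 * m / (\<theta> + 2) = m - ?k * (1 - 2 / \<theta>)" "4 * m / (\<theta> + 2) = m - ?k * (1 - 2 / \<theta>)\<^sup>2"
      unfolding kn using \<theta>2 by (simp_all add: field_simps)
    have "(2 * m / (\<theta> + 2))\<^sup>2 = m / (\<theta> + 2) * (4 * m / (\<theta> + 2))" by (simp add: power2_eq_square)
    also have "\<dots> \<le> ?d * (4 * m / (\<theta> + 2))" using d mn \<theta>2 by (intro mult_right_mono) auto
    finally show "(2 * m / (\<theta> + 2))\<^sup>2 \<le> ?d * (4 * m / (\<theta> + 2))" .
    show "0 \<le> ?d" by (rule order_trans[OF _ d]) (use mn \<theta>2 in simp)
    show "2 * b * c / \<theta>^3 + 2 * (b + m) / \<theta> \<le> 4 * b / \<theta>"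
      using \<theta>2 by (simp add: m_def eval_nat_numeral field_simps)
  qed (use mn \<theta>2 in simp_all)
qed (use \<tau> in simp)

text \<open>The last alternative reads \<open>b' \<le> b - S\<close> here. The quadratic part of \<open>b\<close> solves the equation
  to first order at \<open>T1\<close>, and \<open>g\<close> gives equality at \<open>T\<close>.\<close>

lemma schedule_final:
  fixes T T1 b1 D be1 be2 g :: real
  assumes T: "0 < T1" "T1 \<le> T" "T < T1 + 3" and D: "D = T - T1"
    and be: "be1 = b1 - 2 * T1^2 / T^2" "be1 \<le> 0" "be2 = be1 - 4 * T1 / T^2"
    and g: "g = (12 / T^2 - 3 * be2) / (3 - D)"
    and nonneg: "0 \<le> b1 + be1 * D + be2 * D^2 / 2 - g * D^3 / 6"
  shows "schedule T1 T (\<lambda>\<theta>. 2 * \<theta>^2 / T^2)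
    (\<lambda>\<theta>. b1 + be1 * (\<theta> - T1) + be2 * (\<theta> - T1)^2 / 2 - g * (\<theta> - T1)^3 / 6) (\<lambda>_. 0)"
proof (rule scheduleI)
  let ?b = "\<lambda>\<theta>. b1 + be1 * (\<theta> - T1) + be2 * (\<theta> - T1)^2 / 2 - g * (\<theta> - T1)^3 / 6"
    and ?b' = "\<lambda>\<theta>. be1 + be2 * (\<theta> - T1) - g * (\<theta> - T1)^2 / 2"
  have T0: "0 < T" and D3: "0 < 3 - D" "0 \<le> D" using T D by auto
  have "0 \<le> 4 * T1 / T^2" using T by simp
  then have be2: "be2 \<le> 0" using be(2,3) by linarith
  moreover have "0 \<le> 12 / T^2" using T0 by simp
  ultimately have "0 \<le> 12 / T^2 - 3 * be2" by linarith
  then have g0: "0 \<le> g" unfolding g using D3 by simp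
  have gD: "g * (3 - D) = 12 / T^2 - 3 * be2" using D3 by (simp add: g)
  show "?b \<in> borel_measurable borel" "(\<lambda>\<theta>. 2 * \<theta>^2 / T^2) \<in> borel_measurable borel" by measurable
  \<comment> \<open>All three coefficients pull \<open>b\<close> down, so its value at
    \<open>T\<close> is the smallest.\<close>
  have b: "0 \<le> ?b \<theta>" if "T1 \<le> \<theta>" "\<theta> \<le> T" for \<theta>
  proof -
    have v: "\<theta> - T1 \<le> D" "0 \<le> \<theta> - T1" using that D by auto
    have "be1 * D \<le> be1 * (\<theta> - T1)" "be2 * D^2 \<le> be2 * (\<theta> - T1)^2"
      by (rule mult_left_mono_neg[OF v(1) be(2)], rule mult_left_mono_neg[OF power_mono[OF v] be2])
    moreover have "g * (\<theta> - T1)^3 \<le> g * D^3" by (rule mult_left_mono[OF power_mono[OF v] g0])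
    ultimately show ?thesis using nonneg by simp
  qed
  then show "0 \<le> 2 * \<theta>^2 / T^2 \<and> 0 \<le> ?b \<theta> \<and> 0 \<le> (0::real)" if "T1 \<le> \<theta>" "\<theta> \<le> T" for \<theta>
    using that by simp
  show "(?b has_real_derivative ?b' \<theta>) (at \<theta>)" for \<theta>
    by (auto intro!: derivative_eq_intros)
  show "((\<lambda>\<theta>. 2 * \<theta>^2 / T^2) has_real_derivative 4 * \<theta> / T^2) (at \<theta>)" for \<theta>
    using T0 by (auto intro!: derivative_eq_intros simp: eval_nat_numeral)
  fix \<theta> :: real assume \<theta>: "T1 < \<theta>" "\<theta> < T"
  define v where "v = \<theta> - T1"
  have v: "0 \<le> v" "v \<le> D" "\<theta> = T1 + v" using \<theta> D by (auto simp: v_def)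
  define m where "m = 2 * \<theta>^2 / T^2 - ?b \<theta>"
  have m: "m = - be1 - v * be2 + v^2 * (2 / T^2 - be2 / 2) + g * v^3 / 6"
    unfolding m_def v_def[symmetric] unfolding be v(3)
    by (simp add: power2_eq_square algebra_simps add_divide_distrib diff_divide_distrib)
  have "0 \<le> 2 / T^2" using T0 by simp
  then have "0 \<le> 2 / T^2 - be2 / 2" using be2 by linarith
  then have "0 \<le> v^2 * (2 / T^2 - be2 / 2)" "v * be2 \<le> 0" "0 \<le> g * v^3 / 6"
    using v be2 g0 by (simp_all add: mult_nonneg_nonpos)
  then have m0: "0 \<le> m" unfolding m using be(2) by linarith
  \<comment> \<open>This is the slack in \<open>b' \<le> b - S\<close>; by the choice of
    \<open>g\<close> it vanishes at the end \<open>v = D\<close>.\<close>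
  have "0 \<le> v^2 * (g * (D - v) / 6)" using v g0 by simp
  also have "\<dots> = v^2 * (be2 / 2 - 2 / T^2 + g / 2 - g * v / 6)"
  proof -
    have "g * D = 3 * g - 12 / T^2 + 3 * be2" using gD by (simp add: right_diff_distrib)
    then have "g * (D - v) / 6 = be2 / 2 - 2 / T^2 + g / 2 - g * v / 6" by (simp add: right_diff_distrib)
    then show ?thesis by simp
  qed
  finally have b': "?b' \<theta> \<le> - m"
    unfolding m v_def[symmetric] by (simp add: power2_eq_square power3_eq_cube algebra_simps)
  have "admissible \<theta> (?b \<theta> + m) (?b \<theta>) 0 (4 * \<theta> / T^2) (?b' \<theta>) 0"
  proof (rule admissible_second[where c=m and A=m and d=0])
    have "m\<^sup>2 \<le> - x * m" if "x \<le> - m" for x using mult_right_mono[OF that m0] by (simp add: power2_eq_square)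
    from this[OF b'] show "m\<^sup>2 \<le> - ?b' \<theta> * m" .
    have "4 * \<theta> / T^2 + 2 * (2 * \<theta>^2 / T^2) / \<theta> = 4 * (2 * \<theta>^2 / T^2) / \<theta>"
      using \<theta> T by (simp add: power2_eq_square)
    then show "4 * \<theta> / T^2 + 2 * (?b \<theta> + m) / \<theta> \<le> 4 * ?b \<theta> / \<theta> + 4 * m / \<theta>"
      by (simp add: m_def diff_divide_distrib)
  qed (use m0 b' in simp_all)
  then show "admissible \<theta> (2 * \<theta>^2 / T^2) (?b \<theta>) 0 (4 * \<theta> / T^2) (?b' \<theta>) 0" by (simp add: m_def)
qed (use T in simp_all)

section \<open>The accelerated rate\<close>

context least_squares
begin

text \<open>The formula of each stage is differentiable at its endpoints too, which yields the
  continuity on the closed interval.\<close>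

lemma nsuper_schedule:
  assumes "schedule a e S b k" "a = 0 \<Longrightarrow> k 0 = 0"
  shows "nsuper a e (nform S b k)"
proof -
  from assms(1) obtain S' b' k' where
    d: "\<forall>\<theta>\<in>{a..e}. (S has_real_derivative S' \<theta>) (at \<theta>) \<and> (b has_real_derivative b' \<theta>) (at \<theta>) \<and> (k has_real_derivative k' \<theta>) (at \<theta>)"
      "\<forall>\<theta>\<in>{a<..<e}. admissible \<theta> (S \<theta>) (b \<theta>) (k \<theta>) (S' \<theta>) (b' \<theta>) (k' \<theta>)"
    unfolding schedule_def by blast
  show ?thesis
  proof (rule nsuperI[where S'=S' and b'=b' and k'=k'])
    show "continuous_on {a..e} S" "continuous_on {a..e} b" "continuous_on {a..e} k"
      using d(1) by (auto intro!: continuous_at_imp_continuous_on DERIV_isCont)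
  qed (use assms d in \<open>auto simp: schedule_def\<close>)
qed

text \<open>Only the values of the weights at the current time matter for prolonging a certificate.\<close>

definition certified :: "real \<Rightarrow> real \<Rightarrow> real \<Rightarrow> real \<Rightarrow> bool" where
  "certified a s b k \<longleftrightarrow> (\<exists>U. nsuper 0 a U \<and> (\<forall>w. U 0 w \<le> ennreal (R2 / \<kappa>' / 2 * q (snd w))) \<and>
     U (\<kappa>' * a) = nform (\<lambda>_. s) (\<lambda>_. b) (\<lambda>_. k) (\<kappa>' * a))"

lemma nform_at: "nform S b k (\<kappa>' * a) = nform (\<lambda>_. S a) (\<lambda>_. b a) (\<lambda>_. k a) (\<kappa>' * a)"
  using \<kappa>'_pos by (simp add: nform_def form_def fun_eq_iff)

lemma certified_start:
  assumes "schedule 0 e S b k" "b 0 = 1" "k 0 = 0"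
  shows "certified e (S e) (b e) (k e)"
  unfolding certified_def
proof (intro exI conjI allI)
  show "nsuper 0 e (nform S b k)" using assms by (intro nsuper_schedule) auto
  show "nform S b k 0 w \<le> ennreal (R2 / \<kappa>' / 2 * q (snd w))" for w :: "'d state"
    using assms by (simp add: nform_def form_def)
qed (rule nform_at)

lemma certified_extend:
  assumes "certified a s \<beta> \<kappa>" "schedule a c S b k" "0 < a" "a \<le> c" "S a \<le> s" "b a \<le> \<beta>" "k a \<le> \<kappa>"
  shows "certified c (S c) (b c) (k c)"
proof -
  from assms(1) obtain U where U: "nsuper 0 a U" "\<And>w. U 0 w \<le> ennreal (R2 / \<kappa>' / 2 * q (snd w))"
    "U (\<kappa>' * a) = nform (\<lambda>_. s) (\<lambda>_. \<beta>) (\<lambda>_. \<kappa>) (\<kappa>' * a)" by (auto simp: certified_def)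
  have "nsuper a c (nform S b k)" using assms by (intro nsuper_schedule) auto
  moreover have "nform S b k (\<kappa>' * a) w \<le> U (\<kappa>' * a) w" for w
    unfolding U(3) by (rule nform_mono) (use assms in auto)
  ultimately have "nsuper 0 c (\<lambda>u. if u < \<kappa>' * a then U u else nform S b k u)"
    using assms by (intro nsuper_chain U(1)) auto
  moreover have "(if \<kappa>' * c < \<kappa>' * a then U (\<kappa>' * c) else nform S b k (\<kappa>' * c)) = nform (\<lambda>_. S c) (\<lambda>_. b c) (\<lambda>_. k c) (\<kappa>' * c)"
    using assms \<kappa>'_pos by (simp add: nform_at[of S b k c])
  ultimately show ?thesis
    unfolding certified_def using U(2) assms(3) \<kappa>'_pos
    by (intro exI[of _ "\<lambda>u. if u < \<kappa>' * a then U u else nform S b k u"]) auto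
qed

lemma certified_final:
  assumes cert: "certified T1 S1 b1 k1" and T: "0 < T1" "T1 \<le> T" "T < T1 + 3" and D: "D = T - T1"
    and be: "be1 = b1 - 2 * T1^2 / T^2" "be1 \<le> 0" "be2 = be1 - 4 * T1 / T^2"
    and g: "g = (12 / T^2 - 3 * be2) / (3 - D)"
    and nonneg: "0 \<le> b1 + be1 * D + be2 * D^2 / 2 - g * D^3 / 6"
    and S1: "2 * T1^2 / T^2 \<le> S1" and k1: "0 \<le> k1"
  shows "\<exists>b\<ge>0. certified T 2 b 0"
proof -
  have "certified T (2 * T^2 / T^2) (b1 + be1 * (T - T1) + be2 * (T - T1)^2 / 2 - g * (T - T1)^3 / 6) 0"
    by (rule certified_extend[OF cert schedule_final[OF T D be g nonneg]]) (use T S1 k1 in auto)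
  then show ?thesis using nonneg T unfolding D by (intro exI[of _ "b1 + be1 * (T - T1) + be2 * (T - T1)^2 / 2 - g * (T - T1)^3 / 6"]) simp
qed

text \<open>For a short horizon the \<open>k\<close> term can stay 0: the constant weights pass
  directly to the last stage. The amount of \<open>b\<close> spent there grows with
  \<open>T\<close>, hence the limit on \<open>T\<close>.\<close>

lemma certified_short:
  assumes T: "0 < T" "T \<le> 4"
  shows "\<exists>b\<ge>0. certified T 2 b 0"
proof -
  \<comment> \<open>The ratio lies just below \<open>1 / sqrt 2\<close>, so that the value
    \<open>2 * T1^2 / T^2\<close> of \<open>S\<close> at the switch does not exceed the available
    1.\<close>
  define T1 D where "T1 = 705 / 1000 * T" and "D = 295 / 1000 * T"
  define g where "g = (12 / T^2 + 12 * T1 / T^2) / (3 - D)"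
  have D3: "182 / 100 \<le> 3 - D" using T by (simp add: D_def)
  have b1: "2 * T1^2 / T^2 = 2 * (705 / 1000)^2" using T by (simp add: T1_def power2_eq_square)
  then have le1: "2 * T1^2 / T^2 \<le> 1" by (simp add: power2_eq_square)
  have gD: "(3 - D) * g = 12 / T^2 + 12 * T1 / T^2" using D3 by (simp add: g_def)
  have T2: "T * T \<le> 16" using T mult_mono[of T 4 T 4] by simp
  have cert: "certified T1 1 1 0"
    using certified_start[OF schedule_constant[of T1]] T by (simp add: T1_def)
  \<comment> \<open>A stage of length zero lowers both weights to \<open>2 * T1^2 / T^2\<close>; the
    last stage then starts with slope \<open>be1 = 0\<close>, as its sign condition
    requires.\<close>
  have "schedule T1 T1 (\<lambda>_. 2 * T1^2 / T^2) (\<lambda>_. 2 * T1^2 / T^2) (\<lambda>_. 0)"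
    using T by (intro scheduleI[where S'="\<lambda>_. 0" and b'="\<lambda>_. 0" and k'="\<lambda>_. 0"]) (auto simp: T1_def)
  then have cert: "certified T1 (2 * T1^2 / T^2) (2 * T1^2 / T^2) 0"
    by (rule certified_extend[OF cert]) (use T le1 in \<open>auto simp: T1_def\<close>)
  have "(3 - D) * (g * D^3 / 6) = (295 / 1000)^3 * (2 * T + 2 * (705 / 1000) * (T * T))"
  proof -
    have "(3 - D) * (g * D^3 / 6) = (3 - D) * g * D^3 / 6" by simp
    also have "\<dots> = (295 / 1000)^3 * (2 * T + 2 * (705 / 1000) * (T * T))"
      unfolding gD using T by (simp add: D_def T1_def power_mult_distrib power2_eq_square power3_eq_cube field_simps)
    finally show ?thesis .
  qed
  also have "\<dots> \<le> 432 / 1000 * (182 / 100)" using T T2 by (simp add: power3_eq_cube)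
  also have "\<dots> \<le> (3 - D) * (432 / 1000)" using D3 by simp
  finally have 1: "g * D^3 / 6 \<le> 432 / 1000" using D3 by (simp only: mult_le_cancel_left)
  have "(0 - 4 * T1 / T^2) * D^2 / 2 = - (2 * (705 / 1000) * (295 / 1000)^2 * T)"
    using T by (simp add: T1_def D_def power_mult_distrib power2_eq_square)
  moreover have "2 * (705 / 1000) * (295 / 1000)^2 * T \<le> 492 / 1000" using T by (simp add: power2_eq_square)
  ultimately have 2: "0 \<le> 2 * T1^2 / T^2 + 0 * D + (0 - 4 * T1 / T^2) * D^2 / 2 - g * D^3 / 6"
    using 1 unfolding b1 by (simp add: power2_eq_square)
  show ?thesis
    by (rule certified_final[OF cert _ _ _ _ _ _ _ _ 2]) (use T in \<open>auto simp: T1_def D_def g_def\<close>)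
qed

text \<open>The switching times \<open>\<tau>\<close> and \<open>T1\<close>, and the ratio \<open>705 / 1000\<close> above, are numerical choices
  with some slack, not the optimal ones.\<close>

lemma certified_long:
  assumes T: "4 \<le> T"
  shows "\<exists>b\<ge>0. certified T 2 b 0"
proof -
  \<comment> \<open>A larger \<tau> lowers \<open>K\<close> and with it the loss of
    \<open>b\<close>, but raises the deficit \<open>c / T1^2\<close> of the plateau; with
    \<open>\<tau>^2 = 2 * T\<close> that deficit remains of order \<open>1 / T\<close>.\<close>
  define \<tau> where "\<tau> = sqrt (2 * T)"
  define s \<sigma> where "s = 1 / T" and "\<sigma> = 1 / \<tau>"
  define y where "y = 1 / (5 * \<tau> - 8)"
  \<comment> \<open>The start leaves \<open>b = 1 - 8/3 * K\<close>, and growth saturates at \<tau>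
    when \<open>K * (\<tau>^2 * (5 * \<tau> - 8)) = 2 * b\<close>, that is
    \<open>K = b * s * y\<close>. The two equations determine \<open>b\<close>.\<close>
  define b where "b = 1 / (1 + 8/3 * s * y)"
  define K where "K = b * s * y"
  \<comment> \<open>\<open>D\<close> is the length of the last stage and \<rho> is
    \<open>T1 / T\<close>. For large \<open>T\<close> that stage is nearly \<open>b' = b - 2\<close>
    from \<open>b = 1\<close>, which reaches 0 after \<open>ln 2\<close>; the length
    \<open>1/2\<close> stays below that.\<close>
  define D \<rho> where "D = 1/2 + 5/4 * s" and "\<rho> = 1 - s * D"
  define T1 where "T1 = \<rho> * T"
  define c where "c = \<tau>^2 * (3 * \<tau> - 4) / (5 * \<tau> - 8)"
  have \<tau>2: "\<tau>^2 = 2 * T" using T by (simp add: \<tau>_def)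
  have \<tau>: "2.8284 \<le> \<tau>" unfolding \<tau>_def by (rule real_le_rsqrt) (use T in \<open>simp add: power2_eq_square\<close>)
  have s: "0 < s" "s \<le> 1 / 4" "s = 2 * \<sigma>^2" "s * T = 1"
    using T \<tau>2 by (auto simp: s_def \<sigma>_def power_divide field_simps)
  have \<sigma>: "0 \<le> \<sigma>" "\<sigma> \<le> 354 / 1000" "y = \<sigma> / (5 - 8 * \<sigma>)"
    using \<tau> by (auto simp: \<sigma>_def y_def field_simps)
  \<comment> \<open>The bound is \<open>1 / (5 * 2.8284 - 8)\<close> rounded up, with
    \<open>2.8284\<close> just below \<open>sqrt 8\<close>; times \<open>8/3\<close> and rounded up
    it gives the \<open>4343 / 10000\<close> of the last stage.\<close>
  have y: "0 < y" "y \<le> 16282 / 100000" using \<tau> by (auto simp: y_def field_simps)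
  have sy: "0 < s * y" using s y by simp
  have b: "0 < b" "b \<le> 1" "b * (1 + 8/3 * s * y) = 1" using sy by (auto simp: b_def field_simps)
  then have bK: "b = 1 - 8/3 * K" by (simp add: K_def algebra_simps)
  have K: "0 \<le> K" using b s y by (simp add: K_def)
  have K\<tau>: "K * \<tau>^2 = 2 * b * y" using s(4) by (simp add: K_def \<tau>2)
  have c\<tau>: "1 - c / \<tau>^2 = 2 * (\<tau> - 2) * y" using \<tau> by (simp add: c_def y_def field_simps)
  have "s * s \<le> 1/4 * (1/4)" using s by (intro mult_mono) auto
  then have \<rho>: "79 / 100 \<le> \<rho>" "\<rho> \<le> 1" using s by (auto simp: \<rho>_def D_def algebra_simps)
  have T1D: "D = T - T1" using s(4) by (simp add: T1_def \<rho>_def algebra_simps)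
  have \<tau>T1: "\<tau> \<le> T1"
  proof -
    have "0 \<le> (\<tau> - 2.8284) * (\<tau> + 0.8284)" using \<tau> by simp
    then have "\<tau> + 1/2 + 5/16 \<le> T" using \<tau>2 \<tau> by (simp add: power2_eq_square algebra_simps)
    moreover have "D \<le> 1/2 + 5/16" using s by (simp add: D_def)
    ultimately show ?thesis using T1D by simp
  qed
  \<comment> \<open>The two stages meet at 2: in both \<open>S = b\<close>, and \<open>k\<close> is
    \<open>K / 4 * 2^4\<close> in one and \<open>K * 2^4 / (2 + 2)\<close> in the other.\<close>
  have "certified 2 (b + 0) b (16 * (K / 4))"
    using certified_start[OF schedule_start[of "K / 4"]] K b bK by simp
  then have "certified \<tau> (b + K * (\<tau>^2 * (\<tau> - 2))) b (K * \<tau>^4 / (\<tau> + 2))"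
  proof (rule certified_extend[OF _ schedule_growth[OF K less_imp_le[OF b(1)]]])
    show "K * (\<tau>^2 * (5 * \<tau> - 8)) \<le> 2 * b"
      using \<tau> K\<tau> by (simp add: mult.assoc[symmetric]) (simp add: y_def)
  qed (use \<tau> in auto)
  then have "certified T1 (b + b * (1 - c / T1^2)) b (b * (T1^2 - c) / (T1^2 - 4))"
  proof (rule certified_extend[OF _ schedule_plateau[OF less_imp_le[OF b(1)] _ c_def]])
    show "b + b * (1 - c / \<tau>^2) \<le> b + K * (\<tau>^2 * (\<tau> - 2))"
      unfolding c\<tau> mult.assoc[symmetric] K\<tau> by (simp add: ac_simps)
    have "b * (\<tau>^2 - c) / (\<tau>^2 - 4) = b * (\<tau>^2 * (1 - c / \<tau>^2)) / ((\<tau> - 2) * (\<tau> + 2))"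
      using \<tau> by (simp add: right_diff_distrib power2_eq_square algebra_simps)
    also have "\<dots> = K * \<tau>^2 * \<tau>^2 / (\<tau> + 2)"
    proof -
      have e: "b * (\<tau>^2 * (2 * (\<tau> - 2) * y)) = (\<tau> - 2) * (2 * b * y * \<tau>^2)" by (simp only: mult_ac)
      show ?thesis unfolding c\<tau> K\<tau> e using \<tau> by simp
    qed
    finally show "b * (\<tau>^2 - c) / (\<tau>^2 - 4) \<le> K * \<tau>^4 / (\<tau> + 2)" by (simp add: eval_nat_numeral)
  qed (use \<tau> \<tau>T1 in auto)
  then show ?thesis
  proof (rule certified_final)
    have "T1^2 / T^2 = \<rho>^2" "T1 / T^2 = \<rho> * s" using T by (simp_all add: T1_def s_def power2_eq_square)
    then have e: "2 * T1^2 / T^2 = 2 * \<rho>^2" "4 * T1 / T^2 = 4 * \<rho> * s" "12 / T^2 = 12 * s^2" by (simp_all add: s_def power_divide)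
    show "0 < T1" "T1 \<le> T" "T < T1 + 3" using \<tau>T1 \<tau> T1D[unfolded D_def] s(1,2) by auto
    show "D = T - T1" by fact
    show "b - 2 * \<rho>^2 = b - 2 * T1^2 / T^2" "b - 2 * \<rho>^2 - 4 * \<rho> * s = b - 2 * \<rho>^2 - 4 * T1 / T^2" by (simp_all only: e)
    have "79 / 100 * (79 / 100) \<le> \<rho> * \<rho>" using \<rho> by (intro mult_mono) auto
    then show "b - 2 * \<rho>^2 \<le> 0" using b by (simp add: power2_eq_square)
    show "(12 * s^2 - 3 * (b - 2 * \<rho>^2 - 4 * \<rho> * s)) / (3 - D) = (12 / T^2 - 3 * (b - 2 * \<rho>^2 - 4 * \<rho> * s)) / (3 - D)"
      by (simp only: e)
    have "8/3 * (b * (s * y)) \<le> 8/3 * (1 * (s * (16282 / 100000)))"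
      using b s y by (intro mult_left_mono mult_mono) auto
    then have "8/3 * K \<le> 8/3 * (s * (16282 / 100000))" by (simp only: K_def mult.assoc mult_1)
    then have "1 - 4343 / 10000 * s \<le> b" using s(1) bK by linarith
    then show "0 \<le> b + (b - 2 * \<rho>^2) * D + (b - 2 * \<rho>^2 - 4 * \<rho> * s) * D^2 / 2
        - (12 * s^2 - 3 * (b - 2 * \<rho>^2 - 4 * \<rho> * s)) / (3 - D) * D^3 / 6"
      by (rule final_stage_nonneg[OF less_imp_le[OF s(1)] s(2) _ D_def \<rho>_def refl refl refl])
    have cT1: "c / T1^2 = 2 * s * (3/5 + 4/5 * y) / \<rho>^2"
    proof -
      have "(3 * \<tau> - 4) / (5 * \<tau> - 8) = 3/5 + 4/5 * y" using \<tau> by (simp add: y_def field_simps)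
      then have "c = 2 * T * (3/5 + 4/5 * y)" by (simp add: c_def \<tau>2 flip: times_divide_eq_right)
      then show ?thesis using T by (simp add: T1_def s_def power2_eq_square)
    qed
    have "\<rho>^4 * (1 + 8/3 * s * y) \<le> \<rho>^2 - s * (3/5 + 4/5 * y)"
      by (rule calibration[OF \<sigma>(1,2) s(3,2) \<sigma>(3)]) (simp add: \<rho>_def D_def)
    then have "b * (\<rho>^4 * (1 + 8/3 * s * y)) \<le> b * (\<rho>^2 - s * (3/5 + 4/5 * y))"
      using b(1) by (intro mult_left_mono) auto
    then have "\<rho>^4 * (b * (1 + 8/3 * s * y)) \<le> b * (\<rho>^2 - s * (3/5 + 4/5 * y))" by (simp only: mult.left_commute)
    then have "\<rho>^4 / \<rho>^2 \<le> b * (\<rho>^2 - s * (3/5 + 4/5 * y)) / \<rho>^2" unfolding b(3) by (intro divide_right_mono) auto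
    then have "\<rho>^2 \<le> b - b * (s * (3/5 + 4/5 * y)) / \<rho>^2"
      using \<rho> by (simp add: diff_divide_distrib right_diff_distrib eval_nat_numeral)
    moreover have e2: "b * (2 * s * w / r) = 2 * (b * (s * w) / r)" for w r by simp
    ultimately have "2 * \<rho>^2 \<le> 2 * b - b * (2 * s * (3/5 + 4/5 * y) / \<rho>^2)" unfolding e2 by linarith
    then show "2 * T1^2 / T^2 \<le> b + b * (1 - c / T1^2)" unfolding e cT1 by (simp add: right_diff_distrib)
    have "schedule \<tau> T1 (\<lambda>\<theta>. b + b * (1 - c / \<theta>^2)) (\<lambda>_. b) (\<lambda>\<theta>. b * (\<theta>^2 - c) / (\<theta>^2 - 4))"
      by (rule schedule_plateau[OF less_imp_le[OF b(1)] _ c_def]) (use \<tau> in simp)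
    then show "0 \<le> b * (T1^2 - c) / (T1^2 - 4)" using \<tau>T1 by (simp add: schedule_def)
  qed
qed

lemma nesterov_certificate:
  assumes "0 < T"
  obtains U where "nsuper 0 T U" "\<And>w. U 0 w \<le> ennreal (R2 / \<kappa>' / 2 * q (snd w))"
    "\<And>w. ennreal (T^2 / 4 * (norm (fst w))^2) \<le> U (\<kappa>' * T) w"
proof -
  obtain b U where b: "0 \<le> b" and U: "nsuper 0 T U" "\<And>w. U 0 w \<le> ennreal (R2 / \<kappa>' / 2 * q (snd w))"
    "U (\<kappa>' * T) = nform (\<lambda>_. 2) (\<lambda>_. b) (\<lambda>_. 0) (\<kappa>' * T)"
    using certified_short[of T] certified_long[of T] assms unfolding certified_def by (cases "T \<le> 4") auto
  have "ennreal (T^2 / 4 * (norm (fst w))^2) \<le> U (\<kappa>' * T) w" for w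
    unfolding U(3) nform_def form_def using b q_nonneg R2_pos \<kappa>'_pos by (intro ennreal_leI) simp
  with U that show ?thesis by blast
qed

end

theorem theorem4:
  fixes P :: "((real^'d) \<times> real) measure"
    and M :: "'w measure"
    and T :: "nat \<Rightarrow> 'w \<Rightarrow> real"
    and \<xi> :: "nat \<Rightarrow> 'w \<Rightarrow> (real^'d) \<times> real"
    and xstar x0 z0 :: "real^'d"
    and H :: "real^'d^'d"
    and R2 \<kappa>' :: real
  assumes "prob_space P" and "sets P = sets borel"
    and "integrable P (\<lambda>\<xi>. (norm (fst \<xi>))\<^sup>2 *\<^sub>R outer (fst \<xi>))"
    and "\<forall>x. risk P xstar \<le> risk P x"
    and "AE \<xi> in P. snd \<xi> = xstar \<bullet> fst \<xi>"
    and "H = hessian P" and "invertible H"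
    and "smallest_positive
           (\<lambda>r. loewner_le (\<integral>\<xi>. (norm (fst \<xi>))\<^sup>2 *\<^sub>R outer (fst \<xi>) \<partial>P) (r *\<^sub>R H)) R2"
    and "smallest_positive
           (\<lambda>r. loewner_le (\<integral>\<xi>. qnorm2 (matrix_inv H) (fst \<xi>) *\<^sub>R outer (fst \<xi>) \<partial>P) (r *\<^sub>R H)) \<kappa>'"
    and "prob_space M" and "marked_poisson M P T \<xi>"
  shows "(\<forall>x z. continuized_process M T \<xi>
              (\<lambda>t. 2 / t) (\<lambda>t. 0) (\<lambda>t. 1 / R2) (\<lambda>t. t / (2 * R2 * \<kappa>')) x0 z0 x z \<longrightarrow>
            (\<forall>t>0. integrable M (\<lambda>\<omega>. (norm (x t \<omega> - xstar))\<^sup>2) \<and>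
               1/2 * (\<integral>\<omega>. (norm (x t \<omega> - xstar))\<^sup>2 \<partial>M)
                 \<le> R2 * \<kappa>' * qnorm2 (matrix_inv H) (z0 - xstar) / t\<^sup>2)) \<and>
         (\<forall>\<mu> \<kappa> x z. \<mu> > 0 \<longrightarrow> (\<forall>c. eigenvalue H c \<longrightarrow> \<mu> \<le> c) \<longrightarrow> \<kappa> = R2 / \<mu> \<longrightarrow>
            continuized_process M T \<xi>
              (\<lambda>t. 1 / sqrt (\<kappa> * \<kappa>')) (\<lambda>t. 1 / sqrt (\<kappa> * \<kappa>'))
              (\<lambda>t. 1 / R2) (\<lambda>t. 1 / R2 * sqrt (\<kappa> / \<kappa>')) x0 z0 x z \<longrightarrow>
            (\<forall>t\<ge>0. integrable M (\<lambda>\<omega>. (norm (x t \<omega> - xstar))\<^sup>2) \<and>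
               1/2 * (\<integral>\<omega>. (norm (x t \<omega> - xstar))\<^sup>2 \<partial>M)
                 \<le> (1/2 * (norm (x0 - xstar))\<^sup>2 + \<mu>/2 * qnorm2 (matrix_inv H) (z0 - xstar))
                     * exp (- (t / sqrt (\<kappa> * \<kappa>')))))"
proof -
  interpret L: least_squares P H R2 \<kappa>'
    by (intro least_squares.intro least_squares_axioms.intro) (rule assms)+
  have q: "qnorm2 (matrix_inv H) v = L.q v" for v
    by (simp add: qnorm2_def L.q_def)
  show ?thesis
  proof (intro conjI allI impI)
    fix x z t
    assume proc: "continuized_process M T \<xi>
      (\<lambda>t. 2 / t) (\<lambda>t. 0) (\<lambda>t. 1 / R2) (\<lambda>t. t / (2 * R2 * \<kappa>')) x0 z0 x z" and t: "(0::real) < t"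
    obtain U where U: "L.nsuper 0 (t / \<kappa>') U" "\<And>w. U 0 w \<le> ennreal (R2 / \<kappa>' / 2 * L.q (snd w))"
      "\<And>w. ennreal ((t / \<kappa>')^2 / 4 * (norm (fst w))^2) \<le> U (\<kappa>' * (t / \<kappa>')) w"
      using L.nesterov_certificate[of "t / \<kappa>'"] t L.\<kappa>'_pos by auto
    have U3: "ennreal ((t / \<kappa>')^2 / 4 * (norm (fst w))^2) \<le> U t w" for w
      using U(3)[of w] L.\<kappa>'_pos by simp
    have U2: "U 0 (x0 - xstar, z0 - xstar) \<le> ennreal (R2 / \<kappa>' / 2 * L.q (z0 - xstar))"
      using U(2)[of "(x0 - xstar, z0 - xstar)"] by simp
    note r = L.accelerated_rate[OF assms(10,11,5) proc t U(1) U2 U3]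
    show "integrable M (\<lambda>\<omega>. (norm (x t \<omega> - xstar))\<^sup>2)" by (rule r(1))
    show "1/2 * (\<integral>\<omega>. (norm (x t \<omega> - xstar))\<^sup>2 \<partial>M) \<le> R2 * \<kappa>' * qnorm2 (matrix_inv H) (z0 - xstar) / t\<^sup>2"
      unfolding q by (rule r(2))
  next
    fix \<mu> \<kappa> x z t
    assume \<mu>: "0 < \<mu>" "\<forall>c. eigenvalue H c \<longrightarrow> \<mu> \<le> c" "\<kappa> = R2 / \<mu>"
      and proc: "continuized_process M T \<xi>
        (\<lambda>t. 1 / sqrt (\<kappa> * \<kappa>')) (\<lambda>t. 1 / sqrt (\<kappa> * \<kappa>')) (\<lambda>t. 1 / R2) (\<lambda>t. 1 / R2 * sqrt (\<kappa> / \<kappa>')) x0 z0 x z"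
      and t: "(0::real) \<le> t"
    note r = L.strongly_convex_rate[OF assms(10,11,5) \<mu>(1) \<mu>(2)[rule_format] \<mu>(3) proc t]
    show "integrable M (\<lambda>\<omega>. (norm (x t \<omega> - xstar))\<^sup>2)" by (rule r(1))
    show "1/2 * (\<integral>\<omega>. (norm (x t \<omega> - xstar))\<^sup>2 \<partial>M)
      \<le> (1/2 * (norm (x0 - xstar))\<^sup>2 + \<mu>/2 * qnorm2 (matrix_inv H) (z0 - xstar)) * exp (- (t / sqrt (\<kappa> * \<kappa>')))"
      unfolding q by (rule r(2))
  qed
qed


end
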